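(* Let $E$ be an arbitrary graph and $K$ any field. Then every prime ideal of the Leavitt path algebra $L_K(E)$ is primitive if and only if $E$ satisfies Condition (K) and every maximal tail $M$ in $E^0$ satisfies the Countable Separation Property.
   Context: A graph $E=(E^0,E^1,r,s)$ consists of a set $E^0$ of vertices, a set $E^1$ of edges and maps $r,s:E^1\to E^0$ (range and source); no cardinality restrictions are imposed. A vertex $v$ is regular if $0<|s^{-1}(v)|<\infty$. The Leavitt path algebra $L_K(E)$ is the (not necessarily unital) $K$-algebra generated by pairwise orthogonal idempotents $v\in E^0$ and elements $e,e^*$ ($e\in E^1$) subject to: $s(e)e=e=er(e)$; $r(e)e^*=e^*=e^*s(e)$; $e^*e=r(e)$ and $e^*f=0$ for edges $e\ne f$; $v=\sum_{s(e)=v}ee^*$ for every regular vertex $v$. Ideals are two-sided. A proper ideal $P$ is prime if, for ideals $A,B$, $AB\subseteq P$ implies $A\subseteq P$ or $B\subseteq P$. An ideal is primitive if it is the annihilator of a simple module (for ideals of $L_K(E)$, left and right primitivity coincide). A path is a finite sequence of edges $e_1\cdots e_n$ with $r(e_i)=s(e_{i+1})$ (vertices are paths of length $0$). Write $u\ge v$ if there is a path from $u$ to $v$. A cycle based at $v$ is a path $e_1\cdots e_n$ ($n\ge1$) with $s(e_1)=r(e_n)=v$ and $s(e_i)\neq s(e_j)$ for $i\neq j$. $E$ satisfies Condition (K) if no vertex $v$ in $E$ is the base of precisely one cycle, that is, either no cycle is based at $v$ or at least two are based at $v$. A maximal tail in $E^0$ is a subset $M\subseteq E^0$ such that: (MT-1)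 $v\in M$, $u\in E^0$, $u\ge v$ imply $u\in M$; (MT-2) if $v\in M$ is regular there is an edge $e$ with $s(e)=v$ and $r(e)\in M$; (MT-3) for $u,v\in M$ there is $w\in M$ with $u\ge w$ and $v\ge w$. A set $X\subseteq E^0$ has the Countable Separation Property if there is a countable set $C$ of vertices in $E$ such that for each $u\in X$ there is $v\in C$ with $u\ge v$.
   Formalization: Condition (K) counts closed paths that return to their base only at the end, instead of cycles with all sources distinct, and the countable set in the Countable Separation Property of a maximal tail M must lie inside M; with the literal definitions the equivalence fails. *)

theory Defs
  imports
    "HOL-Algebra.Ideal_Product"
    "HOL-Algebra.QuotRing"
    "HOL-Algebra.Module"
    "HOL-Library.Poly_Mapping"
    "HOL-Library.Countable_Set"
    "Graph_Theory.Digraph"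
    "Graph_Theory.Arc_Walk"
begin

section \<open>The Leavitt path algebra of a graph\<close>

text \<open>
  A graph is a \<^locale>\<open>wf_digraph\<close>: \<^const>\<open>verts\<close> and \<^const>\<open>arcs\<close> are arbitrary sets,
  \<^const>\<open>tail\<close> is the source map and \<^const>\<open>head\<close> the range map. Loops, parallel edges,
  infinite emitters and uncountable vertex or edge sets are all allowed.
\<close>

datatype 'x word = Word (letters: "'x list")

instantiation word :: (type) monoid_add
begin

definition zero_word :: "'a word"
  where "0 = Word []"

definition plus_word :: "'a word \<Rightarrow> 'a word \<Rightarrow> 'a word"
  where "u + w = Word (letters u @ letters w)"

instance
  by standard (simp_all add: zero_word_def plus_word_def)

end

text \<open>
  Since addition of words is concatenation, \<^typ>\<open>'x word \<Rightarrow>\<^sub>0 'k\<close> with the convolution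
  product of \<^theory>\<open>HOL-Library.Poly_Mapping\<close> is the free unital associative algebra on
  the letters \<^typ>\<open>'x\<close>. A scalar is a multiple of the empty word.
\<close>

definition free_algebra :: "'x set \<Rightarrow> ('x word \<Rightarrow>\<^sub>0 'k::field) ring"
  where "free_algebra X =
    \<lparr>carrier = {p. \<forall>w \<in> Poly_Mapping.keys p. set (letters w) \<subseteq> X},
     mult = (*), one = 1, zero = 0, add = (+)\<rparr>"

lemma ring_free_algebra: "ring (free_algebra X :: ('x word \<Rightarrow>\<^sub>0 'k::field) ring)" (is "ring ?F")
proof (rule ringI)
  show "abelian_group ?F"
  proof (rule abelian_groupI)
    fix p assume "p \<in> carrier ?F"
    then show "\<exists>q\<in>carrier ?F. q \<oplus>\<^bsub>?F\<^esub> p = \<zero>\<^bsub>?F\<^esub>"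
      by (intro bexI[of _ "- p"]) (auto simp: free_algebra_def)
  next
    fix p q assume "p \<in> carrier ?F" "q \<in> carrier ?F"
    then show "p \<oplus>\<^bsub>?F\<^esub> q \<in> carrier ?F"
      using Poly_Mapping.keys_add[of p q] by (auto simp: free_algebra_def)
  qed (auto simp: free_algebra_def algebra_simps)
  show "Group.monoid ?F"
  proof (rule monoidI)
    fix p q assume "p \<in> carrier ?F" "q \<in> carrier ?F"
    then show "p \<otimes>\<^bsub>?F\<^esub> q \<in> carrier ?F"
      using keys_mult[of p q] by (fastforce simp: free_algebra_def plus_word_def)
  qed (auto simp: free_algebra_def mult.assoc zero_word_def)
qed (auto simp: free_algebra_def algebra_simps)

text \<open>
  The free algebra without unit: no constant terms. The field \<^const>\<open>one\<close> of the record
  is not an element of the carrier. Here and below a ring without unit is an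
  \<^typ>\<open>'a ring\<close> record whose field \<^const>\<open>one\<close> is ignored.
\<close>

definition free_nonunital_algebra :: "'x set \<Rightarrow> ('x word \<Rightarrow>\<^sub>0 'k::field) ring"
  where "free_nonunital_algebra X =
    (free_algebra X)\<lparr>carrier := {p \<in> carrier (free_algebra X). Poly_Mapping.lookup p 0 = 0}\<rparr>"

datatype ('v, 'e) generator = Vertex 'v | Edge 'e | Ghost 'e

definition generators :: "('v, 'e) pre_digraph \<Rightarrow> ('v, 'e) generator set"
  where "generators E = Vertex ` verts E \<union> Edge ` arcs E \<union> Ghost ` arcs E"

type_synonym ('v, 'e, 'k) free_lpa = "('v, 'e) generator word \<Rightarrow>\<^sub>0 'k"

abbreviation vx :: "'v \<Rightarrow> ('v, 'e, 'k::field) free_lpa"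
  where "vx v \<equiv> Poly_Mapping.single (Word [Vertex v]) 1"

abbreviation ed :: "'e \<Rightarrow> ('v, 'e, 'k::field) free_lpa"
  where "ed e \<equiv> Poly_Mapping.single (Word [Edge e]) 1"

abbreviation gh :: "'e \<Rightarrow> ('v, 'e, 'k::field) free_lpa"
  where "gh e \<equiv> Poly_Mapping.single (Word [Ghost e]) 1"

definition regular_vertex :: "('v, 'e) pre_digraph \<Rightarrow> 'v \<Rightarrow> bool"
  where "regular_vertex E v \<longleftrightarrow> v \<in> verts E \<and> finite (out_arcs E v) \<and> out_arcs E v \<noteq> {}"

definition leavitt_relations :: "('v, 'e) pre_digraph \<Rightarrow> ('v, 'e, 'k::field) free_lpa set"
  where "leavitt_relations E =
      {vx v * vx v - vx v | v. v \<in> verts E}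
    \<union> {vx u * vx v | u v. u \<in> verts E \<and> v \<in> verts E \<and> u \<noteq> v}
    \<union> {vx (tail E e) * ed e - ed e | e. e \<in> arcs E}
    \<union> {ed e * vx (head E e) - ed e | e. e \<in> arcs E}
    \<union> {vx (head E e) * gh e - gh e | e. e \<in> arcs E}
    \<union> {gh e * vx (tail E e) - gh e | e. e \<in> arcs E}
    \<union> {gh e * ed e - vx (head E e) | e. e \<in> arcs E}
    \<union> {gh e * ed f | e f. e \<in> arcs E \<and> f \<in> arcs E \<and> e \<noteq> f}
    \<union> {vx v - (\<Sum>e \<in> out_arcs E v. ed e * gh e) | v. regular_vertex E v}"

text \<open>
  The relations have no constant term, so the ideal they generate in the unital free
  algebra lies in the free algebra without unit, and it is the \<open>K\<close>-algebra ideal they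
  generate there: scalars act through the empty word.
\<close>

definition leavitt_path_algebra ::
    "'k::field itself \<Rightarrow> ('v, 'e) pre_digraph \<Rightarrow> ('v, 'e, 'k) free_lpa set ring"
  where "leavitt_path_algebra _ E =
    free_nonunital_algebra (generators E) Quot
      (Idl\<^bsub>free_algebra (generators E)\<^esub> (leavitt_relations E))"


section \<open>Ideals of rings without unit\<close>

text \<open>
  \<^const>\<open>ideal\<close>, \<^const>\<open>primeideal\<close> and \<^const>\<open>module\<close> of \<open>HOL-Algebra\<close> assume a
  (commutative) ring with unit and cannot be used here. The ideals below are ring ideals;
  in a Leavitt path algebra, which has local units, these are closed under scalars.
\<close>

definition two_sided_ideal :: "('a, 'b) ring_scheme \<Rightarrow> 'a set \<Rightarrow> bool"
  where "two_sided_ideal R I \<longleftrightarrow>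
    additive_subgroup I R \<and>
    (\<forall>a \<in> I. \<forall>x \<in> carrier R. x \<otimes>\<^bsub>R\<^esub> a \<in> I \<and> a \<otimes>\<^bsub>R\<^esub> x \<in> I)"

definition prime_ideal :: "('a, 'b) ring_scheme \<Rightarrow> 'a set \<Rightarrow> bool"
  where "prime_ideal R P \<longleftrightarrow>
    two_sided_ideal R P \<and> P \<noteq> carrier R \<and>
    (\<forall>A B. two_sided_ideal R A \<longrightarrow> two_sided_ideal R B \<longrightarrow>
       ideal_prod R A B \<subseteq> P \<longrightarrow> A \<subseteq> P \<or> B \<subseteq> P)"

text \<open>
  Left modules over a ring without unit, as \<open>HOL-Algebra\<close> module records, of which only
  \<^const>\<open>carrier\<close>, \<^const>\<open>add\<close>, \<^const>\<open>zero\<close> and \<^const>\<open>smult\<close> are used.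
\<close>

locale left_module = abelian_group M
  for R :: "('a, 'b) ring_scheme" and M :: "('a, 'm, 'c) module_scheme" (structure) +
  assumes smult_closed:
      "\<lbrakk>a \<in> carrier R; x \<in> carrier M\<rbrakk> \<Longrightarrow> a \<odot> x \<in> carrier M"
    and smult_l_distr:
      "\<lbrakk>a \<in> carrier R; b \<in> carrier R; x \<in> carrier M\<rbrakk> \<Longrightarrow>
        (a \<oplus>\<^bsub>R\<^esub> b) \<odot> x = a \<odot> x \<oplus> b \<odot> x"
    and smult_r_distr:
      "\<lbrakk>a \<in> carrier R; x \<in> carrier M; y \<in> carrier M\<rbrakk> \<Longrightarrow>
        a \<odot> (x \<oplus> y) = a \<odot> x \<oplus> a \<odot> y"
    and smult_assoc:
      "\<lbrakk>a \<in> carrier R; b \<in> carrier R; x \<in> carrier M\<rbrakk> \<Longrightarrow>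
        (a \<otimes>\<^bsub>R\<^esub> b) \<odot> x = a \<odot> (b \<odot> x)"

text \<open>In the absence of a unit, simplicity includes that the action is not zero.\<close>

definition simple_module :: "('a, 'b) ring_scheme \<Rightarrow> ('a, 'm, 'c) module_scheme \<Rightarrow> bool"
  where "simple_module R M \<longleftrightarrow>
    left_module R M \<and>
    (\<exists>a \<in> carrier R. \<exists>x \<in> carrier M. a \<odot>\<^bsub>M\<^esub> x \<noteq> \<zero>\<^bsub>M\<^esub>) \<and>
    (\<forall>N. submodule N R M \<longrightarrow> N = {\<zero>\<^bsub>M\<^esub>} \<or> N = carrier M)"

definition annihilator :: "('a, 'b) ring_scheme \<Rightarrow> ('a, 'm, 'c) module_scheme \<Rightarrow> 'a set"
  where "annihilator R M = {a \<in> carrier R. \<forall>x \<in> carrier M. a \<odot>\<^bsub>M\<^esub> x = \<zero>\<^bsub>M\<^esub>}"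

text \<open>
  Every simple module is of the form \<open>R x\<close>, hence is a quotient of \<open>R\<close> by a left ideal.
  So it is no restriction that the module below has sets of elements of \<open>R\<close> as its
  elements; see lemma \<open>primitive_ideal_annihilator\<close>.
\<close>

definition primitive_ideal :: "('a, 'b) ring_scheme \<Rightarrow> 'a set \<Rightarrow> bool"
  where "primitive_ideal R P \<longleftrightarrow>
    (\<exists>M :: ('a, 'a set) module. simple_module R M \<and> P = annihilator R M)"


lemma primitive_ideal_annihilator:
  fixes R :: "('a, 'b) ring_scheme" and M :: "('a, 'm, 'c) module_scheme"
  assumes R: "abelian_group R"
    and mult: "\<And>a b. a \<in> carrier R \<Longrightarrow> b \<in> carrier R \<Longrightarrow> a \<otimes>\<^bsub>R\<^esub> b \<in> carrier R"
    and M: "simple_module R M"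
  shows "primitive_ideal R (annihilator R M)"
proof -
  interpret R: abelian_group R by (rule R)
  interpret M: left_module R M using M by (simp add: simple_module_def)
  obtain b x where b: "b \<in> carrier R" and x: "x \<in> carrier M" and bx: "b \<odot>\<^bsub>M\<^esub> x \<noteq> \<zero>\<^bsub>M\<^esub>"
    using M by (auto simp: simple_module_def)
  define N where "N = (\<lambda>a. a \<odot>\<^bsub>M\<^esub> x) ` carrier R"
  have zero_act: "\<zero>\<^bsub>R\<^esub> \<odot>\<^bsub>M\<^esub> y = \<zero>\<^bsub>M\<^esub>" if "y \<in> carrier M" for y
  proof -
    have "\<zero>\<^bsub>R\<^esub> \<odot>\<^bsub>M\<^esub> y \<oplus>\<^bsub>M\<^esub> \<zero>\<^bsub>R\<^esub> \<odot>\<^bsub>M\<^esub> y = \<zero>\<^bsub>R\<^esub> \<odot>\<^bsub>M\<^esub> y"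
      using M.smult_l_distr[of "\<zero>\<^bsub>R\<^esub>" "\<zero>\<^bsub>R\<^esub>" y] that by simp
    then show ?thesis
      using M.smult_closed[OF R.zero_closed that] by (metis M.add.r_cancel_one)
  qed
  have neg_act: "\<ominus>\<^bsub>M\<^esub> (a \<odot>\<^bsub>M\<^esub> y) = (\<ominus>\<^bsub>R\<^esub> a) \<odot>\<^bsub>M\<^esub> y" if "a \<in> carrier R" "y \<in> carrier M" for a y
  proof (rule M.minus_equality)
    show "(\<ominus>\<^bsub>R\<^esub> a) \<odot>\<^bsub>M\<^esub> y \<oplus>\<^bsub>M\<^esub> a \<odot>\<^bsub>M\<^esub> y = \<zero>\<^bsub>M\<^esub>"
      using M.smult_l_distr[of "\<ominus>\<^bsub>R\<^esub> a" a y] that by (simp add: R.l_neg zero_act)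
  qed (use that M.smult_closed in auto)
  have "submodule N R M"
  proof (intro submodule.intro submodule_axioms.intro)
    show "subgroup N (add_monoid M)"
    proof (rule M.add.subgroupI)
      show "N \<subseteq> carrier M" using x M.smult_closed by (auto simp: N_def)
      show "N \<noteq> {}" using b by (auto simp: N_def)
      show "\<ominus>\<^bsub>M\<^esub> n \<in> N" if "n \<in> N" for n
        using that x neg_act by (auto simp: N_def)
      show "n \<oplus>\<^bsub>M\<^esub> n' \<in> N" if "n \<in> N" "n' \<in> N" for n n'
        using that x by (auto simp: N_def M.smult_l_distr[symmetric])
    qed
    show "a \<odot>\<^bsub>M\<^esub> n \<in> N" if "a \<in> carrier R" "n \<in> N" for a n
      using that x mult by (auto simp: N_def M.smult_assoc[symmetric])
  qed
  moreover have "N \<noteq> {\<zero>\<^bsub>M\<^esub>}" using b bx by (auto simp: N_def)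
  ultimately have N: "N = carrier M" using M by (auto simp: simple_module_def)
  define f where "f y = {a \<in> carrier R. a \<odot>\<^bsub>M\<^esub> x = y}" for y
  define g where "g = inv_into (carrier M) f"
  have inj: "inj_on f (carrier M)"
  proof (rule inj_onI)
    fix y z assume yz: "y \<in> carrier M" "z \<in> carrier M" "f y = f z"
    then obtain a where "a \<in> f y" unfolding N[symmetric] by (auto simp: N_def f_def)
    with yz show "y = z" by (auto simp: f_def)
  qed
  have gf [simp]: "g (f y) = y" if "y \<in> carrier M" for y
    using that inj by (simp add: g_def)
  define M' :: "('a, 'a set) module" where "M' =
    \<lparr>carrier = f ` carrier M, mult = undefined, one = undefined, zero = f \<zero>\<^bsub>M\<^esub>,
     add = (\<lambda>A B. f (g A \<oplus>\<^bsub>M\<^esub> g B)), smult = (\<lambda>a A. f (a \<odot>\<^bsub>M\<^esub> g A))\<rparr>"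
  have M'_simps [simp]: "carrier M' = f ` carrier M" "\<zero>\<^bsub>M'\<^esub> = f \<zero>\<^bsub>M\<^esub>"
    "A \<oplus>\<^bsub>M'\<^esub> B = f (g A \<oplus>\<^bsub>M\<^esub> g B)" "a \<odot>\<^bsub>M'\<^esub> A = f (a \<odot>\<^bsub>M\<^esub> g A)" for a A B
    by (simp_all add: M'_def)
  have f_eq [simp]: "f y = f z \<longleftrightarrow> y = z" if "y \<in> carrier M" "z \<in> carrier M" for y z
    using inj that by (auto dest: inj_onD)
  have "abelian_group M'"
  proof (rule abelian_groupI)
    fix A assume "A \<in> carrier M'"
    then obtain y where "y \<in> carrier M" "A = f y" by auto
    then show "\<exists>B\<in>carrier M'. B \<oplus>\<^bsub>M'\<^esub> A = \<zero>\<^bsub>M'\<^esub>"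
      by (intro bexI[of _ "f (\<ominus>\<^bsub>M\<^esub> y)"]) (auto simp: M.l_neg)
  qed (auto simp: M.a_ac)
  then interpret M': abelian_group M' .
  have left: "left_module R M'"
    by unfold_locales
      (auto simp: M.smult_closed M.smult_l_distr M.smult_r_distr M.smult_assoc)
  have sub: "S = {\<zero>\<^bsub>M'\<^esub>} \<or> S = carrier M'" if "submodule S R M'" for S
  proof -
    interpret S: submodule S R M' by (rule that)
    have S_carr: "S \<subseteq> f ` carrier M" using S.subset by simp
    have S_eq: "S = f ` (g ` S)" using S_carr by (force simp: image_iff)
    have "submodule (g ` S) R M"
    proof (intro submodule.intro submodule_axioms.intro)
      show "subgroup (g ` S) (add_monoid M)"
      proof (rule M.add.subgroupI)
        show "g ` S \<subseteq> carrier M" using S_carr by auto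
        show "g ` S \<noteq> {}" using S.one_closed by auto
        fix n assume "n \<in> g ` S"
        then obtain y where y: "y \<in> carrier M" "f y \<in> S" "n = y" using S_carr by force
        have "\<ominus>\<^bsub>M'\<^esub> f y = f (\<ominus>\<^bsub>M\<^esub> y)"
          using y by (intro M'.minus_equality) (auto simp: M.l_neg)
        moreover have "\<ominus>\<^bsub>M'\<^esub> f y \<in> S"
          using S.m_inv_closed[OF y(2)] by (simp add: a_inv_def)
        ultimately have "g (f (\<ominus>\<^bsub>M\<^esub> y)) \<in> g ` S" by simp
        then show "\<ominus>\<^bsub>M\<^esub> n \<in> g ` S" using y by simp
        fix n' assume "n' \<in> g ` S"
        then obtain z where z: "z \<in> carrier M" "f z \<in> S" "n' = z" using S_carr by force
        have "f (y \<oplus>\<^bsub>M\<^esub> z) \<in> S" using S.m_closed[OF y(2) z(2)] y z by simp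
        then have "g (f (y \<oplus>\<^bsub>M\<^esub> z)) \<in> g ` S" by (rule imageI)
        then show "n \<oplus>\<^bsub>M\<^esub> n' \<in> g ` S" using y z by simp
      qed
      fix a n assume a: "a \<in> carrier R" and "n \<in> g ` S"
      then obtain y where y: "y \<in> carrier M" "f y \<in> S" "n = y" using S_carr by force
      have "f (a \<odot>\<^bsub>M\<^esub> y) \<in> S" using S.smult_closed[OF a y(2)] y by simp
      then have "g (f (a \<odot>\<^bsub>M\<^esub> y)) \<in> g ` S" by (rule imageI)
      then show "a \<odot>\<^bsub>M\<^esub> n \<in> g ` S" using y a by (simp add: M.smult_closed)
    qed
    then have "g ` S = {\<zero>\<^bsub>M\<^esub>} \<or> g ` S = carrier M" using M by (auto simp: simple_module_def)
    then show ?thesis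
    proof
      assume "g ` S = {\<zero>\<^bsub>M\<^esub>}" then show ?thesis using S_eq by simp
    next
      assume "g ` S = carrier M" then show ?thesis using S_eq by simp
    qed
  qed
  have "\<exists>a \<in> carrier R. \<exists>A \<in> carrier M'. a \<odot>\<^bsub>M'\<^esub> A \<noteq> \<zero>\<^bsub>M'\<^esub>"
    using b x bx by (intro bexI[of _ b] bexI[of _ "f x"]) (auto simp: M.smult_closed)
  with left sub have "simple_module R M'" by (simp add: simple_module_def)
  moreover have "annihilator R M = annihilator R M'"
    by (auto simp: annihilator_def M.smult_closed)
  ultimately show ?thesis unfolding primitive_ideal_def by blast
qed


section \<open>Conditions on the graph\<close>

text \<open>
  The closed paths that count for Condition (K) return to their base \<open>v\<close> only at the end,
  but may repeat other vertices. Requiring all the sources to be distinct would be too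
  strong: for two vertices \<open>v\<close>, \<open>w\<close> and edges \<open>e : v \<rightarrow> w\<close>, \<open>f : w \<rightarrow> v\<close>, \<open>g : w \<rightarrow> w\<close>, the
  path \<open>e f\<close> would then be the only cycle based at \<open>v\<close>, although the Leavitt path algebra
  of this graph is simple.
\<close>

definition simple_closed_path :: "('v, 'e) pre_digraph \<Rightarrow> 'v \<Rightarrow> 'e list \<Rightarrow> bool"
  where "simple_closed_path E v p \<longleftrightarrow>
    p \<noteq> [] \<and> pre_digraph.awalk E v p v \<and> (\<forall>e \<in> set (tl p). tail E e \<noteq> v)"

definition condition_K :: "('v, 'e) pre_digraph \<Rightarrow> bool"
  where "condition_K E \<longleftrightarrow> (\<forall>v \<in> verts E. \<not> (\<exists>!p. simple_closed_path E v p))"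

definition maximal_tail :: "('v, 'e) pre_digraph \<Rightarrow> 'v set \<Rightarrow> bool"
  where "maximal_tail E M \<longleftrightarrow>
    M \<subseteq> verts E \<and>
    (\<forall>v \<in> M. \<forall>u \<in> verts E. u \<rightarrow>\<^sup>*\<^bsub>E\<^esub> v \<longrightarrow> u \<in> M) \<and>
    (\<forall>v \<in> M. regular_vertex E v \<longrightarrow> (\<exists>e \<in> arcs E. tail E e = v \<and> head E e \<in> M)) \<and>
    (\<forall>u \<in> M. \<forall>v \<in> M. \<exists>w \<in> M. u \<rightarrow>\<^sup>*\<^bsub>E\<^esub> w \<and> v \<rightarrow>\<^sup>*\<^bsub>E\<^esub> w)"

text \<open>
  The countable set is taken inside \<open>X\<close>, as it is for the graph with vertex set \<open>X\<close>. With
  arbitrary vertices of \<open>E\<close> the property would be too weak: let \<open>E\<close> have the finite subsets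
  of an uncountable set as vertices, an edge from \<open>A\<close> to \<open>B\<close> if \<open>A \<subset> B\<close>, and one more vertex,
  a sink \<open>z\<close> that receives an edge from every \<open>A\<close>. Then \<open>{z}\<close> would separate the maximal
  tail of all finite subsets, although the ideal generated by \<open>z\<close> is prime and not primitive.
\<close>

definition countable_separation :: "('v, 'e) pre_digraph \<Rightarrow> 'v set \<Rightarrow> bool"
  where "countable_separation E X \<longleftrightarrow>
    (\<exists>C. countable C \<and> C \<subseteq> X \<and> (\<forall>u \<in> X. \<exists>v \<in> C. u \<rightarrow>\<^sup>*\<^bsub>E\<^esub> v))"

end

theory Submission
  imports Defs
begin

text \<open>
  Let \<open>P\<close> be a prime ideal and \<open>M\<close> the maximal tail of the vertices outside \<open>P\<close>. If some vertex
  \<open>u\<close> of \<open>M\<close> emits only finitely many edges \<open>e\<close> into \<open>M\<close> and \<open>g = u - \<Sum> e e\<^sup>*\<close> is not in \<open>P\<close>, then the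
  corner of \<open>g\<close> modulo \<open>P\<close> is \<open>K g\<close> and the quotient has a minimal left ideal with annihilator
  \<open>P\<close>. Otherwise, under Condition (K), every ideal that properly contains \<open>P\<close> contains a
  vertex of \<open>M\<close>. The Countable Separation Property then provides paths \<open>p\<^sub>0, p\<^sub>1, \<dots>\<close>, each one
  extending the previous one, such that every vertex of \<open>M\<close> reaches the end of some \<open>p\<^sub>n\<close>. A maximal left
  ideal of \<open>L w\<close> that contains all \<open>w - p\<^sub>n p\<^sub>n\<^sup>*\<close>, where \<open>w\<close> is the source of the paths, yields a simple module
  with annihilator \<open>P\<close>.

  Conversely, if \<open>v\<close> is the base of exactly one simple closed path \<open>c\<close>, the corner of \<open>v\<close> maps onto
  the Laurent polynomials in \<open>c\<close>, and the kernel of the action that this induces is prime but not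
  primitive. Every nonempty maximal tail \<open>M\<close> is the set of vertices outside some prime ideal, namely
  of an ideal maximal among those that meet the vertices exactly in the complement of \<open>M\<close>. If
  this ideal is primitive, a fixed vector of a simple module relates the vertices of \<open>M\<close> so tightly that a
  countable set of vertices closed under the resulting operations separates \<open>M\<close>.
\<close>

section \<open>Ideals of a quotient of a ring with local units\<close>

text \<open>No basis of the Leavitt path algebra is constructed. Wherever elements have to be
  written out, it suffices that the products \<open>p q\<^sup>*\<close> of a real and a ghost path
  span. An element that must be nonzero is either assumed to lie outside a given ideal or detected
  by a branching system, an explicit action on functions. Linear independence is used only in the
  free algebra, where it is a matter of coefficients.

  The algebra has no unit and a simple module is awkward to carry around, so the module is traded
  for the annihilator of one of its vectors. Everything then happens inside one type with ordinary
  ring operations, modulo the ideal of relations.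

  The elements \<open>g\<close> of the overview are needed because vertices alone do not determine
  an ideal: two ideals with the same vertices can differ at a vertex that emits infinitely many
  edges, of which only finitely many lead into \<open>M\<close>. Condition (K) excludes the other
  source of larger ideals without new vertices, namely polynomials in a closed path that has no exit
  in the quotient.\<close>

definition additive_closed :: "'r::ring set \<Rightarrow> bool"
  where "additive_closed I \<longleftrightarrow> 0 \<in> I \<and> (\<forall>x\<in>I. \<forall>y\<in>I. x - y \<in> I)"

lemma additive_closedD:
  assumes "additive_closed I"
  shows additive_closed_zero: "0 \<in> I"
    and additive_closed_diff: "x \<in> I \<Longrightarrow> y \<in> I \<Longrightarrow> x - y \<in> I"
    and additive_closed_uminus: "x \<in> I \<Longrightarrow> - x \<in> I"
    and additive_closed_add: "x \<in> I \<Longrightarrow> y \<in> I \<Longrightarrow> x + y \<in> I"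
proof -
  show 0: "0 \<in> I" and 1: "x \<in> I \<Longrightarrow> y \<in> I \<Longrightarrow> x - y \<in> I" for x y
    using assms by (auto simp: additive_closed_def)
  show 2: "x \<in> I \<Longrightarrow> - x \<in> I" for x using 1[OF 0, of x] by simp
  show "x \<in> I \<Longrightarrow> y \<in> I \<Longrightarrow> x + y \<in> I" using 1[OF _ 2, of x y] by simp
qed

lemma additive_closed_sum:
  assumes "additive_closed I" "\<And>i. i \<in> S \<Longrightarrow> f i \<in> I"
  shows "sum f S \<in> I"
  using assms(2)
  by (induction S rule: infinite_finite_induct)
    (auto intro: additive_closed_add[OF assms(1)] additive_closed_zero[OF assms(1)])

lemma additive_closed_cong:
  assumes "additive_closed I" "x - y \<in> I"
  shows "x \<in> I \<longleftrightarrow> y \<in> I"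
  using additive_closed_diff[OF assms(1), of x "x - y"] additive_closed_add[OF assms(1), of "x - y" y]
    assms(2) by auto

definition coset_of :: "'r::ring set \<Rightarrow> 'r \<Rightarrow> 'r set"
  where "coset_of I a = {x. x - a \<in> I}"

lemma coset_of_eq_iff:
  assumes "additive_closed I"
  shows "coset_of I a = coset_of I b \<longleftrightarrow> a - b \<in> I"
proof
  assume "coset_of I a = coset_of I b"
  moreover have "a \<in> coset_of I a" using additive_closed_zero[OF assms] by (simp add: coset_of_def)
  ultimately show "a - b \<in> I" by (auto simp: coset_of_def)
next
  assume ab: "a - b \<in> I"
  have "x - a \<in> I \<longleftrightarrow> x - b \<in> I" for x
    using additive_closed_cong[OF assms, of "x - b" "x - a"] ab by simp
  then show "coset_of I a = coset_of I b" by (simp add: coset_of_def)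
qed

text \<open>\<open>L\<close> is the quotient of \<open>A\<close> by \<open>N\<close>, described
  through representatives: an ideal of \<open>L\<close> becomes a subset of \<open>A\<close> that
  contains \<open>N\<close>, and computation happens in the surrounding type class ring, whose
  \<open>1\<close> need not belong to \<open>A\<close>. The local units depend on the element and
  are only asked for modulo \<open>N\<close>.\<close>

locale local_unit_quotient =
  fixes A N :: "'r::ring set" and L :: "'r set ring"
  assumes A_add: "additive_closed A"
    and A_mult: "a \<in> A \<Longrightarrow> b \<in> A \<Longrightarrow> a * b \<in> A"
    and N_add: "additive_closed N"
    and N_sub: "N \<subseteq> A"
    and N_left: "a \<in> A \<Longrightarrow> x \<in> N \<Longrightarrow> a * x \<in> N"
    and N_right: "a \<in> A \<Longrightarrow> x \<in> N \<Longrightarrow> x * a \<in> N"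
    and left_unit: "x \<in> A \<Longrightarrow> \<exists>u\<in>A. u * x - x \<in> N"
    and right_unit: "x \<in> A \<Longrightarrow> \<exists>u\<in>A. x * u - x \<in> N"
    and L_carrier: "carrier L = coset_of N ` A"
    and L_zero: "\<zero>\<^bsub>L\<^esub> = coset_of N 0"
    and L_plus: "a \<in> A \<Longrightarrow> b \<in> A \<Longrightarrow> coset_of N a \<oplus>\<^bsub>L\<^esub> coset_of N b = coset_of N (a + b)"
    and L_times: "a \<in> A \<Longrightarrow> b \<in> A \<Longrightarrow> coset_of N a \<otimes>\<^bsub>L\<^esub> coset_of N b = coset_of N (a * b)"
begin

lemmas A_zero = additive_closed_zero[OF A_add]
lemmas A_diff = additive_closed_diff[OF A_add]
lemmas A_plus = additive_closed_add[OF A_add]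
lemmas A_uminus = additive_closed_uminus[OF A_add]
lemmas A_closed = A_zero A_diff A_plus A_uminus A_mult
lemmas coset_eq = coset_of_eq_iff[OF N_add]

definition left_ideal :: "'r set \<Rightarrow> bool"
  where "left_ideal T \<longleftrightarrow> additive_closed T \<and> N \<subseteq> T \<and> T \<subseteq> A \<and> (\<forall>a\<in>A. \<forall>x\<in>T. a * x \<in> T)"

definition bi_ideal :: "'r set \<Rightarrow> bool"
  where "bi_ideal T \<longleftrightarrow> left_ideal T \<and> (\<forall>a\<in>A. \<forall>x\<in>T. x * a \<in> T)"

definition elementwise_prime :: "'r set \<Rightarrow> bool"
  where "elementwise_prime P \<longleftrightarrow> bi_ideal P \<and> P \<noteq> A \<and>
    (\<forall>x\<in>A. \<forall>y\<in>A. (\<forall>a\<in>A. x * a * y \<in> P) \<longrightarrow> x \<in> P \<or> y \<in> P)"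

text \<open>
  Here \<open>T\<close> is the annihilator of a nonzero vector \<open>s\<close> of a simple module, and \<open>w s = s\<close>.
\<close>

definition modular_maximal :: "'r set \<Rightarrow> 'r \<Rightarrow> bool"
  where "modular_maximal T w \<longleftrightarrow> left_ideal T \<and> w \<in> A \<and> w \<notin> T \<and>
    (\<forall>x\<in>A. x - x * w \<in> T) \<and> (\<forall>y\<in>A. y \<notin> T \<longrightarrow> (\<exists>b\<in>A. b * y - w \<in> T))"

text \<open>The annihilator of the module \<open>A\<close> modulo \<open>T\<close>.\<close>

definition core :: "'r set \<Rightarrow> 'r set"
  where "core T = {a\<in>A. \<forall>b\<in>A. a * b \<in> T}"

lemma left_idealD:
  assumes "left_ideal T"
  shows "additive_closed T" "N \<subseteq> T" "T \<subseteq> A" "a \<in> A \<Longrightarrow> x \<in> T \<Longrightarrow> a * x \<in> T"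
  using assms by (auto simp: left_ideal_def)

lemma bi_idealD:
  assumes "bi_ideal T"
  shows "left_ideal T" "additive_closed T" "N \<subseteq> T" "T \<subseteq> A" "a \<in> A \<Longrightarrow> x \<in> T \<Longrightarrow> a * x \<in> T"
    "a \<in> A \<Longrightarrow> x \<in> T \<Longrightarrow> x * a \<in> T"
  using assms by (auto simp: bi_ideal_def left_ideal_def)

lemma elementwise_primeD:
  assumes "elementwise_prime P"
  shows "bi_ideal P" "P \<noteq> A"
    "\<lbrakk>x \<in> A; y \<in> A; x \<notin> P; y \<notin> P\<rbrakk> \<Longrightarrow> \<exists>a\<in>A. x * a * y \<notin> P"
  using assms by (auto simp: elementwise_prime_def)

lemma modular_maximalD:
  assumes "modular_maximal T w"
  shows "left_ideal T" "w \<in> A" "w \<notin> T" "x \<in> A \<Longrightarrow> x - x * w \<in> T"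
    "y \<in> A \<Longrightarrow> y \<notin> T \<Longrightarrow> \<exists>b\<in>A. b * y - w \<in> T"
  using assms by (auto simp: modular_maximal_def)

lemma bi_ideal_N: "bi_ideal N"
  using N_add N_sub N_left N_right by (auto simp: bi_ideal_def left_ideal_def)

text \<open>These two ideals turn a product of elements into a product of ideals: if
  \<open>B\<close> is the first one, then \<open>B\<close> times the second one lies in
  \<open>P\<close>. Callers that only want the first ideal supply \<open>N\<close> for
  \<open>B\<close>.\<close>

lemma left_annihilator_mod:
  assumes "bi_ideal P" "y \<in> A" "bi_ideal B"
  shows "bi_ideal {a\<in>A. \<forall>b\<in>A. a * b * y \<in> P}" (is "bi_ideal ?X")
    and "P \<subseteq> {a\<in>A. \<forall>b\<in>A. a * b * y \<in> P}"
    and "bi_ideal {b\<in>A. \<forall>a\<in>B. a * b \<in> P}" (is "bi_ideal ?Y")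
    and "P \<subseteq> {b\<in>A. \<forall>a\<in>B. a * b \<in> P}"
proof -
  note P = bi_idealD[OF assms(1)] and B = bi_idealD[OF assms(3)]
  have add: "additive_closed ?X" "additive_closed ?Y"
    using P(2) A_add unfolding additive_closed_def by (auto simp: left_diff_distrib right_diff_distrib)
  show PX: "P \<subseteq> ?X" using P(4) P(6) assms(2) by auto
  show PY: "P \<subseteq> ?Y" using P(4) P(5) B(4) by blast
  have "c * a \<in> ?X" "a * c \<in> ?X" if "c \<in> A" "a \<in> ?X" for c a
    using that P(5) A_mult[OF that(1)] A_mult[OF _ that(1)]
    by (auto simp: mult.assoc) (metis mult.assoc)
  then show "bi_ideal ?X"
    unfolding bi_ideal_def left_ideal_def using add PX P(3) by auto
  have "c * b \<in> ?Y" "b * c \<in> ?Y" if "c \<in> A" "b \<in> ?Y" for c b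
  proof -
    have "a * (c * b) \<in> P" if "a \<in> B" for a
      using B(6)[OF \<open>c \<in> A\<close> that] \<open>b \<in> ?Y\<close> by (auto simp: mult.assoc[symmetric])
    moreover have "a * (b * c) \<in> P" if "a \<in> B" for a
      using P(6)[OF \<open>c \<in> A\<close>, of "a * b"] \<open>b \<in> ?Y\<close> that by (auto simp: mult.assoc[symmetric])
    ultimately show "c * b \<in> ?Y" "b * c \<in> ?Y" using that A_mult by auto
  qed
  then show "bi_ideal ?Y"
    unfolding bi_ideal_def left_ideal_def using add PY P(3) by auto
qed

subsection \<open>Passing between the quotient ring and its cover\<close>

lemma L_abelian_group: "abelian_group L"
proof (rule abelian_groupI)
  fix X assume "X \<in> carrier L"
  then obtain a where "a \<in> A" "X = coset_of N a" by (auto simp: L_carrier)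
  then show "\<exists>Y\<in>carrier L. Y \<oplus>\<^bsub>L\<^esub> X = \<zero>\<^bsub>L\<^esub>"
    by (intro bexI[of _ "coset_of N (- a)"]) (auto simp: L_carrier L_zero L_plus A_closed)
qed (auto simp: L_carrier L_zero L_plus A_closed add_ac)

lemma L_mult_closed: "X \<in> carrier L \<Longrightarrow> Y \<in> carrier L \<Longrightarrow> X \<otimes>\<^bsub>L\<^esub> Y \<in> carrier L"
  by (auto simp: L_carrier L_times A_closed)

lemma L_uminus: "a \<in> A \<Longrightarrow> \<ominus>\<^bsub>L\<^esub> coset_of N a = coset_of N (- a)"
  by (rule abelian_group.minus_equality[OF L_abelian_group])
    (auto simp: L_carrier L_zero L_plus A_closed)

definition pull :: "'r set set \<Rightarrow> 'r set"
  where "pull J = {a\<in>A. coset_of N a \<in> J}"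

lemma bi_ideal_pull:
  assumes "two_sided_ideal L J"
  shows "bi_ideal (pull J)" and "J = coset_of N ` pull J"
proof -
  have sub: "subgroup J (add_monoid L)"
    using assms by (auto simp: two_sided_ideal_def additive_subgroup_def)
  interpret L: abelian_group L by (rule L_abelian_group)
  have carr: "J \<subseteq> carrier L" using subgroup.subset[OF sub] by simp
  show eq: "J = coset_of N ` pull J" using carr by (auto simp: pull_def L_carrier)
  have zero: "coset_of N 0 \<in> J" using subgroup.one_closed[OF sub] by (simp add: L_zero)
  have diff: "coset_of N (a - b) \<in> J" if "a \<in> A" "b \<in> A" "coset_of N a \<in> J" "coset_of N b \<in> J" for a b
  proof -
    have "\<ominus>\<^bsub>L\<^esub> coset_of N b \<in> J"
      using subgroup.m_inv_closed[OF sub that(4)] by (simp add: a_inv_def)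
    then have "coset_of N (- b) \<in> J" using that by (simp add: L_uminus)
    from subgroup.m_closed[OF sub that(3) this] show ?thesis
      using that by (simp add: L_plus A_closed)
  qed
  have "coset_of N a = coset_of N 0" if "a \<in> N" for a
    using that by (simp add: coset_eq)
  then have "N \<subseteq> pull J" using zero N_sub by (auto simp: pull_def)
  moreover have "additive_closed (pull J)"
    using zero diff A_closed by (auto simp: additive_closed_def pull_def)
  moreover have "c * a \<in> pull J" "a * c \<in> pull J" if "c \<in> A" "a \<in> pull J" for c a
    using assms that A_mult unfolding two_sided_ideal_def pull_def
    by (auto simp: L_carrier simp flip: L_times)
  ultimately show "bi_ideal (pull J)"
    by (auto simp: bi_ideal_def left_ideal_def) (auto simp: pull_def)
qed

lemma coset_in_image_iff:
  assumes "left_ideal I" "a \<in> A"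
  shows "coset_of N a \<in> coset_of N ` I \<longleftrightarrow> a \<in> I"
proof
  assume "coset_of N a \<in> coset_of N ` I"
  then obtain b where b: "b \<in> I" "a - b \<in> N" by (auto simp: coset_eq)
  then show "a \<in> I" using additive_closed_cong[of I a b] left_idealD[OF assms(1)] by auto
qed auto

lemma pull_image:
  assumes "left_ideal I"
  shows "pull (coset_of N ` I) = I"
  using coset_in_image_iff[OF assms] left_idealD(3)[OF assms] by (auto simp: pull_def)

lemma two_sided_ideal_image:
  assumes "bi_ideal I"
  shows "two_sided_ideal L (coset_of N ` I)"
proof -
  note I = bi_idealD[OF assms]
  interpret L: abelian_group L by (rule L_abelian_group)
  have "subgroup (coset_of N ` I) (add_monoid L)"
  proof (rule L.add.subgroupI)
    show "coset_of N ` I \<subseteq> carrier L" using I(4) by (auto simp: L_carrier)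
    show "coset_of N ` I \<noteq> {}" using additive_closed_zero[OF I(2)] by auto
    show "\<ominus>\<^bsub>L\<^esub> X \<in> coset_of N ` I" if "X \<in> coset_of N ` I" for X
      using that I(4) additive_closed_uminus[OF I(2)] by (auto simp: L_uminus subset_iff)
    show "X \<oplus>\<^bsub>L\<^esub> Y \<in> coset_of N ` I" if "X \<in> coset_of N ` I" "Y \<in> coset_of N ` I" for X Y
      using that I(4) additive_closed_add[OF I(2)] by (auto simp: L_plus subset_iff)
  qed
  then show ?thesis
    using I(4,5,6) by (auto simp: two_sided_ideal_def additive_subgroup_def L_carrier L_times subset_iff)
qed

text \<open>If \<open>x A y\<close> lies in the ideal, two ideals \<open>B\<close> and
  \<open>C\<close> with product inside it are formed. That \<open>x\<close> is in \<open>B\<close>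
  is immediate; that \<open>y\<close> is in \<open>C\<close> takes a local unit \<open>u\<close> of
  \<open>y\<close>, since membership in \<open>B\<close> only controls products
  \<open>a * u * y\<close> with a factor in between.\<close>

lemma elementwise_prime_pull:
  assumes "prime_ideal L J"
  shows "elementwise_prime (pull J)"
proof -
  have ts: "two_sided_ideal L J" and ne: "J \<noteq> carrier L"
    and pr: "\<And>B C. two_sided_ideal L B \<Longrightarrow> two_sided_ideal L C \<Longrightarrow> ideal_prod L B C \<subseteq> J \<Longrightarrow> B \<subseteq> J \<or> C \<subseteq> J"
    using assms by (auto simp: prime_ideal_def)
  note bi = bi_ideal_pull[OF ts]
  note P = bi_idealD[OF bi(1)]
  have "x \<in> pull J \<or> y \<in> pull J" if x: "x \<in> A" and y: "y \<in> A" and xy: "\<forall>a\<in>A. x * a * y \<in> pull J" for x y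
  proof -
    define B where "B = {a\<in>A. \<forall>b\<in>A. a * b * y \<in> pull J}"
    have B: "bi_ideal B" unfolding B_def by (rule left_annihilator_mod[OF bi(1) y bi_ideal_N])
    define C where "C = {b\<in>A. \<forall>a\<in>B. a * b \<in> pull J}"
    have C: "bi_ideal C" unfolding C_def by (rule left_annihilator_mod[OF bi(1) y B])
    have "X \<in> J" if "X \<in> ideal_prod L (coset_of N ` B) (coset_of N ` C)" for X
      using that
    proof induction
      case (prod X Y)
      then show ?case by (auto simp: B_def C_def pull_def L_times)
    next
      case (sum X Y)
      then show ?case using ts by (auto simp: two_sided_ideal_def additive_subgroup.a_closed)
    qed
    then have "coset_of N ` B \<subseteq> J \<or> coset_of N ` C \<subseteq> J"
      using pr two_sided_ideal_image[OF B] two_sided_ideal_image[OF C] by blast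
    moreover have "x \<in> B" using x xy by (simp add: B_def)
    moreover have "y \<in> C"
    proof -
      obtain u where u: "u \<in> A" "u * y - y \<in> N" using left_unit[OF y] by blast
      have "a * y \<in> pull J" if a: "a \<in> B" for a
      proof -
        have aA: "a \<in> A" using a by (auto simp: B_def)
        have "a * (u * y - y) \<in> pull J" using u P(3) N_left[OF aA] by auto
        moreover have "a * u * y \<in> pull J" using a u by (auto simp: B_def)
        ultimately show ?thesis
          using additive_closed_cong[OF P(2), of "a * u * y" "a * y"] by (simp add: algebra_simps)
      qed
      then show ?thesis using y by (simp add: C_def)
    qed
    ultimately show ?thesis using x y by (auto simp: pull_def)
  qed
  moreover have "pull J \<noteq> A"
    using ne bi(2) by (metis L_carrier)
  ultimately show ?thesis using bi(1) by (auto simp: elementwise_prime_def)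
qed

lemma prime_ideal_image:
  assumes "elementwise_prime P"
  shows "prime_ideal L (coset_of N ` P)"
proof -
  note pr = elementwise_primeD[OF assms]
  note P = bi_idealD[OF pr(1)]
  have "B \<subseteq> coset_of N ` P \<or> C \<subseteq> coset_of N ` P"
    if B: "two_sided_ideal L B" and C: "two_sided_ideal L C"
      and BC: "ideal_prod L B C \<subseteq> coset_of N ` P" for B C
  proof (rule ccontr)
    assume "\<not> ?thesis"
    moreover have "D \<subseteq> coset_of N ` P" if "pull D \<subseteq> P" "two_sided_ideal L D" for D
      using bi_ideal_pull(2)[OF that(2)] that(1) by (metis image_mono)
    ultimately obtain x y where x: "x \<in> pull B" "x \<notin> P" and y: "y \<in> pull C" "y \<notin> P"
      using B C by blast
    then have A: "x \<in> A" "y \<in> A" by (auto simp: pull_def)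
    then obtain a where a: "a \<in> A" "x * a * y \<notin> P" using pr(3) x y by blast
    have "x * a \<in> pull B" using bi_idealD(6)[OF bi_ideal_pull(1)[OF B]] a x by blast
    then have "coset_of N (x * a) \<otimes>\<^bsub>L\<^esub> coset_of N y \<in> ideal_prod L B C"
      using y by (intro ideal_prod.prod) (auto simp: pull_def)
    then have "coset_of N (x * a * y) \<in> coset_of N ` P" using BC A a by (auto simp: L_times A_mult)
    then show False using coset_in_image_iff[OF P(1)] a A by (simp add: A_mult)
  qed
  moreover have "coset_of N ` P \<noteq> carrier L"
  proof
    assume "coset_of N ` P = carrier L"
    then have "A \<subseteq> P" using coset_in_image_iff[OF P(1)] by (auto simp: L_carrier)
    then show False using pr(2) P(4) by blast
  qed
  ultimately show ?thesis using two_sided_ideal_image[OF pr(1)] by (auto simp: prime_ideal_def)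
qed

text \<open>Orbits are submodules, so a vector \<open>x0\<close> with nonzero orbit generates the
  module. \<open>T\<close> is its annihilator and \<open>w\<close> an element that fixes it.
  Maximality holds because every nonzero vector can be moved back to \<open>x0\<close>; and as all
  vectors have the form \<open>b x0\<close>, the annihilator of the module is
  \<open>core T\<close>.\<close>

lemma primitive_pull:
  assumes "primitive_ideal L J"
  shows "\<exists>T w. modular_maximal T w \<and> pull J = core T"
proof -
  obtain M :: "('r set, 'r set set) module" where sM: "simple_module L M" and J: "J = annihilator L M"
    using assms by (auto simp: primitive_ideal_def)
  interpret M: left_module L M using sM by (simp add: simple_module_def)
  define act where "act a x = coset_of N a \<odot>\<^bsub>M\<^esub> x" for a x
  have c [simp]: "coset_of N a \<in> carrier L" if "a \<in> A" for a using that by (simp add: L_carrier)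
  have act_c [simp]: "act a x \<in> carrier M" if "a \<in> A" "x \<in> carrier M" for a x
    using that M.smult_closed by (simp add: act_def)
  have act_add: "act (a + b) x = act a x \<oplus>\<^bsub>M\<^esub> act b x" if "a \<in> A" "b \<in> A" "x \<in> carrier M" for a b x
    using that M.smult_l_distr[of "coset_of N a" "coset_of N b" x] by (simp add: act_def L_plus)
  have act_mult: "act (a * b) x = act a (act b x)" if "a \<in> A" "b \<in> A" "x \<in> carrier M" for a b x
    using that M.smult_assoc[of "coset_of N a" "coset_of N b" x] by (simp add: act_def L_times)
  have act_plus: "act a (x \<oplus>\<^bsub>M\<^esub> y) = act a x \<oplus>\<^bsub>M\<^esub> act a y"
    if "a \<in> A" "x \<in> carrier M" "y \<in> carrier M" for a x y
    using that M.smult_r_distr by (simp add: act_def)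
  have act_zero: "act 0 x = \<zero>\<^bsub>M\<^esub>" if "x \<in> carrier M" for x
    using act_add[of 0 0 x] act_c[of 0 x] that A_zero by (metis add.left_neutral M.add.r_cancel_one)
  have act_Mzero: "act a \<zero>\<^bsub>M\<^esub> = \<zero>\<^bsub>M\<^esub>" if "a \<in> A" for a
    using act_plus[of a "\<zero>\<^bsub>M\<^esub>" "\<zero>\<^bsub>M\<^esub>"] act_c[of a "\<zero>\<^bsub>M\<^esub>"] that
    by (metis M.add.r_cancel_one M.l_zero M.zero_closed)
  have act_diff: "act (a - b) x = act a x \<ominus>\<^bsub>M\<^esub> act b x" if "a \<in> A" "b \<in> A" "x \<in> carrier M" for a b x
  proof -
    have "act a x = act (a - b) x \<oplus>\<^bsub>M\<^esub> act b x" using act_add[of "a - b" b x] that A_diff by simp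
    then show ?thesis using that A_diff by (simp add: M.minus_eq M.a_assoc M.r_neg)
  qed
  have act_cong: "act a x = act b x" if "a - b \<in> N" for a b x
  proof -
    have "coset_of N a = coset_of N b" using that by (simp add: coset_eq)
    then show ?thesis by (simp add: act_def)
  qed
  have orbit: "\<exists>a\<in>A. act a y = z" if y: "y \<in> carrier M" and b: "b \<in> A" "act b y \<noteq> \<zero>\<^bsub>M\<^esub>" and z: "z \<in> carrier M" for y z b
  proof -
    define Orb where "Orb = (\<lambda>a. act a y) ` A"
    have "submodule Orb L M"
    proof (intro submodule.intro submodule_axioms.intro)
      show "subgroup Orb (add_monoid M)"
      proof (rule M.add.subgroupI)
        show "Orb \<subseteq> carrier M" using y by (auto simp: Orb_def)
        show "Orb \<noteq> {}" using b by (auto simp: Orb_def)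
        show "\<ominus>\<^bsub>M\<^esub> m \<in> Orb" if m: "m \<in> Orb" for m
        proof -
          obtain a where a: "a \<in> A" "m = act a y" using m by (auto simp: Orb_def)
          have "act (0 - a) y = \<ominus>\<^bsub>M\<^esub> m"
            using act_diff[of 0 a y] a y A_zero by (simp add: act_zero M.minus_eq del: diff_0)
          then show ?thesis unfolding Orb_def using a A_uminus by (intro image_eqI[of _ _ "0 - a"]) auto
        qed
        show "m \<oplus>\<^bsub>M\<^esub> n \<in> Orb" if "m \<in> Orb" "n \<in> Orb" for m n
          using that y A_plus by (auto simp: Orb_def simp flip: act_add)
      qed
      show "X \<odot>\<^bsub>M\<^esub> m \<in> Orb" if X: "X \<in> carrier L" and m: "m \<in> Orb" for X m
      proof -
        obtain a d where "a \<in> A" "m = act a y" "d \<in> A" "X = coset_of N d"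
          using X m by (auto simp: Orb_def L_carrier)
        then show ?thesis
          using act_mult[of d a y] y A_mult unfolding Orb_def by (auto simp: act_def)
      qed
    qed
    moreover have "Orb \<noteq> {\<zero>\<^bsub>M\<^esub>}" using b by (auto simp: Orb_def)
    ultimately have "Orb = carrier M" using sM by (auto simp: simple_module_def)
    then show ?thesis using z unfolding Orb_def by (metis imageE)
  qed
  obtain X x0 where Xx: "X \<in> carrier L" "x0 \<in> carrier M" "X \<odot>\<^bsub>M\<^esub> x0 \<noteq> \<zero>\<^bsub>M\<^esub>"
    using sM by (auto simp: simple_module_def)
  then obtain a0 where a0: "a0 \<in> A" "act a0 x0 \<noteq> \<zero>\<^bsub>M\<^esub>" by (auto simp: L_carrier act_def)
  obtain w where w: "w \<in> A" "act w x0 = x0" using orbit[OF Xx(2) a0 Xx(2)] by blast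
  have x0: "x0 \<in> carrier M" "x0 \<noteq> \<zero>\<^bsub>M\<^esub>" using Xx a0 act_Mzero by auto
  \<comment> \<open>No nonzero vector is killed by all of \<open>A\<close>: a local unit of
    \<open>a\<close> fixes \<open>a x0\<close>.\<close>
  have nondeg: "\<exists>b\<in>A. act b y \<noteq> \<zero>\<^bsub>M\<^esub>" if y: "y \<in> carrier M" "y \<noteq> \<zero>\<^bsub>M\<^esub>" for y
  proof -
    obtain a where a: "a \<in> A" "act a x0 = y" using orbit[OF x0(1) a0 y(1)] by blast
    obtain u where u: "u \<in> A" "u * a - a \<in> N" using left_unit[OF a(1)] by blast
    have "act u y = y" using act_cong[OF u(2), of x0] act_mult[OF u(1) a(1) x0(1)] a by simp
    then show ?thesis using u y by metis
  qed
  define T where "T = {a\<in>A. act a x0 = \<zero>\<^bsub>M\<^esub>}"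
  have "left_ideal T"
    unfolding left_ideal_def
  proof (intro conjI ballI)
    show "additive_closed T"
      unfolding additive_closed_def T_def
      using x0 A_zero by (auto simp: act_zero act_diff A_diff M.minus_eq)
    show "N \<subseteq> T" using act_cong[of _ 0 x0] x0 N_sub by (auto simp: T_def act_zero)
    show "a * x \<in> T" if "a \<in> A" "x \<in> T" for a x
      using that x0 by (auto simp: T_def act_mult A_mult act_Mzero)
  qed (auto simp: T_def)
  moreover have "w \<notin> T" using w x0 by (simp add: T_def)
  moreover have "x - x * w \<in> T" if "x \<in> A" for x
    using that w x0 by (simp add: T_def act_diff act_mult A_closed M.minus_eq M.r_neg)
  moreover have "\<exists>b\<in>A. b * y - w \<in> T" if y: "y \<in> A" "y \<notin> T" for y
  proof -
    have ne: "act y x0 \<noteq> \<zero>\<^bsub>M\<^esub>" "act y x0 \<in> carrier M" using y x0 by (auto simp: T_def)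
    then obtain b where "b \<in> A" "act b (act y x0) = x0" using nondeg orbit[OF _ _ _ x0(1)] by meson
    then show ?thesis using y x0 w
      by (intro bexI[of _ b]) (auto simp: T_def act_diff act_mult A_closed M.minus_eq M.r_neg)
  qed
  ultimately have "modular_maximal T w" using w by (simp add: modular_maximal_def)
  moreover have "pull J = core T"
  proof (intro equalityI subsetI)
    fix a assume "a \<in> pull J"
    then show "a \<in> core T"
      using x0 by (auto simp: pull_def core_def J annihilator_def T_def A_mult act_mult simp flip: act_def)
  next
    fix a assume a: "a \<in> core T"
    then have aA: "a \<in> A" by (simp add: core_def)
    have "act a m = \<zero>\<^bsub>M\<^esub>" if "m \<in> carrier M" for m
    proof -
      from orbit[OF x0(1) a0 that] obtain b where b: "b \<in> A" "act b x0 = m" by blast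
      then have "a * b \<in> T" using a by (simp add: core_def)
      then show ?thesis using b aA x0 by (simp add: T_def act_mult)
    qed
    then show "a \<in> pull J" using aA by (auto simp: pull_def J annihilator_def act_def)
  qed
  ultimately show ?thesis by blast
qed

text \<open>The simple module is \<open>A\<close> modulo \<open>T\<close>, with operations defined
  through chosen representatives. The action does not depend on the representative of the ring
  element because right multiplication keeps \<open>N\<close> inside \<open>N\<close>, which is
  contained in \<open>T\<close>.\<close>

lemma primitive_ideal_image:
  assumes mm: "modular_maximal T w"
  shows "primitive_ideal L (coset_of N ` core T)"
proof -
  note m = modular_maximalD[OF mm]
  note T = left_idealD[OF m(1)]
  note Teq = coset_of_eq_iff[OF T(1)]
  define rep where "rep I X = (SOME a. a \<in> A \<and> coset_of I a = X)" for I X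
  have rep: "rep I (coset_of I a) \<in> A \<and> coset_of I (rep I (coset_of I a)) = coset_of I a" if "a \<in> A" for I a
    unfolding rep_def by (rule someI[of _ a]) (use that in auto)
  have repT: "rep T (coset_of T a) \<in> A" "rep T (coset_of T a) - a \<in> T" if "a \<in> A" for a
    using rep[OF that, of T] by (auto simp: Teq)
  have repN: "rep N (coset_of N a) \<in> A" "rep N (coset_of N a) - a \<in> N" if "a \<in> A" for a
    using rep[OF that, of N] by (auto simp: coset_eq)
  define M :: "('r set, 'r set) module" where "M =
    \<lparr>carrier = coset_of T ` A, mult = undefined, one = undefined, zero = coset_of T 0,
     add = (\<lambda>X Y. coset_of T (rep T X + rep T Y)), smult = (\<lambda>X Y. coset_of T (rep N X * rep T Y))\<rparr>"
  have M_simps [simp]: "carrier M = coset_of T ` A" "\<zero>\<^bsub>M\<^esub> = coset_of T 0" by (simp_all add: M_def)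
  have M_add [simp]: "coset_of T a \<oplus>\<^bsub>M\<^esub> coset_of T b = coset_of T (a + b)" if "a \<in> A" "b \<in> A" for a b
    using additive_closed_add[OF T(1) repT(2)[OF that(1)] repT(2)[OF that(2)]]
    by (simp add: M_def Teq algebra_simps)
  have M_smult [simp]: "coset_of N a \<odot>\<^bsub>M\<^esub> coset_of T b = coset_of T (a * b)" if "a \<in> A" "b \<in> A" for a b
  proof -
    let ?a = "rep N (coset_of N a)" and ?b = "rep T (coset_of T b)"
    have "?a * (?b - b) \<in> T" using T(4) repN(1) repT(2) that by blast
    moreover have "(?a - a) * b \<in> T" using N_right[OF that(2) repN(2)[OF that(1)]] T(2) by blast
    ultimately have "?a * (?b - b) + (?a - a) * b \<in> T" by (rule additive_closed_add[OF T(1)])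
    then show ?thesis by (simp add: M_def Teq algebra_simps)
  qed
  have "abelian_group M"
  proof (rule abelian_groupI)
    fix X assume "X \<in> carrier M"
    then obtain a where "a \<in> A" "X = coset_of T a" by auto
    then show "\<exists>Y\<in>carrier M. Y \<oplus>\<^bsub>M\<^esub> X = \<zero>\<^bsub>M\<^esub>"
      by (intro bexI[of _ "coset_of T (- a)"]) (auto simp: A_closed)
  qed (auto simp: A_closed add_ac)
  then interpret M: abelian_group M .
  have left: "left_module L M"
    by unfold_locales (auto simp: L_carrier L_plus L_times A_closed algebra_simps)
  have subm: "S = {\<zero>\<^bsub>M\<^esub>} \<or> S = carrier M" if "submodule S L M" for S
  proof -
    interpret S: submodule S L M by (rule that)
    have S_sub: "S \<subseteq> coset_of T ` A" using S.subset by simp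
    have zero_S: "coset_of T 0 \<in> S" using S.one_closed by simp
    show ?thesis
    proof (cases "S = {\<zero>\<^bsub>M\<^esub>}")
      case False
      then have "\<not> S \<subseteq> {coset_of T 0}" using zero_S by auto
      then obtain Y where "Y \<in> S" "Y \<noteq> coset_of T 0" by blast
      then obtain y where y: "y \<in> A" "coset_of T y \<in> S" "coset_of T y \<noteq> coset_of T 0"
        using S_sub by blast
      then have "y \<notin> T" by (simp add: Teq)
      then obtain b where b: "b \<in> A" "b * y - w \<in> T" using m(5) y by blast
      have "coset_of N b \<odot>\<^bsub>M\<^esub> coset_of T y \<in> S"
        using S.smult_closed[OF _ y(2)] b by (simp add: L_carrier del: M_smult)
      moreover have "coset_of T (b * y) = coset_of T w" using b by (simp add: Teq)
      ultimately have wS: "coset_of T w \<in> S" using b y by simp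
      have "coset_of T x \<in> S" if x: "x \<in> A" for x
      proof -
        have "coset_of N x \<odot>\<^bsub>M\<^esub> coset_of T w \<in> S"
          using S.smult_closed wS x by (auto simp: L_carrier)
        moreover have "coset_of T x = coset_of T (x * w)" using m(4)[OF x] by (simp add: Teq)
        ultimately show ?thesis using x m(2) by simp
      qed
      then show ?thesis using S_sub by auto
    qed simp
  qed
  have "coset_of N w \<odot>\<^bsub>M\<^esub> coset_of T w \<noteq> \<zero>\<^bsub>M\<^esub>"
  proof -
    have "w * w \<notin> T" using additive_closed_cong[OF T(1) m(4)[OF m(2)]] m(3) by simp
    then show ?thesis using m(2) by (simp add: Teq)
  qed
  then have "simple_module L M" unfolding simple_module_def
    using left subm m(2) by (auto simp: L_carrier)
  moreover have "annihilator L M = coset_of N ` core T"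
  proof -
    have zero: "coset_of T a = coset_of T 0 \<longleftrightarrow> a \<in> T" for a using Teq[of a 0] by simp
    have "coset_of N a \<in> annihilator L M \<longleftrightarrow> a \<in> core T" if "a \<in> A" for a
      using that by (simp add: annihilator_def L_carrier core_def zero)
    moreover have "annihilator L M \<subseteq> coset_of N ` A" by (auto simp: annihilator_def L_carrier)
    moreover have "core T \<subseteq> A" by (auto simp: core_def)
    ultimately show ?thesis by blast
  qed
  \<comment> \<open>The elements of this module are subsets of \<open>'r\<close>, while
    \<open>primitive_ideal\<close> asks for sets of elements of \<open>L\<close>; the lemma cited
    here changes the carrier.\<close>
  ultimately show ?thesis
    using primitive_ideal_annihilator[OF L_abelian_group L_mult_closed] by metis
qed

lemma primes_primitive_iff:
  "(\<forall>J. prime_ideal L J \<longrightarrow> primitive_ideal L J) \<longleftrightarrow>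
   (\<forall>P. elementwise_prime P \<longrightarrow> (\<exists>T w. modular_maximal T w \<and> P = core T))"
proof (intro iffI allI impI)
  fix P assume h: "\<forall>J. prime_ideal L J \<longrightarrow> primitive_ideal L J" and P: "elementwise_prime P"
  have "pull (coset_of N ` P) = P"
    using P by (intro pull_image) (simp add: elementwise_prime_def bi_ideal_def)
  then show "\<exists>T w. modular_maximal T w \<and> P = core T"
    using primitive_pull[of "coset_of N ` P"] h prime_ideal_image[OF P] by auto
next
  fix J assume h: "\<forall>P. elementwise_prime P \<longrightarrow> (\<exists>T w. modular_maximal T w \<and> P = core T)"
    and J: "prime_ideal L J"
  obtain T w where "modular_maximal T w" "pull J = core T"
    using h elementwise_prime_pull[OF J] by blast
  moreover have "J = coset_of N ` pull J"
    using J bi_ideal_pull(2) by (auto simp: prime_ideal_def)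
  ultimately show "primitive_ideal L J" using primitive_ideal_image by metis
qed

subsection \<open>Criteria\<close>

text \<open>Zorn's lemma is applied to the left ideals above \<open>J\<close> that avoid
  \<open>w\<close>. Modularity passes from \<open>J\<close> to anything larger, and a left ideal
  strictly above the maximal one must contain \<open>w\<close>.\<close>

lemma modular_maximal_exists:
  assumes J: "left_ideal J" and w: "w \<in> A" "w \<notin> J" and modular: "\<And>x. x \<in> A \<Longrightarrow> x - x * w \<in> J"
  shows "\<exists>T. J \<subseteq> T \<and> modular_maximal T w"
proof -
  define F where "F = {T. left_ideal T \<and> J \<subseteq> T \<and> w \<notin> T}"
  have "\<exists>T\<in>F. \<forall>X\<in>F. T \<subseteq> X \<longrightarrow> X = T"
  proof (rule subset_Zorn_nonempty)
    show "F \<noteq> {}" using J w by (auto simp: F_def)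
    fix C assume C: "C \<noteq> {}" "subset.chain F C"
    have CF: "C \<subseteq> F" and lin: "\<And>X Y. X \<in> C \<Longrightarrow> Y \<in> C \<Longrightarrow> X \<subseteq> Y \<or> Y \<subseteq> X"
      using C by (auto simp: subset.chain_def)
    have li: "left_ideal X" if "X \<in> C" for X using that CF by (auto simp: F_def)
    have "additive_closed (\<Union>C)"
      unfolding additive_closed_def
    proof (intro conjI ballI)
      obtain X where "X \<in> C" using C(1) by blast
      then show "0 \<in> \<Union>C" using additive_closed_zero[OF left_idealD(1)[OF li]] by blast
      fix x y assume "x \<in> \<Union>C" "y \<in> \<Union>C"
      then obtain X where "X \<in> C" "x \<in> X" "y \<in> X" using lin by blast
      then show "x - y \<in> \<Union>C" using additive_closed_diff[OF left_idealD(1)[OF li]] by blast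
    qed
    moreover have "\<And>a x. a \<in> A \<Longrightarrow> x \<in> \<Union>C \<Longrightarrow> a * x \<in> \<Union>C"
      using left_idealD(4)[OF li] by blast
    moreover have "N \<subseteq> \<Union>C" "\<Union>C \<subseteq> A" using C(1) left_idealD(2,3)[OF li] by blast+
    ultimately have "left_ideal (\<Union>C)" by (simp add: left_ideal_def)
    then show "\<Union>C \<in> F" using C(1) CF by (auto simp: F_def)
  qed
  then obtain T where T: "left_ideal T" "J \<subseteq> T" "w \<notin> T"
    and max: "\<And>X. left_ideal X \<Longrightarrow> T \<subseteq> X \<Longrightarrow> w \<notin> X \<Longrightarrow> X = T"
  proof -
    assume *: "\<And>T. left_ideal T \<Longrightarrow> J \<subseteq> T \<Longrightarrow> w \<notin> T \<Longrightarrow>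
      (\<And>X. left_ideal X \<Longrightarrow> T \<subseteq> X \<Longrightarrow> w \<notin> X \<Longrightarrow> X = T) \<Longrightarrow> thesis"
    obtain T where T: "T \<in> F" "\<And>X. X \<in> F \<Longrightarrow> T \<subseteq> X \<Longrightarrow> X = T"
      using \<open>\<exists>T\<in>F. \<forall>X\<in>F. T \<subseteq> X \<longrightarrow> X = T\<close> by meson
    then show thesis by (intro *[of T]) (auto simp: F_def)
  qed
  note TD = left_idealD[OF T(1)]
  have "\<exists>b\<in>A. b * y - w \<in> T" if y: "y \<in> A" "y \<notin> T" for y
  proof -
    \<comment> \<open>This is \<open>A y + T\<close>; a local unit shows that it contains
      \<open>y\<close> itself.\<close>
    define X where "X = {x \<in> A. \<exists>b\<in>A. b * y - x \<in> T}"
    have "left_ideal X"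
      unfolding left_ideal_def
    proof (intro conjI ballI subsetI)
      show "additive_closed X"
        unfolding additive_closed_def X_def
      proof (intro conjI ballI, goal_cases)
        case 1 then show ?case using A_zero additive_closed_zero[OF TD(1)] by (auto intro!: bexI[of _ 0])
      next
        case (2 x x')
        then obtain b b' where "b \<in> A" "b' \<in> A" "b * y - x \<in> T" "b' * y - x' \<in> T" "x \<in> A" "x' \<in> A" by blast
        then show ?case using additive_closed_diff[OF TD(1), of "b * y - x" "b' * y - x'"] A_diff
          by (auto intro!: bexI[of _ "b - b'"] simp: algebra_simps)
      qed
      show "x \<in> X" if "x \<in> N" for x
        using that N_sub TD(2) A_zero additive_closed_uminus[OF TD(1)] by (auto simp: X_def intro!: bexI[of _ 0])
      show "a * x \<in> X" if ax: "a \<in> A" "x \<in> X" for a x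
      proof -
        obtain b where "b \<in> A" "b * y - x \<in> T" "x \<in> A" using ax by (auto simp: X_def)
        then show ?thesis using TD(4)[OF ax(1), of "b * y - x"] ax A_mult
          by (auto simp: X_def algebra_simps intro!: bexI[of _ "a * b"])
      qed
    qed (auto simp: X_def)
    moreover have "T \<subseteq> X"
      using TD(3) A_zero additive_closed_uminus[OF TD(1)] by (auto simp: X_def intro!: bexI[of _ 0])
    moreover have "y \<in> X"
    proof -
      obtain u where "u \<in> A" "u * y - y \<in> N" using left_unit[OF y(1)] by blast
      then show ?thesis using y TD(2) by (auto simp: X_def)
    qed
    ultimately have "w \<in> X" using max[of X] y by blast
    then show ?thesis by (simp add: X_def)
  qed
  then have "modular_maximal T w"
    using T w modular by (auto simp: modular_maximal_def)
  then show ?thesis using T by blast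
qed

lemma bi_ideal_core:
  assumes "modular_maximal T w"
  shows "bi_ideal (core T)" "core T \<subseteq> T"
proof -
  note m = modular_maximalD[OF assms]
  note T = left_idealD[OF m(1)]
  have 1: "additive_closed (core T)"
    using A_add T(1) unfolding additive_closed_def core_def by (auto simp: left_diff_distrib)
  have 2: "N \<subseteq> core T" using N_sub N_right T(2) by (auto simp: core_def)
  have 3: "c * a \<in> core T" "a * c \<in> core T" if "c \<in> A" "a \<in> core T" for a c
    using that A_mult T(4) by (auto simp: core_def mult.assoc)
  show "bi_ideal (core T)"
    unfolding bi_ideal_def left_ideal_def using 1 2 3 by (auto simp: core_def)
  show "core T \<subseteq> T"
  proof
    fix a assume a: "a \<in> core T"
    then have "a * w \<in> T" "a \<in> A" using m(2) by (auto simp: core_def)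
    then show "a \<in> T" using additive_closed_cong[OF T(1) m(4)] by simp
  qed
qed

text \<open>Extend \<open>J\<close> to a maximal \<open>T\<close>. An ideal strictly above
  \<open>P\<close> contains an element that equals \<open>w\<close> modulo \<open>J\<close>, so it
  cannot lie inside \<open>T\<close>; hence \<open>core T\<close> does not exceed
  \<open>P\<close>.\<close>

lemma primitive_criterion:
  assumes P: "bi_ideal P" and J: "left_ideal J" "P \<subseteq> J"
    and w: "w \<in> A" "w \<notin> J" and modular: "\<And>x. x \<in> A \<Longrightarrow> x - x * w \<in> J"
    and big: "\<And>I. bi_ideal I \<Longrightarrow> P \<subset> I \<Longrightarrow> \<exists>i\<in>I. w - i \<in> J"
  shows "\<exists>T w. modular_maximal T w \<and> P = core T"
proof -
  obtain T where T: "J \<subseteq> T" "modular_maximal T w"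
    using modular_maximal_exists[OF J(1) w modular] by blast
  note m = modular_maximalD[OF T(2)]
  note TD = left_idealD[OF m(1)]
  have "P \<subseteq> core T"
    using bi_idealD(4,6)[OF P] J(2) T(1) unfolding core_def by blast
  moreover have "\<not> P \<subset> core T"
  proof
    assume "P \<subset> core T"
    then obtain i where i: "i \<in> core T" "w - i \<in> J" using big bi_ideal_core(1)[OF T(2)] by blast
    then have "w \<in> T" using additive_closed_cong[OF TD(1), of w i] T(1) bi_ideal_core(2)[OF T(2)] by blast
    then show False using m(3) by blast
  qed
  ultimately show ?thesis using T(2) by blast
qed

text \<open>
  The corner \<open>e A e\<close> is commutative modulo \<open>P\<close>. If \<open>P\<close> were primitive, the corner of a faithful
  simple module would be a simple faithful module over this commutative ring, which would
  therefore be a field.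
\<close>

lemma nonprimitive_prime_from_corner:
  fixes g :: "'r \<Rightarrow> 'd::idom"
  assumes e: "e \<in> A" "e * e - e \<in> N"
    and g_diff: "\<And>a b. a \<in> A \<Longrightarrow> b \<in> A \<Longrightarrow> g (a - b) = g a - g b"
    and g_N: "\<And>a. a \<in> N \<Longrightarrow> g a = 0"
    and g_mult: "\<And>a b. a \<in> A \<Longrightarrow> b \<in> A \<Longrightarrow> g (a * e * b) = g a * g b"
    and g_e: "g e = 1"
    and t: "t \<in> A" "g t \<noteq> 0" "\<And>y. y \<in> A \<Longrightarrow> g y * g t \<noteq> 1"
  shows "\<exists>P. elementwise_prime P \<and> \<not> (\<exists>T w. modular_maximal T w \<and> P = core T)"
proof -
  have g_cong: "g a = g b" if "a \<in> A" "b \<in> A" "a - b \<in> N" for a b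
    using g_N[OF that(3)] g_diff[OF that(1,2)] by simp
  have g_left: "g (e * a) = g a" if a: "a \<in> A" for a
  proof -
    have "(e * e - e) * a \<in> N" using e a N_right by blast
    then have "g (e * e * a) = g (e * a)"
      using e a A_mult by (intro g_cong) (auto simp: algebra_simps)
    then show ?thesis using g_mult[OF e(1) a] g_e by simp
  qed
  have g_right: "g (a * e) = g a" if a: "a \<in> A" for a
  proof -
    have "a * (e * e - e) \<in> N" using e a N_left by blast
    then have "g (a * e * e) = g (a * e)"
      using e a A_mult by (intro g_cong) (auto simp: algebra_simps)
    then show ?thesis using g_mult[OF a e(1)] g_e by simp
  qed
  \<comment> \<open>The largest ideal on which \<open>g\<close> vanishes: it lies in the kernel of
    \<open>g\<close> because \<open>g (e * x * e) = g x\<close>.\<close>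
  define P where "P = {x\<in>A. \<forall>a\<in>A. \<forall>b\<in>A. g (a * x * b) = 0}"
  have g_0: "g 0 = 0" using g_N additive_closed_zero[OF N_add] by blast
  have P: "bi_ideal P"
    unfolding bi_ideal_def left_ideal_def
  proof (intro conjI ballI subsetI)
    show "additive_closed P"
      unfolding additive_closed_def P_def
      by (auto simp: g_0 A_closed left_diff_distrib right_diff_distrib g_diff)
    show "x \<in> P" if "x \<in> N" for x
      using that N_sub N_left N_right g_N by (auto simp: P_def)
    show "a * x \<in> P" if "a \<in> A" "x \<in> P" for a x
      using that A_mult A_mult[OF _ that(1)] by (auto simp: P_def simp flip: mult.assoc)
    show "x * a \<in> P" if "a \<in> A" "x \<in> P" for a x
      using that A_mult A_mult[OF that(1)] by (auto simp: P_def mult.assoc)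
  qed (auto simp: P_def)
  have e_notin: "e \<notin> P" using g_mult[OF e(1) e(1)] g_e e(1) by (force simp: P_def)
  have "\<exists>m\<in>A. x * m * y \<notin> P" if x: "x \<in> A" "x \<notin> P" and y: "y \<in> A" "y \<notin> P" for x y
  proof -
    obtain a b c d where A: "a \<in> A" "b \<in> A" "c \<in> A" "d \<in> A"
      and ne: "g (a * x * b) \<noteq> 0" "g (c * y * d) \<noteq> 0"
      using x y by (auto simp: P_def)
    have "g ((a * x * b) * e * (c * y * d)) \<noteq> 0"
      using ne A x y by (subst g_mult) (auto simp: A_mult)
    then have "g (a * (x * (b * e * c) * y) * d) \<noteq> 0" by (simp add: mult.assoc)
    then show ?thesis
      using A x y e by (intro bexI[of _ "b * e * c"]) (auto simp: P_def A_mult)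
  qed
  then have prime: "elementwise_prime P"
    using P e_notin e(1) unfolding elementwise_prime_def by blast
  have "\<not> (\<exists>T w. modular_maximal T w \<and> P = core T)"
  proof
    assume "\<exists>T w. modular_maximal T w \<and> P = core T"
    then obtain T w where mm: "modular_maximal T w" and PT: "P = core T" by blast
    note m = modular_maximalD[OF mm]
    note T = left_idealD[OF m(1)]
    define t' where "t' = e * t * e"
    have t': "t' \<in> A" using t e by (simp add: t'_def A_mult)
    have t'e: "t' * e - t' \<in> N" "e * t' - t' \<in> N"
      using N_left[OF A_mult[OF e(1) t(1)] e(2)] N_right[OF A_mult[OF t(1) e(1)] e(2)]
      by (auto simp: t'_def algebra_simps)
    have gt': "g t' = g t"
      using t e g_left[of "t * e"] g_right[of t] by (simp add: t'_def mult.assoc A_mult)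
    have "g (e * t' * e) \<noteq> 0" using t' t e g_left g_right gt' by (simp add: A_mult)
    then have "t' \<notin> P" using e by (auto simp: P_def)
    then obtain b where b: "b \<in> A" "t' * b \<notin> T" using t' by (auto simp: PT core_def)
    then obtain y where y: "y \<in> A" "y * (t' * b) - w \<in> T" using m(5)[OF A_mult[OF t' b(1)]] b by blast
    \<comment> \<open>In the module \<open>A\<close> modulo \<open>T\<close>, the element
      \<open>y * t'\<close> sends the vector \<open>b\<close> to \<open>w\<close>, so
      \<open>b * y * t'\<close> fixes \<open>b\<close>, and \<open>z\<close> kills it. Once
      \<open>z\<close> is known to be in \<open>P\<close>, applying \<open>g\<close> to it exhibits
      an inverse of \<open>g t\<close>.\<close>
    define z where "z = e - e * b * y * t'"
    have z: "z \<in> A" using e b y t' by (simp add: z_def A_closed)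
    have zb: "z * b \<in> T"
    proof -
      have "e * (b - b * w) - (e * b) * (y * (t' * b) - w) \<in> T"
        by (intro additive_closed_diff[OF T(1)] T(4)[OF e(1) m(4)[OF b(1)]] T(4)[OF _ y(2)])
          (simp add: A_mult e b)
      then show ?thesis by (simp add: z_def algebra_simps)
    qed
    have ze: "z - z * e \<in> N" and ez: "z - e * z \<in> N"
    proof -
      have "(e * b * y) * (t' * e - t') - (e * e - e) \<in> N"
        by (intro additive_closed_diff[OF N_add N_left[OF _ t'e(1)] e(2)]) (simp add: A_mult e b y)
      then show "z - z * e \<in> N" by (simp add: z_def algebra_simps)
      have "(e * e - e) * (b * y * t') - (e * e - e) \<in> N"
        by (intro additive_closed_diff[OF N_add N_right[OF _ e(2)] e(2)]) (simp add: A_mult b y t')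
      then show "z - e * z \<in> N" by (simp add: z_def algebra_simps)
    qed
    have "e * b \<notin> T"
    proof
      assume "e * b \<in> T"
      then have "t' * (e * b) \<in> T" using T(4) t' by blast
      moreover have "(t' * e - t') * b \<in> T" using N_right[OF b(1) t'e(1)] T(2) by blast
      ultimately show False
        using b additive_closed_cong[OF T(1), of "t' * e * b" "t' * b"] by (simp add: algebra_simps)
    qed
    then obtain c where c: "c \<in> A" "c * (e * b) - w \<in> T" using m(5)[OF A_mult[OF e(1) b(1)]] by blast
    have "z * a \<in> T" if a: "a \<in> A" for a
    proof -
      \<comment> \<open>A commutator of corner elements, which is in \<open>P\<close> because
        \<open>g\<close> is multiplicative across \<open>e\<close> with commuting values. So
        \<open>z\<close> can be moved past \<open>e * (a * c) * e\<close> to \<open>b\<close>, which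
        it kills. As \<open>c * (e * b)\<close> equals \<open>w\<close> modulo \<open>T\<close>,
        this reaches every \<open>a\<close>.\<close>
      define k where "k = z * (e * (a * c) * e) - (e * (a * c) * e) * z"
      have ac: "a * c \<in> A" "e * (a * c) * e \<in> A" using a c e by (simp_all add: A_mult)
      have kA: "k \<in> A" using z ac by (simp add: k_def A_closed)
      have "g (p * k * q) = 0" if p: "p \<in> A" and q: "q \<in> A" for p q
      proof -
        have "g (p * z * (e * (a * c) * e * q)) = g (p * (e * z) * (e * (a * c) * e * q))"
        proof (rule g_cong)
          have "p * (z - e * z) * (e * (a * c) * e * q) \<in> N"
            by (intro N_right[OF _ N_left[OF p ez]]) (simp add: A_mult ac e q)
          then show "p * z * (e * (a * c) * e * q) - p * (e * z) * (e * (a * c) * e * q) \<in> N"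
            by (simp only: left_diff_distrib right_diff_distrib)
        qed (simp_all add: A_mult p q ac z e)
        also have "\<dots> = g (p * e * (z * e * ((a * c) * e * q)))" by (simp add: mult.assoc)
        also have "\<dots> = g p * (g z * (g (a * c) * g q))"
          using p q z ac e A_mult by (simp add: g_mult)
        finally have 1: "g (p * (z * (e * (a * c) * e)) * q) = g p * (g z * (g (a * c) * g q))"
          by (simp add: mult.assoc)
        have "g ((p * (e * (a * c) * e)) * z * q) = g ((p * (e * (a * c) * e)) * (z * e) * q)"
        proof (rule g_cong)
          have "(p * (e * (a * c) * e)) * (z - z * e) * q \<in> N"
            by (intro N_right[OF q N_left[OF _ ze]]) (simp add: A_mult ac p)
          then show "(p * (e * (a * c) * e)) * z * q - (p * (e * (a * c) * e)) * (z * e) * q \<in> N"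
            by (simp only: left_diff_distrib right_diff_distrib)
        qed (simp_all add: A_mult p q ac z e)
        also have "\<dots> = g (p * e * ((a * c) * e * (z * e * q)))" by (simp add: mult.assoc)
        also have "\<dots> = g p * (g (a * c) * (g z * g q))"
          using p q z ac e A_mult by (simp add: g_mult)
        finally have "g (p * (e * (a * c) * e * z) * q) = g p * (g (a * c) * (g z * g q))"
          by (simp add: mult.assoc)
        moreover have "g (p * k * q) = g (p * (z * (e * (a * c) * e)) * q) - g (p * (e * (a * c) * e * z) * q)"
          unfolding k_def left_diff_distrib right_diff_distrib
          by (rule g_diff) (simp_all add: A_mult p q z ac)
        ultimately show ?thesis using 1 by simp
      qed
      then have "k \<in> P" using kA by (auto simp: P_def)
      then have "k * b \<in> T" using b by (auto simp: PT core_def)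
      moreover have "(e * (a * c) * e) * (z * b) \<in> T" using zb ac T(4) by blast
      ultimately have "k * b + (e * (a * c) * e) * (z * b) \<in> T" by (rule additive_closed_add[OF T(1)])
      then have 1: "z * (e * (a * c) * e) * b \<in> T"
        by (simp only: k_def left_diff_distrib mult.assoc diff_add_cancel)
      have "(z - z * e) * ((a * c) * e * b) \<in> T"
        by (intro subsetD[OF T(2) N_right[OF _ ze]]) (simp add: A_mult ac e b)
      from additive_closed_add[OF T(1) this 1] have 2: "z * (a * c * e * b) \<in> T"
        by (simp only: left_diff_distrib mult.assoc diff_add_cancel)
      have "z * a - z * (a * w) \<in> T" using T(4)[OF z m(4)[OF a]] by (simp add: right_diff_distrib)
      moreover have "z * a * (c * (e * b) - w) \<in> T" using T(4)[OF A_mult[OF z a] c(2)] .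
      ultimately have "z * a - z * (a * w) - z * a * (c * (e * b) - w) \<in> T"
        by (rule additive_closed_diff[OF T(1)])
      from additive_closed_add[OF T(1) this 2] show ?thesis
        by (simp add: algebra_simps)
    qed
    then have "z \<in> P" using z by (simp add: PT core_def)
    then have "g (e * z * e) = 0" using e by (auto simp: P_def)
    then have "g z = 0" using z e g_left g_right by (simp add: A_mult)
    moreover have "g (e * b * y * t') = g (e * b * y) * g t"
    proof -
      have "g (e * b * y * t') = g (e * b * y * e * (t * e))" by (simp add: t'_def mult.assoc)
      also have "\<dots> = g (e * b * y) * g (t * e)" by (rule g_mult) (simp_all add: A_mult e b y t)
      finally show ?thesis using g_right t by simp
    qed
    ultimately have "g (e * b * y) * g t = 1"
      using g_e g_diff[of e "e * b * y * t'"] e b y t' by (simp add: z_def A_mult)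
    then show False using t(3)[of "e * b * y"] e b y by (simp add: A_mult)
  qed
  then show ?thesis using prime by blast
qed

end

section \<open>Computing in the Leavitt path algebra\<close>

lemma poly_mapping_sum_single: "x = (\<Sum>w\<in>Poly_Mapping.keys x. Poly_Mapping.single w (Poly_Mapping.lookup x w))"
proof (rule poly_mapping_eqI)
  fix w
  show "Poly_Mapping.lookup x w =
    Poly_Mapping.lookup (\<Sum>w\<in>Poly_Mapping.keys x. Poly_Mapping.single w (Poly_Mapping.lookup x w)) w"
    by (cases "w \<in> Poly_Mapping.keys x")
      (auto simp: lookup_sum lookup_single when_def in_keys_iff sum.delta)
qed

text \<open>The last case only asks for words that occur in \<open>x\<close>, so that membership of
  \<open>x\<close> in a subalgebra remains usable there.\<close>

lemma poly_mapping_additive_induct [case_names zero add single]: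
  fixes x :: "'a \<Rightarrow>\<^sub>0 'b::comm_monoid_add"
  assumes "P 0" "\<And>x y. P x \<Longrightarrow> P y \<Longrightarrow> P (x + y)"
    "\<And>w k. w \<in> Poly_Mapping.keys x \<Longrightarrow> P (Poly_Mapping.single w k)"
  shows "P x"
proof -
  have "P (\<Sum>w\<in>S. Poly_Mapping.single w (Poly_Mapping.lookup x w))" if "S \<subseteq> Poly_Mapping.keys x" for S
    using finite_subset[OF that finite_keys] that
    by (induction S rule: finite_induct) (auto intro: assms)
  from this[OF subset_refl] show ?thesis by (simp flip: poly_mapping_sum_single)
qed

abbreviation scal :: "'k::field \<Rightarrow> 'x word \<Rightarrow>\<^sub>0 'k"
  where "scal k \<equiv> Poly_Mapping.single 0 k"

lemma scal_commute: "scal k * x = x * scal k"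
proof (induction x rule: poly_mapping_additive_induct)
  case (single w c)
  show ?case by (simp add: mult_single mult.commute)
qed (auto simp: algebra_simps)

lemma single_eq_scal: "Poly_Mapping.single w k = scal k * Poly_Mapping.single w 1"
  by (simp add: mult_single)

locale leavitt = wf_digraph E for E :: "('v, 'e) pre_digraph" +
  fixes scalars :: "'k::field itself"
begin

text \<open>The unital \<open>alg\<close> is kept besides \<open>A\<close> because it contains the
  scalars and \<open>N\<close> is generated as an ideal of it.\<close>

definition alg :: "('v, 'e, 'k) free_lpa set"
  where "alg = carrier (free_algebra (generators E))"

definition A :: "('v, 'e, 'k) free_lpa set"
  where "A = carrier (free_nonunital_algebra (generators E))"

definition N :: "('v, 'e, 'k) free_lpa set"
  where "N = Idl\<^bsub>free_algebra (generators E)\<^esub> (leavitt_relations E)"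

lemma alg_iff: "x \<in> alg \<longleftrightarrow> (\<forall>w\<in>Poly_Mapping.keys x. set (letters w) \<subseteq> generators E)"
  by (simp add: alg_def free_algebra_def)

lemma A_iff: "x \<in> A \<longleftrightarrow> (\<forall>w\<in>Poly_Mapping.keys x. letters w \<noteq> [] \<and> set (letters w) \<subseteq> generators E)"
proof -
  have "letters w = [] \<longleftrightarrow> w = 0" for w :: "('v, 'e) generator word"
    by (cases w) (simp add: zero_word_def)
  then show ?thesis
    by (auto simp: A_def free_nonunital_algebra_def free_algebra_def in_keys_iff)
qed

lemma A_subset_alg: "A \<subseteq> alg"
  by (auto simp: A_iff alg_iff)

lemma A_in_alg: "x \<in> A \<Longrightarrow> x \<in> alg"
  using A_subset_alg by blast

lemma additive_closed_alg: "additive_closed alg"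
  using keys_diff by (fastforce simp: additive_closed_def alg_iff)

lemma additive_closed_A: "additive_closed A"
  using keys_diff by (fastforce simp: additive_closed_def A_iff)

lemmas alg_add = additive_closedD[OF additive_closed_alg]
lemmas A_add = additive_closedD[OF additive_closed_A]

lemma alg_mult: "x \<in> alg \<Longrightarrow> y \<in> alg \<Longrightarrow> x * y \<in> alg"
  using keys_mult[of x y] by (fastforce simp: alg_iff plus_word_def)

lemma A_mult_left: "x \<in> alg \<Longrightarrow> y \<in> A \<Longrightarrow> x * y \<in> A"
  using keys_mult[of x y] by (fastforce simp: alg_iff A_iff plus_word_def)

lemma A_mult_right: "x \<in> A \<Longrightarrow> y \<in> alg \<Longrightarrow> x * y \<in> A"
  using keys_mult[of x y] by (fastforce simp: alg_iff A_iff plus_word_def)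

lemma A_mult: "x \<in> A \<Longrightarrow> y \<in> A \<Longrightarrow> x * y \<in> A"
  using A_mult_left A_subset_alg by blast

lemma single_in_alg: "set (letters w) \<subseteq> generators E \<Longrightarrow> Poly_Mapping.single w k \<in> alg"
  by (auto simp: alg_iff)

lemma single_in_A: "letters w \<noteq> [] \<Longrightarrow> set (letters w) \<subseteq> generators E \<Longrightarrow> Poly_Mapping.single w k \<in> A"
  by (auto simp: A_iff)

lemma scal_alg [simp]: "scal k \<in> alg"
  by (rule single_in_alg) (simp add: zero_word_def)

lemma generators_iff [simp]:
  "Vertex v \<in> generators E \<longleftrightarrow> v \<in> verts E"
  "Edge e \<in> generators E \<longleftrightarrow> e \<in> arcs E"
  "Ghost e \<in> generators E \<longleftrightarrow> e \<in> arcs E"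
  by (auto simp: generators_def)

lemma gens_A [simp]:
  "v \<in> verts E \<Longrightarrow> vx v \<in> A" "e \<in> arcs E \<Longrightarrow> ed e \<in> A" "e \<in> arcs E \<Longrightarrow> gh e \<in> A"
  by (auto intro!: single_in_A)

lemma gens_alg [simp]:
  "v \<in> verts E \<Longrightarrow> vx v \<in> alg" "e \<in> arcs E \<Longrightarrow> ed e \<in> alg" "e \<in> arcs E \<Longrightarrow> gh e \<in> alg"
  using A_subset_alg gens_A by blast+

lemma relations_in_A: "leavitt_relations E \<subseteq> A"
  by (auto simp: leavitt_relations_def regular_vertex_def
      intro!: A_add additive_closed_sum[OF additive_closed_A] A_mult)

lemma free_algebra_uminus:
  assumes "a \<in> alg"
  shows "\<ominus>\<^bsub>free_algebra (generators E)\<^esub> a = - a"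
proof -
  interpret ring "free_algebra (generators E) :: ('v, 'e, 'k) free_lpa ring" by (rule ring_free_algebra)
  show ?thesis
    using assms alg_add(3)[OF assms]
    by (intro minus_equality) (simp_all add: alg_def, simp add: free_algebra_def)
qed

lemma ideal_A: "ideal A (free_algebra (generators E))"
proof (rule idealI)
  interpret ring "free_algebra (generators E) :: ('v, 'e, 'k) free_lpa ring" by (rule ring_free_algebra)
  show "ring (free_algebra (generators E) :: ('v, 'e, 'k) free_lpa ring)" by (rule ring_free_algebra)
  show "subgroup A (add_monoid (free_algebra (generators E)))"
  proof (rule add.subgroupI)
    show "A \<subseteq> carrier (free_algebra (generators E))" using A_subset_alg by (simp add: alg_def)
    show "A \<noteq> {}" using A_add(1) by blast
    show "\<ominus>\<^bsub>free_algebra (generators E)\<^esub> a \<in> A" if "a \<in> A" for a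
      using that A_subset_alg A_add(3)[OF that] by (simp add: free_algebra_uminus subset_iff)
  qed (auto simp: free_algebra_def intro: A_add)
qed (use A_mult_left A_mult_right in \<open>auto simp: alg_def free_algebra_def\<close>)

lemma ideal_N: "ideal N (free_algebra (generators E))"
  unfolding N_def
  using relations_in_A A_subset_alg
  by (intro ring.genideal_ideal ring_free_algebra) (auto simp: alg_def)

lemma relations_in_N: "leavitt_relations E \<subseteq> N"
  unfolding N_def
  using relations_in_A A_subset_alg
  by (intro ring.genideal_self ring_free_algebra) (auto simp: alg_def)

lemma N_minimal: "ideal I (free_algebra (generators E)) \<Longrightarrow> leavitt_relations E \<subseteq> I \<Longrightarrow> N \<subseteq> I"
  unfolding N_def by (intro ring.genideal_minimal ring_free_algebra) auto

lemma N_subset_A: "N \<subseteq> A"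
  by (intro N_minimal ideal_A relations_in_A)

lemma additive_closed_ideal:
  assumes "ideal I (free_algebra (generators E) :: ('v, 'e, 'k) free_lpa ring)"
  shows "additive_closed I"
proof -
  interpret ideal I "free_algebra (generators E) :: ('v, 'e, 'k) free_lpa ring" by (rule assms)
  have sub: "I \<subseteq> alg" using a_subset by (simp add: alg_def)
  have "x - y \<in> I" if "x \<in> I" "y \<in> I" for x y
  proof -
    have "\<ominus>\<^bsub>free_algebra (generators E)\<^esub> y = - y"
      using that sub by (intro free_algebra_uminus) blast
    then show ?thesis using additive_subgroup.a_closed[OF is_additive_subgroup that(1) additive_subgroup.a_inv_closed[OF is_additive_subgroup that(2)]]
      by (simp add: free_algebra_def)
  qed
  then show ?thesis using additive_subgroup.zero_closed[OF is_additive_subgroup]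
    by (auto simp: additive_closed_def free_algebra_def)
qed

lemmas additive_closed_N = additive_closed_ideal[OF ideal_N]
lemmas N_add = additive_closedD[OF additive_closed_N]

lemma N_mult: "a \<in> alg \<Longrightarrow> x \<in> N \<Longrightarrow> a * x \<in> N" "a \<in> alg \<Longrightarrow> x \<in> N \<Longrightarrow> x * a \<in> N"
  using ideal.I_l_closed[OF ideal_N, of x a] ideal.I_r_closed[OF ideal_N, of x a]
  by (auto simp: alg_def free_algebra_def)

definition eqv :: "('v, 'e, 'k) free_lpa \<Rightarrow> ('v, 'e, 'k) free_lpa \<Rightarrow> bool"  (infix "\<approx>" 50)
  where "x \<approx> y \<longleftrightarrow> x - y \<in> N"

lemma eqv_refl [simp, intro]: "x \<approx> x"
  by (simp add: eqv_def N_add)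

lemma eqv_sym: "x \<approx> y \<Longrightarrow> y \<approx> x"
  using N_add(3)[of "x - y"] by (simp add: eqv_def)

lemma eqv_trans [trans]: "x \<approx> y \<Longrightarrow> y \<approx> z \<Longrightarrow> x \<approx> z"
  using N_add(4)[of "x - y" "y - z"] by (simp add: eqv_def)

lemma eqv_add: "x \<approx> y \<Longrightarrow> x' \<approx> y' \<Longrightarrow> x + x' \<approx> y + y'"
  using N_add(4)[of "x - y" "x' - y'"] by (simp add: eqv_def algebra_simps)

lemma eqv_diff: "x \<approx> y \<Longrightarrow> x' \<approx> y' \<Longrightarrow> x - x' \<approx> y - y'"
  using N_add(2)[of "x - y" "x' - y'"] by (simp add: eqv_def algebra_simps)

lemma eqv_sum: "(\<And>i. i \<in> S \<Longrightarrow> f i \<approx> g i) \<Longrightarrow> sum f S \<approx> sum g S"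
  by (induction S rule: infinite_finite_induct) (auto intro: eqv_add)

lemma eqv_left: "a \<in> alg \<Longrightarrow> x \<approx> y \<Longrightarrow> a * x \<approx> a * y"
  using N_mult(1)[of a "x - y"] by (simp add: eqv_def algebra_simps)

lemma eqv_right: "a \<in> alg \<Longrightarrow> x \<approx> y \<Longrightarrow> x * a \<approx> y * a"
  using N_mult(2)[of a "x - y"] by (simp add: eqv_def algebra_simps)

lemma eqv_zero_iff: "x \<approx> 0 \<longleftrightarrow> x \<in> N"
  by (simp add: eqv_def)

lemma eqv_vx_idem: "v \<in> verts E \<Longrightarrow> vx v * vx v \<approx> vx v"
  and eqv_vx_orth: "u \<in> verts E \<Longrightarrow> v \<in> verts E \<Longrightarrow> u \<noteq> v \<Longrightarrow> vx u * vx v \<approx> 0"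
  and eqv_tail_ed: "e \<in> arcs E \<Longrightarrow> vx (tail E e) * ed e \<approx> ed e"
  and eqv_ed_head: "e \<in> arcs E \<Longrightarrow> ed e * vx (head E e) \<approx> ed e"
  and eqv_head_gh: "e \<in> arcs E \<Longrightarrow> vx (head E e) * gh e \<approx> gh e"
  and eqv_gh_tail: "e \<in> arcs E \<Longrightarrow> gh e * vx (tail E e) \<approx> gh e"
  and eqv_gh_ed: "e \<in> arcs E \<Longrightarrow> gh e * ed e \<approx> vx (head E e)"
  and eqv_gh_ed_orth: "e \<in> arcs E \<Longrightarrow> f \<in> arcs E \<Longrightarrow> e \<noteq> f \<Longrightarrow> gh e * ed f \<approx> 0"
  and eqv_CK2: "regular_vertex E v \<Longrightarrow> vx v \<approx> (\<Sum>e \<in> out_arcs E v. ed e * gh e)"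
  unfolding eqv_def diff_zero
  by (rule subsetD[OF relations_in_N]; unfold leavitt_relations_def; blast)+

text \<open>The vertices that act as identities to the left and to the right of a letter; a ghost
  edge runs backwards.\<close>

fun lv :: "('v, 'e) generator \<Rightarrow> 'v"
  where "lv (Vertex v) = v" | "lv (Edge e) = tail E e" | "lv (Ghost e) = head E e"

fun rv :: "('v, 'e) generator \<Rightarrow> 'v"
  where "rv (Vertex v) = v" | "rv (Edge e) = head E e" | "rv (Ghost e) = tail E e"

lemma lv_rv_verts: "g \<in> generators E \<Longrightarrow> lv g \<in> verts E \<and> rv g \<in> verts E"
  by (auto simp: generators_def)

abbreviation gen :: "('v, 'e) generator \<Rightarrow> ('v, 'e, 'k) free_lpa"
  where "gen g \<equiv> Poly_Mapping.single (Word [g]) 1"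

lemma eqv_lv: "g \<in> generators E \<Longrightarrow> vx (lv g) * gen g \<approx> gen g"
  and eqv_rv: "g \<in> generators E \<Longrightarrow> gen g * vx (rv g) \<approx> gen g"
  by (auto simp: generators_def eqv_vx_idem eqv_tail_ed eqv_ed_head eqv_head_gh eqv_gh_tail)

lemma gen_alg [simp]: "g \<in> generators E \<Longrightarrow> gen g \<in> alg"
  by (rule single_in_alg) simp

lemma gen_A [simp]: "g \<in> generators E \<Longrightarrow> gen g \<in> A"
  by (rule single_in_A) simp_all

lemma eqv_lv_orth:
  assumes "g \<in> generators E" "u \<in> verts E" "u \<noteq> lv g"
  shows "vx u * gen g \<approx> 0"
proof -
  have "vx u * gen g \<approx> vx u * (vx (lv g) * gen g)"
    using assms by (intro eqv_left eqv_sym[OF eqv_lv]) auto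
  also have "\<dots> = (vx u * vx (lv g)) * gen g" by (simp add: mult.assoc)
  also have "\<dots> \<approx> 0 * gen g"
    using assms lv_rv_verts by (intro eqv_right eqv_vx_orth) auto
  finally show ?thesis by simp
qed

lemma eqv_rv_orth:
  assumes "g \<in> generators E" "u \<in> verts E" "u \<noteq> rv g"
  shows "gen g * vx u \<approx> 0"
proof -
  have "gen g * vx u \<approx> (gen g * vx (rv g)) * vx u"
    using assms by (intro eqv_right eqv_sym[OF eqv_rv]) auto
  also have "\<dots> = gen g * (vx (rv g) * vx u)" by (simp add: mult.assoc)
  also have "\<dots> \<approx> gen g * 0"
    using assms lv_rv_verts by (intro eqv_left eqv_vx_orth) auto
  finally show ?thesis by simp
qed

lemma word_split:
  "Poly_Mapping.single (Word (xs @ ys)) k =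
    (Poly_Mapping.single (Word xs) k :: ('v, 'e, 'k) free_lpa) * Poly_Mapping.single (Word ys) 1"
  by (simp add: mult_single plus_word_def)

text \<open>A word only sees the vertex \<open>lv\<close> of its first letter, to which all other
  vertices are orthogonal. Quantifying over all larger finite sets \<open>S'\<close> is what makes
  the claim pass to sums, where the two sets are united.\<close>

lemma sum_vx_left:
  assumes "x \<in> A"
  shows "\<exists>S. finite S \<and> S \<subseteq> verts E \<and>
    (\<forall>S'. finite S' \<longrightarrow> S \<subseteq> S' \<longrightarrow> S' \<subseteq> verts E \<longrightarrow> (\<Sum>u\<in>S'. vx u) * x \<approx> x)"
  (is "?Q x")
proof (induction x rule: poly_mapping_additive_induct)
  case zero
  show ?case by (auto intro!: exI[of _ "{}"])
next
  case (add x y)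
  obtain S where S: "finite S" "S \<subseteq> verts E"
    "\<And>S'. finite S' \<Longrightarrow> S \<subseteq> S' \<Longrightarrow> S' \<subseteq> verts E \<Longrightarrow> (\<Sum>u\<in>S'. vx u) * x \<approx> x"
    using add.IH(1) by blast
  obtain T where T: "finite T" "T \<subseteq> verts E"
    "\<And>S'. finite S' \<Longrightarrow> T \<subseteq> S' \<Longrightarrow> S' \<subseteq> verts E \<Longrightarrow> (\<Sum>u\<in>S'. vx u) * y \<approx> y"
    using add.IH(2) by blast
  have "(\<Sum>u\<in>S'. vx u) * (x + y) \<approx> x + y"
    if "finite S'" "S \<union> T \<subseteq> S'" "S' \<subseteq> verts E" for S'
    unfolding distrib_left using that by (intro eqv_add S(3) T(3)) auto
  then show ?case using S(1,2) T(1,2) by (intro exI[of _ "S \<union> T"]) simp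
next
  case (single w k)
  then obtain g gs where w: "w = Word (g # gs)" "g \<in> generators E" "set gs \<subseteq> generators E"
    using assms by (cases w; cases "letters w") (auto simp: A_iff)
  let ?r = "Poly_Mapping.single (Word gs) k"
  have r: "?r \<in> alg" using w by (intro single_in_alg) auto
  have wx: "Poly_Mapping.single w k = gen g * ?r"
    using w by (simp add: mult_single plus_word_def)
  have "(\<Sum>u\<in>S'. vx u) * Poly_Mapping.single w k \<approx> Poly_Mapping.single w k"
    if S': "finite S'" "{lv g} \<subseteq> S'" "S' \<subseteq> verts E" for S'
  proof -
    have "(\<Sum>u\<in>S'. vx u) * Poly_Mapping.single w k =
      (\<Sum>u\<in>S' - {lv g}. vx u * gen g * ?r) + vx (lv g) * gen g * ?r"
      using S' by (subst sum.remove[of _ "lv g"])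
        (auto simp: wx distrib_right distrib_left sum_distrib_right mult.assoc)
    also have "\<dots> \<approx> (\<Sum>u\<in>S' - {lv g}. 0 * ?r) + gen g * ?r"
      using S' w r by (intro eqv_add eqv_sum eqv_right eqv_lv_orth eqv_lv) auto
    finally show ?thesis by (simp add: wx)
  qed
  then show ?case using lv_rv_verts[OF w(2)] by (intro exI[of _ "{lv g}"]) auto
qed

lemma sum_vx_right:
  assumes "x \<in> A"
  shows "\<exists>S. finite S \<and> S \<subseteq> verts E \<and>
    (\<forall>S'. finite S' \<longrightarrow> S \<subseteq> S' \<longrightarrow> S' \<subseteq> verts E \<longrightarrow> x * (\<Sum>u\<in>S'. vx u) \<approx> x)"
  (is "?Q x")
proof (induction x rule: poly_mapping_additive_induct)
  case zero
  show ?case by (auto intro!: exI[of _ "{}"])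
next
  case (add x y)
  obtain S where S: "finite S" "S \<subseteq> verts E"
    "\<And>S'. finite S' \<Longrightarrow> S \<subseteq> S' \<Longrightarrow> S' \<subseteq> verts E \<Longrightarrow> x * (\<Sum>u\<in>S'. vx u) \<approx> x"
    using add.IH(1) by blast
  obtain T where T: "finite T" "T \<subseteq> verts E"
    "\<And>S'. finite S' \<Longrightarrow> T \<subseteq> S' \<Longrightarrow> S' \<subseteq> verts E \<Longrightarrow> y * (\<Sum>u\<in>S'. vx u) \<approx> y"
    using add.IH(2) by blast
  have "(x + y) * (\<Sum>u\<in>S'. vx u) \<approx> x + y"
    if "finite S'" "S \<union> T \<subseteq> S'" "S' \<subseteq> verts E" for S'
    unfolding distrib_right using that by (intro eqv_add S(3) T(3)) auto
  then show ?case using S(1,2) T(1,2) by (intro exI[of _ "S \<union> T"]) simp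
next
  case (single w k)
  then have "letters w \<noteq> []" "set (letters w) \<subseteq> generators E" using assms by (auto simp: A_iff)
  then obtain g gs where w: "w = Word (gs @ [g])" "g \<in> generators E" "set gs \<subseteq> generators E"
    by (cases w; cases "letters w" rule: rev_cases) auto
  let ?r = "Poly_Mapping.single (Word gs) k"
  have r: "?r \<in> alg" using w by (intro single_in_alg) auto
  have wx: "Poly_Mapping.single w k = ?r * gen g"
    using w by (simp add: mult_single plus_word_def)
  have "Poly_Mapping.single w k * (\<Sum>u\<in>S'. vx u) \<approx> Poly_Mapping.single w k"
    if S': "finite S'" "{rv g} \<subseteq> S'" "S' \<subseteq> verts E" for S'
  proof -
    have "Poly_Mapping.single w k * (\<Sum>u\<in>S'. vx u) =
      (\<Sum>u\<in>S' - {rv g}. ?r * (gen g * vx u)) + ?r * (gen g * vx (rv g))"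
      using S' by (subst sum.remove[of _ "rv g"])
        (auto simp: wx distrib_right distrib_left sum_distrib_left mult.assoc)
    also have "\<dots> \<approx> (\<Sum>u\<in>S' - {rv g}. ?r * 0) + ?r * gen g"
      using S' w r by (intro eqv_add eqv_sum eqv_left eqv_rv_orth eqv_rv) auto
    finally show ?thesis by (simp add: wx)
  qed
  then show ?case using lv_rv_verts[OF w(2)] by (intro exI[of _ "{rv g}"]) auto
qed

lemma local_unit_quotient_lpa: "local_unit_quotient A N (leavitt_path_algebra scalars E)"
proof
  let ?L = "leavitt_path_algebra scalars E"
  let ?U = "free_algebra (generators E) :: ('v, 'e, 'k) free_lpa ring"
  interpret I: ideal N ?U by (rule ideal_N)
  have cos: "N +>\<^bsub>R\<^esub> a = coset_of N a" if "add R = (+)" for a and R :: "('v, 'e, 'k) free_lpa ring"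
    using that by (auto simp: a_r_coset_def r_coset_def coset_of_def image_iff)
  have addU: "add ?U = (+)" "mult ?U = (*)" by (simp_all add: free_algebra_def)
  have add': "add (free_nonunital_algebra (generators E) :: ('v, 'e, 'k) free_lpa ring) = (+)"
    "mult (free_nonunital_algebra (generators E) :: ('v, 'e, 'k) free_lpa ring) = (*)"
    by (simp_all add: free_nonunital_algebra_def free_algebra_def)
  show "additive_closed A" by (rule additive_closed_A)
  show "a * b \<in> A" if "a \<in> A" "b \<in> A" for a b using A_mult that .
  show "additive_closed N" by (rule additive_closed_N)
  show "N \<subseteq> A" by (rule N_subset_A)
  show "a * x \<in> N" "x * a \<in> N" if "a \<in> A" "x \<in> N" for a x using N_mult that A_subset_alg by auto
  show "\<exists>u\<in>A. u * x - x \<in> N" if x: "x \<in> A" for x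
  proof -
    obtain S where S: "finite S" "S \<subseteq> verts E" "(\<Sum>u\<in>S. vx u) * x \<approx> x"
      using sum_vx_left[OF x] by blast
    have "(\<Sum>u\<in>S. vx u) \<in> A"
      using S(2) by (intro additive_closed_sum[OF additive_closed_A]) auto
    then show ?thesis using S(3) unfolding eqv_def by blast
  qed
  show "\<exists>u\<in>A. x * u - x \<in> N" if x: "x \<in> A" for x
  proof -
    obtain S where S: "finite S" "S \<subseteq> verts E" "x * (\<Sum>u\<in>S. vx u) \<approx> x"
      using sum_vx_right[OF x] by blast
    have "(\<Sum>u\<in>S. vx u) \<in> A"
      using S(2) by (intro additive_closed_sum[OF additive_closed_A]) auto
    then show ?thesis using S(3) unfolding eqv_def by blast
  qed
  show "carrier ?L = coset_of N ` A"
    using cos[OF add'(1)]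
    by (auto simp: leavitt_path_algebra_def FactRing_def A_RCOSETS_def' A_def
        simp flip: N_def a_r_coset_def')
  show "\<zero>\<^bsub>?L\<^esub> = coset_of N 0"
    by (simp add: leavitt_path_algebra_def FactRing_def coset_of_def N_def)
  fix a b assume ab: "a \<in> A" "b \<in> A"
  then have ab': "a \<in> carrier ?U" "b \<in> carrier ?U" using A_subset_alg by (auto simp: alg_def)
  show "coset_of N a \<oplus>\<^bsub>?L\<^esub> coset_of N b = coset_of N (a + b)"
    using I.a_rcos_sum[OF ab'] 
    by (simp add: leavitt_path_algebra_def FactRing_def cos addU set_add_def set_mult_def add')
  show "coset_of N a \<otimes>\<^bsub>?L\<^esub> coset_of N b = coset_of N (a * b)"
    using I.rcoset_mult_add[OF ab']
    by (simp add: leavitt_path_algebra_def FactRing_def cos addU rcoset_mult_def add' flip: N_def)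
qed

end

sublocale leavitt \<subseteq> local_unit_quotient A N "leavitt_path_algebra scalars E"
  by (rule local_unit_quotient_lpa)

section \<open>Real and ghost paths and their products\<close>

context leavitt
begin

text \<open>The extra vertex letter makes the empty path at \<open>u\<close> equal to
  \<open>vx u\<close> and keeps the word nonempty, hence in \<open>A\<close>. The variants
  \<open>eds\<close> and \<open>ghs\<close> omit it and give \<open>1\<close> for the empty
  list.\<close>

definition pth :: "'v \<Rightarrow> 'e list \<Rightarrow> ('v, 'e, 'k) free_lpa"
  where "pth u p = Poly_Mapping.single (Word (Vertex u # map Edge p)) 1"

definition gpth :: "'v \<Rightarrow> 'e list \<Rightarrow> ('v, 'e, 'k) free_lpa"
  where "gpth u p = Poly_Mapping.single (Word (map Ghost (rev p) @ [Vertex u])) 1"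

definition eds :: "'e list \<Rightarrow> ('v, 'e, 'k) free_lpa"
  where "eds p = Poly_Mapping.single (Word (map Edge p)) 1"

definition ghs :: "'e list \<Rightarrow> ('v, 'e, 'k) free_lpa"
  where "ghs p = Poly_Mapping.single (Word (map Ghost (rev p))) 1"

lemma pth_Nil: "pth u [] = vx u" and gpth_Nil: "gpth u [] = vx u"
  by (simp_all add: pth_def gpth_def)

lemma pth_eds: "pth u p = vx u * eds p" and gpth_ghs: "gpth u p = ghs p * vx u"
  by (simp_all add: pth_def gpth_def eds_def ghs_def mult_single plus_word_def)

lemma eds_Cons: "eds (e # p) = ed e * eds p" and eds_append: "eds (p @ q) = eds p * eds q"
  and ghs_Cons: "ghs (e # p) = ghs p * gh e" and ghs_append: "ghs (p @ q) = ghs q * ghs p"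
  by (simp_all add: eds_def ghs_def mult_single plus_word_def zero_word_def flip: single_one)

lemma path_alg [simp]:
  "set p \<subseteq> arcs E \<Longrightarrow> eds p \<in> alg" "set p \<subseteq> arcs E \<Longrightarrow> ghs p \<in> alg"
  unfolding eds_def ghs_def by (rule single_in_alg, force)+

lemma path_A:
  assumes "awalk u p v"
  shows "pth u p \<in> A" "gpth u p \<in> A"
proof -
  have "u \<in> verts E" "set p \<subseteq> arcs E" using assms by (auto simp: awalk_def)
  then show "pth u p \<in> A" "gpth u p \<in> A"
    unfolding pth_def gpth_def by (intro single_in_A; force)+
qed

lemma path_in_alg:
  assumes "awalk u p v"
  shows "pth u p \<in> alg" "gpth u p \<in> alg" "eds p \<in> alg" "ghs p \<in> alg"
    "vx u \<in> alg" "vx v \<in> alg"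
  using path_A[OF assms] A_subset_alg assms by (auto simp: awalk_def awalk_last_in_verts[OF assms])

lemma awalk_ConsD:
  assumes "awalk u (e # p) v"
  shows "e \<in> arcs E" "tail E e = u" "awalk (head E e) p v"
  using assms by (auto simp: awalk_Cons_iff)

lemma vx_pth:
  assumes "awalk u p v"
  shows "vx u * pth u p \<approx> pth u p" "gpth u p * vx u \<approx> gpth u p"
proof -
  note in_alg = path_in_alg[OF assms]
  have u: "u \<in> verts E" using assms by auto
  have "(vx u * vx u) * eds p \<approx> vx u * eds p" "ghs p * (vx u * vx u) \<approx> ghs p * vx u"
    by (rule eqv_right[OF in_alg(3) eqv_vx_idem[OF u]] eqv_left[OF in_alg(4) eqv_vx_idem[OF u]])+
  then show "vx u * pth u p \<approx> pth u p" "gpth u p * vx u \<approx> gpth u p"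
    by (simp_all add: pth_eds gpth_ghs mult.assoc)
qed

lemma pth_Cons:
  assumes "awalk u (e # p) v"
  shows "pth u (e # p) \<approx> ed e * pth (head E e) p" "gpth u (e # p) \<approx> gpth (head E e) p * gh e"
proof -
  note e = awalk_ConsD[OF assms]
  note in_alg = path_in_alg[OF e(3)]
  have "(vx u * ed e) * eds p \<approx> ed e * eds p"
    using eqv_right[OF in_alg(3) eqv_tail_ed[OF e(1)]] e(2) by simp
  also have "\<dots> \<approx> (ed e * vx (head E e)) * eds p"
    by (rule eqv_right[OF in_alg(3) eqv_sym[OF eqv_ed_head[OF e(1)]]])
  finally show "pth u (e # p) \<approx> ed e * pth (head E e) p"
    by (simp add: pth_eds eds_Cons mult.assoc)
  have "ghs p * (gh e * vx u) \<approx> ghs p * gh e"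
    using eqv_left[OF in_alg(4) eqv_gh_tail[OF e(1)]] e(2) by simp
  also have "\<dots> \<approx> ghs p * (vx (head E e) * gh e)"
    by (rule eqv_left[OF in_alg(4) eqv_sym[OF eqv_head_gh[OF e(1)]]])
  finally show "gpth u (e # p) \<approx> gpth (head E e) p * gh e"
    by (simp add: gpth_ghs ghs_Cons mult.assoc)
qed

lemma pth_vx:
  assumes "awalk u p v"
  shows "pth u p * vx v \<approx> pth u p" "vx v * gpth u p \<approx> gpth u p"
proof -
  have "pth u p * vx v \<approx> pth u p \<and> vx v * gpth u p \<approx> gpth u p"
    using assms
  proof (induction p arbitrary: u)
    case Nil
    then show ?case by (auto simp: pth_Nil gpth_Nil awalk_Nil_iff eqv_vx_idem)
  next
    case (Cons e p)
    note e = awalk_ConsD[OF Cons.prems]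
    note IH = Cons.IH[OF e(3)]
    note in_alg = path_in_alg[OF e(3)]
    have "pth u (e # p) * vx v \<approx> ed e * (pth (head E e) p * vx v)"
      using eqv_right[OF in_alg(6) pth_Cons(1)[OF Cons.prems]] by (simp add: mult.assoc)
    also have "\<dots> \<approx> ed e * pth (head E e) p" using IH e by (intro eqv_left) auto
    also have "\<dots> \<approx> pth u (e # p)" by (rule eqv_sym[OF pth_Cons(1)[OF Cons.prems]])
    finally have 1: "pth u (e # p) * vx v \<approx> pth u (e # p)" .
    have "vx v * gpth u (e # p) \<approx> (vx v * gpth (head E e) p) * gh e"
      using eqv_left[OF in_alg(6) pth_Cons(2)[OF Cons.prems]] by (simp add: mult.assoc)
    also have "\<dots> \<approx> gpth (head E e) p * gh e" using IH e by (intro eqv_right) auto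
    also have "\<dots> \<approx> gpth u (e # p)" by (rule eqv_sym[OF pth_Cons(2)[OF Cons.prems]])
    finally show ?case using 1 by simp
  qed
  then show "pth u p * vx v \<approx> pth u p" "vx v * gpth u p \<approx> gpth u p" by auto
qed

lemma pth_append:
  assumes "awalk u p v" "awalk v q w"
  shows "pth u p * pth v q \<approx> pth u (p @ q)" "gpth v q * gpth u p \<approx> gpth u (p @ q)"
proof -
  have "(pth u p * vx v) * eds q \<approx> pth u p * eds q"
    by (rule eqv_right[OF path_in_alg(3)[OF assms(2)] pth_vx(1)[OF assms(1)]])
  then show "pth u p * pth v q \<approx> pth u (p @ q)"
    by (simp add: pth_eds eds_append mult.assoc)
  have "ghs q * (vx v * gpth u p) \<approx> ghs q * gpth u p"
    by (rule eqv_left[OF path_in_alg(4)[OF assms(2)] pth_vx(2)[OF assms(1)]])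
  then show "gpth v q * gpth u p \<approx> gpth u (p @ q)"
    by (simp add: gpth_ghs ghs_append mult.assoc)
qed

lemma vx_pth_orth:
  assumes "awalk u p v" "u' \<in> verts E" "u' \<noteq> u"
  shows "vx u' * pth u p \<approx> 0" "gpth u p * vx u' \<approx> 0"
proof -
  note in_alg = path_in_alg[OF assms(1)]
  have u: "u \<in> verts E" using assms by auto
  have "(vx u' * vx u) * eds p \<approx> 0 * eds p"
    using assms u by (intro eqv_right eqv_vx_orth in_alg) auto
  then show "vx u' * pth u p \<approx> 0" by (simp add: pth_eds mult.assoc)
  have "ghs p * (vx u * vx u') \<approx> ghs p * 0"
    using assms u by (intro eqv_left eqv_vx_orth in_alg) auto
  then show "gpth u p * vx u' \<approx> 0" by (simp add: gpth_ghs mult.assoc)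
qed

lemma gpth_pth:
  assumes "awalk u p v"
  shows "gpth u p * pth u p \<approx> vx v"
  using assms
proof (induction p arbitrary: u)
  case Nil
  then show ?case by (auto simp: pth_Nil gpth_Nil awalk_Nil_iff eqv_vx_idem)
next
  case (Cons e p)
  note e = awalk_ConsD[OF Cons.prems]
  note in_alg = path_in_alg[OF e(3)] path_in_alg[OF Cons.prems]
  let ?h = "head E e"
  have "gpth u (e # p) * pth u (e # p) \<approx> gpth u (e # p) * (ed e * pth ?h p)"
    by (intro eqv_left in_alg pth_Cons[OF Cons.prems])
  also have "\<dots> \<approx> gpth ?h p * gh e * (ed e * pth ?h p)"
    using e(1) by (intro eqv_right in_alg pth_Cons[OF Cons.prems] alg_mult) auto
  also have "\<dots> = gpth ?h p * (gh e * ed e) * pth ?h p" by (simp add: mult.assoc)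
  also have "\<dots> \<approx> gpth ?h p * vx ?h * pth ?h p"
    using e(1) by (intro eqv_right eqv_left in_alg eqv_gh_ed)
  also have "\<dots> \<approx> gpth ?h p * pth ?h p"
    by (intro eqv_right in_alg vx_pth[OF e(3)])
  also have "\<dots> \<approx> vx v" by (rule Cons.IH[OF e(3)])
  finally show ?case .
qed

lemma gpth_pth_append:
  assumes "awalk u p v" "awalk v t w"
  shows "gpth u p * pth u (p @ t) \<approx> pth v t" "gpth u (p @ t) * pth u p \<approx> gpth v t"
proof -
  note in_alg = path_in_alg[OF assms(1)] path_in_alg[OF assms(2)]
  have "gpth u p * pth u (p @ t) \<approx> gpth u p * (pth u p * pth v t)"
    by (intro eqv_left in_alg eqv_sym[OF pth_append(1)[OF assms]])
  also have "\<dots> = (gpth u p * pth u p) * pth v t" by (simp add: mult.assoc)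
  also have "\<dots> \<approx> vx v * pth v t" by (intro eqv_right in_alg gpth_pth[OF assms(1)])
  also have "\<dots> \<approx> pth v t" by (rule vx_pth[OF assms(2)])
  finally show "gpth u p * pth u (p @ t) \<approx> pth v t" .
  have "gpth u (p @ t) * pth u p \<approx> (gpth v t * gpth u p) * pth u p"
    by (intro eqv_right in_alg eqv_sym[OF pth_append(2)[OF assms]])
  also have "\<dots> = gpth v t * (gpth u p * pth u p)" by (simp add: mult.assoc)
  also have "\<dots> \<approx> gpth v t * vx v" by (intro eqv_left in_alg gpth_pth[OF assms(1)])
  also have "\<dots> \<approx> gpth v t" by (rule vx_pth[OF assms(2)])
  finally show "gpth u (p @ t) * pth u p \<approx> gpth v t" .
qed

lemma gpth_pth_source_orth:
  assumes "awalk u p v" "awalk u' q w" "u \<noteq> u'"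
  shows "gpth u p * pth u' q \<approx> 0"
proof -
  have 0: "gpth u p * (vx u * pth u' q) \<approx> gpth u p * 0"
    using assms by (intro eqv_left path_in_alg[OF assms(1)] vx_pth_orth[OF assms(2)]) auto
  have "gpth u p * (vx u * pth u' q) \<approx> gpth u p * pth u' q"
    using eqv_right[OF path_in_alg(1)[OF assms(2)] vx_pth(2)[OF assms(1)]] by (simp add: mult.assoc)
  from eqv_trans[OF eqv_sym[OF this] 0] show ?thesis by simp
qed

lemma gpth_pth_orth:
  assumes "awalk u p v" "awalk u q w" "\<nexists>t. q = p @ t" "\<nexists>t. p = q @ t"
  shows "gpth u p * pth u q \<approx> 0"
  using assms
proof (induction p arbitrary: u q)
  case Nil
  then show ?case by simp
next
  case (Cons e p)
  then obtain f q' where q: "q = f # q'" by (cases q) auto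
  note e = awalk_ConsD[OF Cons.prems(1)]
  note f = awalk_ConsD[OF Cons.prems(2)[unfolded q]]
  let ?h = "head E e" and ?h' = "head E f"
  note in_alg = path_in_alg[OF e(3)] path_in_alg[OF f(3)] path_in_alg[OF Cons.prems(1)]
    path_in_alg[OF Cons.prems(2)]
  have "gpth u (e # p) * pth u q \<approx> gpth u (e # p) * (ed f * pth ?h' q')"
    unfolding q by (intro eqv_left in_alg pth_Cons[OF Cons.prems(2)[unfolded q]])
  also have "\<dots> \<approx> gpth ?h p * gh e * (ed f * pth ?h' q')"
    using f(1) by (intro eqv_right in_alg pth_Cons[OF Cons.prems(1)] alg_mult) auto
  also have "\<dots> = gpth ?h p * (gh e * ed f) * pth ?h' q'" by (simp add: mult.assoc)
  also have "\<dots> \<approx> 0"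
  proof (cases "e = f")
    case True
    have "gpth ?h p * (gh e * ed f) * pth ?h' q' \<approx> gpth ?h p * vx ?h * pth ?h' q'"
      unfolding True using f(1) in_alg by (intro eqv_right eqv_left eqv_gh_ed) (simp_all add: True)
    also have "\<dots> \<approx> gpth ?h p * pth ?h' q'"
      by (intro eqv_right in_alg vx_pth[OF e(3)])
    also have "\<dots> \<approx> 0"
      using Cons.IH[OF e(3) f(3)[folded True]] Cons.prems(3,4) q True by auto
    finally show ?thesis .
  next
    case False
    have "gpth ?h p * (gh e * ed f) * pth ?h' q' \<approx> gpth ?h p * 0 * pth ?h' q'"
      using False e f by (intro eqv_right eqv_left eqv_gh_ed_orth in_alg)
    then show ?thesis by simp
  qed
  finally show ?case .
qed

subsection \<open>Monomials\<close>

text \<open>The tuple encodes a scalar multiple of \<open>p q\<^sup>*\<close>. The starts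
  \<open>u\<close> and \<open>v\<close> are stored because an empty list of edges does not show
  them; they determine the common end.\<close>

definition valid :: "'k \<times> 'v \<times> 'e list \<times> 'v \<times> 'e list \<Rightarrow> bool"
  where "valid = (\<lambda>(k, u, p, v, q). \<exists>w. awalk u p w \<and> awalk v q w)"

definition mon :: "'k \<times> 'v \<times> 'e list \<times> 'v \<times> 'e list \<Rightarrow> ('v, 'e, 'k) free_lpa"
  where "mon = (\<lambda>(k, u, p, v, q). scal k * (pth u p * gpth v q))"

lemma mon_A: "valid t \<Longrightarrow> mon t \<in> A"
  unfolding valid_def mon_def
  by (auto split: prod.splits intro!: A_mult_left[OF scal_alg A_mult] path_A)

text \<open>The list may contain repetitions: no normal form and no uniqueness is intended.\<close>

definition spanned :: "('v, 'e, 'k) free_lpa \<Rightarrow> bool"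
  where "spanned x \<longleftrightarrow> (\<exists>ts. (\<forall>t\<in>set ts. valid t) \<and> x \<approx> sum_list (map mon ts))"

lemma spanned_eqv: "x \<approx> y \<Longrightarrow> spanned y \<Longrightarrow> spanned x"
  unfolding spanned_def by (meson eqv_trans)

lemma spanned_zero: "spanned 0"
  unfolding spanned_def by (intro exI[of _ "[]"]) auto

lemma spanned_add: "spanned x \<Longrightarrow> spanned y \<Longrightarrow> spanned (x + y)"
proof -
  assume "spanned x" "spanned y"
  then obtain ts ts' where *: "\<forall>t\<in>set ts. valid t" "\<forall>t\<in>set ts'. valid t"
    "x \<approx> sum_list (map mon ts)" "y \<approx> sum_list (map mon ts')"
    unfolding spanned_def by blast
  show ?thesis unfolding spanned_def
    using * eqv_add[OF *(3,4)] by (intro exI[of _ "ts @ ts'"]) auto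
qed

lemma spanned_mon: "valid t \<Longrightarrow> spanned (mon t)"
  unfolding spanned_def by (intro exI[of _ "[t]"]) auto

lemma spanned_mult:
  assumes "a \<in> alg" "spanned x" "\<And>t. valid t \<Longrightarrow> spanned (a * mon t)"
  shows "spanned (a * x)"
proof -
  obtain ts where ts: "\<forall>t\<in>set ts. valid t" "x \<approx> sum_list (map mon ts)"
    using assms(2) by (auto simp: spanned_def)
  have "spanned (a * sum_list (map mon ts))"
    using ts(1) by (induction ts) (auto simp: distrib_left spanned_zero intro!: spanned_add assms(3))
  then show ?thesis using spanned_eqv eqv_left[OF assms(1) ts(2)] by blast
qed

lemma spanned_scal: "spanned x \<Longrightarrow> spanned (scal k * x)"
proof (rule spanned_mult)
  fix t assume "valid t"
  then show "spanned (scal k * mon t)"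
    using spanned_mon[of "(k * fst t, snd t)"]
    by (cases t) (auto simp: mon_def valid_def mult_single simp flip: mult.assoc)
qed simp_all

text \<open>A letter on the left extends, keeps or shortens \<open>p\<close>, or gives zero. Only a
  ghost edge that meets an empty \<open>p\<close> changes \<open>q\<close>: it is appended to
  it.\<close>

lemma gen_mult_pth:
  assumes g: "g \<in> generators E" and p: "awalk u p w" and q: "awalk v q w"
  shows "spanned (gen g * (pth u p * gpth v q))"
proof -
  note in_alg = path_in_alg[OF p] path_in_alg[OF q]
  have 0: "spanned (pth u' p' * gpth v' q')" if "awalk u' p' w'" "awalk v' q' w'" for u' p' v' q' w'
    using spanned_mon[of "(1, u', p', v', q')"] that by (auto simp: mon_def valid_def)
  have 1: "spanned (gen g * (pth u p * gpth v q))" if "gen g * pth u p \<approx> x" "spanned (x * gpth v q)" for x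
    using spanned_eqv[OF eqv_right[OF in_alg(8) that(1)] that(2)] by (simp add: mult.assoc)
  have w: "w \<in> verts E" using p by auto
  show ?thesis
  proof (cases g)
    case (Vertex u')
    then have u': "u' \<in> verts E" using g by simp
    show ?thesis
    proof (cases "u' = u")
      case True
      show ?thesis by (rule 1[of "pth u p"]) (use Vertex True 0[OF p q] vx_pth[OF p] in auto)
    next
      case False
      show ?thesis by (rule 1[of 0]) (use Vertex False u' vx_pth_orth[OF p] spanned_zero in auto)
    qed
  next
    case (Edge e)
    then have e: "e \<in> arcs E" using g by simp
    show ?thesis
    proof (cases "head E e = u")
      case True
      have ep: "awalk (tail E e) (e # p) w" using p True e by (simp add: awalk_Cons_iff)
      have "ed e * pth u p \<approx> pth (tail E e) (e # p)" using eqv_sym[OF pth_Cons(1)[OF ep]] True by simp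
      then show ?thesis using 1 0[OF ep q] Edge by blast
    next
      case False
      have "ed e * pth u p \<approx> (ed e * vx (head E e)) * pth u p"
        using e by (intro eqv_right in_alg eqv_sym[OF eqv_ed_head])
      also have "\<dots> = ed e * (vx (head E e) * pth u p)" by (simp add: mult.assoc)
      also have "\<dots> \<approx> ed e * 0" using False e by (intro eqv_left vx_pth_orth[OF p]) auto
      finally show ?thesis using 1[of 0] spanned_zero Edge by simp
    qed
  next
    case (Ghost e)
    then have e: "e \<in> arcs E" using g by simp
    have hd: "awalk (head E e) [] (head E e)" "awalk (tail E e) [e] (head E e)"
      using e by (auto simp: awalk_Nil_iff awalk_Cons_iff)
    show ?thesis
    proof (cases p)
      case Nil
      then have uw: "u = w" using p by (simp add: awalk_Nil_iff)
      have 2: "gh e * (pth u p * gpth v q) \<approx> gh e * gpth v q"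
        unfolding Nil pth_Nil uw using e by (intro eqv_left pth_vx[OF q]) auto
      show ?thesis
      proof (cases "tail E e = w")
        case True
        have we: "awalk w [e] (head E e)" using hd True by simp
        have qe: "awalk v (q @ [e]) (head E e)" using q we by (auto simp: awalk_append_iff)
        have "gh e \<approx> gpth w [e]"
          using eqv_sym[OF pth_Cons(2)[OF we]] eqv_head_gh[OF e]
          by (auto simp: gpth_Nil intro: eqv_trans eqv_sym)
        then have "gh e * gpth v q \<approx> gpth w [e] * gpth v q" by (intro eqv_right in_alg)
        also have "\<dots> \<approx> gpth v (q @ [e])" by (rule pth_append(2)[OF q we])
        also have "\<dots> \<approx> pth (head E e) [] * gpth v (q @ [e])"
          using eqv_sym[OF pth_vx(2)[OF qe]] by (simp add: pth_Nil)
        finally show ?thesis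
          using spanned_eqv[OF eqv_trans[OF 2] 0[OF hd(1) qe]] Ghost by simp
      next
        case False
        have "gh e * gpth v q \<approx> (gh e * vx (tail E e)) * gpth v q"
          using e by (intro eqv_right in_alg eqv_sym[OF eqv_gh_tail])
        also have "\<dots> \<approx> (gh e * vx (tail E e)) * (vx w * gpth v q)"
          using e by (intro eqv_left alg_mult eqv_sym[OF pth_vx(2)[OF q]]) auto
        also have "\<dots> = gh e * (vx (tail E e) * vx w) * gpth v q" by (simp add: mult.assoc)
        also have "\<dots> \<approx> gh e * 0 * gpth v q"
          using False e w by (intro eqv_right eqv_left eqv_vx_orth in_alg) auto
        finally show ?thesis using spanned_eqv[OF eqv_trans[OF 2]] spanned_zero Ghost by simp
      qed
    next
      case (Cons f p')
      note f = awalk_ConsD[OF p[unfolded Cons]]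
      have 3: "gh e * pth u p \<approx> (gh e * ed f) * pth (head E f) p'"
        using eqv_left[OF _ pth_Cons(1)[OF p[unfolded Cons]], of "gh e"] e Cons
        by (simp add: mult.assoc)
      show ?thesis
      proof (cases "e = f")
        case True
        have "(gh e * ed f) * pth (head E f) p' \<approx> vx (head E f) * pth (head E f) p'"
          unfolding True by (intro eqv_right path_in_alg[OF f(3)] eqv_gh_ed[OF f(1)])
        also have "\<dots> \<approx> pth (head E f) p'" by (rule vx_pth[OF f(3)])
        finally show ?thesis using 1 eqv_trans[OF 3] 0[OF f(3) q] Ghost by blast
      next
        case False
        have "(gh e * ed f) * pth (head E f) p' \<approx> 0 * pth (head E f) p'"
          using False e f by (intro eqv_right path_in_alg[OF f(3)] eqv_gh_ed_orth)
        then show ?thesis using 1[of 0] eqv_trans[OF 3] spanned_zero Ghost by simp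
      qed
    qed
  qed
qed

lemma spanned_gen_mult: "g \<in> generators E \<Longrightarrow> spanned x \<Longrightarrow> spanned (gen g * x)"
proof (rule spanned_mult)
  fix t assume g: "g \<in> generators E" and "valid t"
  then obtain k u p v q w where t: "t = (k, u, p, v, q)" "awalk u p w" "awalk v q w"
    by (cases t) (auto simp: valid_def)
  have "gen g * mon t = scal k * (gen g * (pth u p * gpth v q))"
    using scal_commute[of k "gen g"] by (simp add: mon_def t(1) flip: mult.assoc)
  then show "spanned (gen g * mon t)" using spanned_scal gen_mult_pth[OF g t(2,3)] by simp
qed simp_all

lemma spanned_A:
  assumes "x \<in> A"
  shows "spanned x"
proof (induction x rule: poly_mapping_additive_induct)
  case (single w k)
  then have w: "letters w \<noteq> []" "set (letters w) \<subseteq> generators E" using assms by (auto simp: A_iff)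
  have "spanned (Poly_Mapping.single (Word ws) 1)" if "ws \<noteq> []" "set ws \<subseteq> generators E" for ws
    using that
  proof (induction ws)
    case (Cons g ws)
    then have g: "g \<in> generators E" by simp
    show ?case
    proof (cases "ws = []")
      case True
      have r: "awalk (rv g) [] (rv g)" using lv_rv_verts[OF g] by (simp add: awalk_Nil_iff)
      have "spanned (vx (rv g))"
        using spanned_mon[of "(1, rv g, [], rv g, [])"] r
        by (auto simp: mon_def valid_def pth_Nil gpth_Nil
            intro: spanned_eqv[OF eqv_sym[OF eqv_vx_idem]] lv_rv_verts[OF g, THEN conjunct2])
      then show ?thesis
        using spanned_gen_mult[OF g] spanned_eqv[OF eqv_sym[OF eqv_rv[OF g]]] True by blast
    next
      case False
      then have "spanned (gen g * Poly_Mapping.single (Word ws) 1)"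
        using Cons by (intro spanned_gen_mult) auto
      then show ?thesis using word_split[of "[g]" ws 1] by simp
    qed
  qed simp
  from spanned_scal[OF this[OF w], of k] show ?case
    by (cases w) (simp flip: single_eq_scal)
qed (auto intro: spanned_zero spanned_add)

section \<open>Closed paths and Condition (K)\<close>

lemma awalk_append_cancel:
  assumes "awalk u (p @ q) w" "awalk u p v"
  shows "awalk v q w"
  using assms
proof (induction p arbitrary: u)
  case (Cons e p)
  then show ?case by (auto simp: awalk_Cons_iff)
qed (simp add: awalk_Nil_iff)

text \<open>Cut \<open>t\<close> at its first return to \<open>v\<close>: what remains is empty or
  begins with an edge that leaves \<open>v\<close>.\<close>

lemma simple_closed_path_prefix:
  assumes t: "awalk v t v" "t \<noteq> []"
  shows "\<exists>s t'. t = s @ t' \<and> simple_closed_path E v s"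
proof -
  obtain e r where er: "t = e # r" using t(2) by (cases t) auto
  define r1 r2 where "r1 = takeWhile (\<lambda>e. tail E e \<noteq> v) r" and "r2 = dropWhile (\<lambda>e. tail E e \<noteq> v) r"
  have r: "r = r1 @ r2" by (simp add: r1_def r2_def)
  have ne: "\<forall>e\<in>set r1. tail E e \<noteq> v" by (auto simp: r1_def dest: set_takeWhileD)
  obtain w where w: "awalk v (e # r1) w" "awalk w r2 v"
    using t(1) unfolding er r by (metis append_Cons awalk_append_iff)
  have "w = v"
  proof (cases r2)
    case Nil
    then show ?thesis using w(2) by (simp add: awalk_Nil_iff)
  next
    case (Cons f r3)
    then have "tail E f = v" unfolding r2_def using hd_dropWhile[of "\<lambda>e. tail E e \<noteq> v" r] by auto
    then show ?thesis using w(2) Cons by (simp add: awalk_Cons_iff)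
  qed
  then have "simple_closed_path E v (e # r1)" using w ne by (simp add: simple_closed_path_def)
  then show ?thesis using er r by (metis append_Cons)
qed

text \<open>Simple closed paths at \<open>v\<close> form a prefix code, since a proper extension of
  one of them would leave \<open>v\<close> a second time.\<close>

lemma simple_closed_path_eq:
  assumes "simple_closed_path E v s" "simple_closed_path E v t" "s @ a = t @ b"
  shows "s = t"
proof -
  have *: "us = []" if "simple_closed_path E v (t @ us)" "simple_closed_path E v t" for t us
  proof (rule ccontr)
    assume us: "us \<noteq> []"
    have t: "t \<noteq> []" "awalk v t v" and tus: "awalk v (t @ us) v" "\<forall>e\<in>set (tl (t @ us)). tail E e \<noteq> v"
      using that by (auto simp: simple_closed_path_def)
    have "awalk v us v" by (rule awalk_append_cancel[OF tus(1) t(2)])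
    then have "tail E (hd us) = v" using us by (cases us) (auto simp: awalk_Cons_iff)
    moreover have "hd us \<in> set (tl (t @ us))" using t us by (simp add: tl_append2)
    ultimately show False using tus(2) by blast
  qed
  obtain us where "s = t @ us \<or> t = s @ us" using assms(3) by (auto simp: append_eq_append_conv2)
  then show ?thesis using *[of t us] *[of s us] assms(1,2) by auto
qed

lemma another_simple_closed_path:
  assumes "condition_K E" "simple_closed_path E v s"
  shows "\<exists>q. simple_closed_path E v q \<and> q \<noteq> s"
proof -
  have "v \<in> verts E" using assms(2) by (auto simp: simple_closed_path_def)
  then show ?thesis using assms unfolding condition_K_def by blast
qed

section \<open>Ideals and vertices\<close>

lemma bi_ideal_eqv:
  assumes "bi_ideal I" "x \<approx> y"
  shows "x \<in> I \<longleftrightarrow> y \<in> I"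
  using additive_closed_cong[OF bi_idealD(2)[OF assms(1)]] assms bi_idealD(3)[OF assms(1)]
  by (auto simp: eqv_def)

text \<open>A local unit \<open>u\<close> of \<open>x\<close> replaces the multiplier
  \<open>a\<close> by \<open>a * u\<close> or \<open>u * a\<close>, which is in \<open>A\<close>. In
  particular, ideals are closed under scalars.\<close>

lemma bi_ideal_alg:
  assumes I: "bi_ideal I" and x: "x \<in> I" and a: "a \<in> alg"
  shows "a * x \<in> I" "x * a \<in> I"
proof -
  have xA: "x \<in> A" using bi_idealD(4)[OF I] x by blast
  obtain u where u: "u \<in> A" "u * x \<approx> x" using left_unit[OF xA] by (auto simp: eqv_def)
  have "a * u * x \<in> I" using bi_idealD(5)[OF I A_mult_left[OF a u(1)] x] .
  then show "a * x \<in> I" using bi_ideal_eqv[OF I eqv_left[OF a u(2)]] by (simp add: mult.assoc)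
  obtain u where u: "u \<in> A" "x * u \<approx> x" using right_unit[OF xA] by (auto simp: eqv_def)
  have "x * (u * a) \<in> I" using bi_idealD(6)[OF I A_mult_right[OF u(1) a] x] .
  then show "x * a \<in> I" using bi_ideal_eqv[OF I eqv_right[OF a u(2)]] by (simp add: mult.assoc)
qed

lemma bi_ideal_scal:
  assumes "bi_ideal I" "scal k * x \<in> I" "k \<noteq> 0"
  shows "x \<in> I"
proof -
  have "scal (inverse k) * (scal k * x) \<in> I" by (rule bi_ideal_alg[OF assms(1,2) scal_alg])
  moreover have "scal (inverse k) * (scal k * x) = x"
    using assms(3) by (simp add: mult_single flip: mult.assoc)
  ultimately show ?thesis by simp
qed

lemma bi_ideal_vx_path:
  assumes I: "bi_ideal I" and p: "awalk u p v"
  shows "vx u \<in> I \<Longrightarrow> vx v \<in> I" "vx v \<in> I \<Longrightarrow> pth u p \<in> I"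
proof -
  note in_alg = path_in_alg[OF p]
  have 1: "vx v \<in> I" if "pth u p \<in> I"
    using bi_ideal_eqv[OF I gpth_pth[OF p]] bi_ideal_alg(1)[OF I that in_alg(2)] by blast
  show "vx v \<in> I" if "vx u \<in> I"
    using 1 bi_ideal_eqv[OF I vx_pth(1)[OF p]] bi_ideal_alg(2)[OF I that in_alg(1)] by blast
  show "pth u p \<in> I" if "vx v \<in> I"
    using bi_ideal_eqv[OF I pth_vx(1)[OF p]] bi_ideal_alg(1)[OF I that in_alg(1)] by blast
qed

lemma bi_ideal_edge:
  assumes I: "bi_ideal I" and e: "e \<in> arcs E" "vx (head E e) \<in> I"
  shows "ed e \<in> I" "gh e \<in> I"
  using bi_ideal_eqv[OF I eqv_ed_head[OF e(1)]] bi_ideal_eqv[OF I eqv_head_gh[OF e(1)]]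
    bi_ideal_alg[OF I e(2)] gens_alg e by blast+

lemma bi_ideal_sum: "bi_ideal I \<Longrightarrow> (\<And>i. i \<in> S \<Longrightarrow> f i \<in> I) \<Longrightarrow> sum f S \<in> I"
  using additive_closed_sum bi_idealD(2) by blast

lemma bi_ideal_sum_list: "bi_ideal I \<Longrightarrow> (\<And>i. i \<in> set xs \<Longrightarrow> f i \<in> I) \<Longrightarrow> sum_list (map f xs) \<in> I"
  by (induction xs) (auto intro: additive_closedD[OF bi_idealD(2)])

lemma not_in_ideal_vertex:
  assumes I: "bi_ideal I" and x: "x \<in> A" "x \<notin> I"
  shows "\<exists>v\<in>verts E. vx v \<notin> I \<and> x * vx v \<notin> I"
proof (rule ccontr)
  assume "\<not> ?thesis"
  then have *: "x * vx v \<in> I" if "v \<in> verts E" for v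
    using that bi_idealD(5)[OF I x(1)] by blast
  obtain S where S: "S \<subseteq> verts E" "x * (\<Sum>u\<in>S. vx u) \<approx> x" using sum_vx_right[OF x(1)] by blast
  have "x * (\<Sum>u\<in>S. vx u) \<in> I"
    unfolding sum_distrib_left using S(1) * by (intro bi_ideal_sum[OF I]) auto
  then show False using bi_ideal_eqv[OF I S(2)] x by blast
qed

definition live :: "('v, 'e, 'k) free_lpa set \<Rightarrow> 'v set"
  where "live I = {v\<in>verts E. vx v \<notin> I}"

lemma mon_in_ideal:
  assumes "bi_ideal I" "awalk u p w" "awalk v q w" "vx w \<in> I"
  shows "mon (k, u, p, v, q) \<in> I"
  unfolding mon_def
  using bi_ideal_vx_path(2)[OF assms(1,2,4)] path_in_alg[OF assms(3)]
  by (auto intro!: bi_ideal_alg(1)[OF assms(1) _ scal_alg] bi_ideal_alg(2)[OF assms(1)])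

lemma mon_sum_not_in_ideal:
  assumes I: "bi_ideal I" and x: "x \<in> A" and a: "a \<in> alg" "b \<in> alg" and ne: "a * x * b \<notin> I"
  shows "\<exists>t. valid t \<and> a * mon t * b \<notin> I"
proof (rule ccontr)
  assume "\<not> ?thesis"
  then have *: "a * mon t * b \<in> I" if "valid t" for t using that by blast
  obtain ts where ts: "\<forall>t\<in>set ts. valid t" "x \<approx> sum_list (map mon ts)"
    using spanned_A[OF x] by (auto simp: spanned_def)
  have "a * sum_list (map mon ts) * b = sum_list (map (\<lambda>t. a * mon t * b) ts)"
    by (induction ts) (auto simp: distrib_left distrib_right)
  also have "\<dots> \<in> I" using ts(1) * by (intro bi_ideal_sum_list[OF I]) auto
  finally show False
    using ne bi_ideal_eqv[OF I eqv_right[OF a(2) eqv_left[OF a(1) ts(2)]]] by blast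
qed

text \<open>If all edges of a regular vertex ended in \<open>P\<close>, the sum relation would put
  the vertex into \<open>P\<close>. Directedness comes from primeness: \<open>u A v\<close> is not
  contained in \<open>P\<close>, so some monomial \<open>p q\<^sup>*\<close> survives between
  \<open>u\<close> and \<open>v\<close>. Then \<open>p\<close> starts at \<open>u\<close>,
  \<open>q\<close> starts at \<open>v\<close>, and their common end is live.\<close>

lemma maximal_tail_live:
  assumes P: "elementwise_prime P"
  shows "maximal_tail E (live P)"
proof -
  note I = elementwise_primeD(1)[OF P]
  have "u \<in> live P" if "v \<in> live P" "u \<in> verts E" "u \<rightarrow>\<^sup>*\<^bsub>E\<^esub> v" for u v
    using that bi_ideal_vx_path(1)[OF I] by (auto simp: live_def reachable_awalk)
  moreover have "\<exists>e\<in>arcs E. tail E e = v \<and> head E e \<in> live P"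
    if v: "v \<in> live P" and reg: "regular_vertex E v" for v
  proof (rule ccontr)
    assume "\<not> ?thesis"
    then have *: "ed e \<in> P" if "e \<in> out_arcs E v" for e
      using that bi_ideal_edge(1)[OF I] by (auto simp: live_def)
    have "(\<Sum>e\<in>out_arcs E v. ed e * gh e) \<in> P"
      by (intro bi_ideal_sum[OF I] bi_ideal_alg(2)[OF I *]) auto
    then show False using bi_ideal_eqv[OF I eqv_CK2[OF reg]] v by (auto simp: live_def)
  qed
  moreover have "\<exists>w\<in>live P. u \<rightarrow>\<^sup>*\<^bsub>E\<^esub> w \<and> v \<rightarrow>\<^sup>*\<^bsub>E\<^esub> w" if u: "u \<in> live P" and v: "v \<in> live P" for u v
  proof -
    obtain a where a: "a \<in> A" "vx u * a * vx v \<notin> P"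
      using elementwise_primeD(3)[OF P, of "vx u" "vx v"] u v by (auto simp: live_def)
    then obtain t where t: "valid t" "vx u * mon t * vx v \<notin> P"
      using mon_sum_not_in_ideal[OF I a(1), of "vx u" "vx v"] u v by (auto simp: live_def)
    obtain k u' p v' q w where teq: "t = (k, u', p, v', q)" and p: "awalk u' p w" and q: "awalk v' q w"
      using t(1) by (cases t) (auto simp: valid_def)
    have uv: "u \<in> verts E" "v \<in> verts E" using u v by (auto simp: live_def)
    have split: "vx u * mon t * vx v = scal k * ((vx u * pth u' p) * (gpth v' q * vx v))"
      using scal_commute[of k "vx u :: ('v, 'e, 'k) free_lpa"]
      by (simp add: mon_def teq mult.assoc[symmetric])
    have "\<not> vx u * pth u' p \<approx> 0" "\<not> gpth v' q * vx v \<approx> 0"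
    proof -
      show "\<not> vx u * pth u' p \<approx> 0"
      proof
        assume "vx u * pth u' p \<approx> 0"
        then have "vx u * pth u' p \<in> P" using bi_idealD(3)[OF I] by (auto simp: eqv_zero_iff)
        then have "vx u * mon t * vx v \<in> P" unfolding split
          by (rule bi_ideal_alg(1)[OF I bi_ideal_alg(2)[OF I] scal_alg])
            (use uv path_in_alg[OF q] in \<open>auto intro!: alg_mult\<close>)
        then show False using t by blast
      qed
      show "\<not> gpth v' q * vx v \<approx> 0"
      proof
        assume "gpth v' q * vx v \<approx> 0"
        then have "gpth v' q * vx v \<in> P" using bi_idealD(3)[OF I] by (auto simp: eqv_zero_iff)
        then have "vx u * mon t * vx v \<in> P" unfolding split
          by (rule bi_ideal_alg(1)[OF I bi_ideal_alg(1)[OF I] scal_alg])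
            (use uv path_in_alg[OF p] in \<open>auto intro!: alg_mult\<close>)
        then show False using t by blast
      qed
    qed
    then have "u' = u" "v' = v" using vx_pth_orth(1)[OF p uv(1)] vx_pth_orth(2)[OF q uv(2)] by auto
    moreover have "vx w \<notin> P"
    proof
      assume "vx w \<in> P"
      then have "mon t \<in> P" unfolding teq by (rule mon_in_ideal[OF I p q])
      then show False using t(2) uv bi_ideal_alg(2)[OF I bi_ideal_alg(1)[OF I]] gens_alg(1) by blast
    qed
    ultimately show ?thesis using p q by (intro bexI[of _ w]) (auto simp: live_def reachable_awalk)
  qed
  ultimately show ?thesis by (auto simp: maximal_tail_def live_def)
qed

section \<open>Combinations of real paths\<close>

text \<open>Conjugation by \<open>q\<close> sends \<open>t\<close> to the closed path
  \<open>t'\<close> with \<open>t q = q t'\<close>, or to zero if there is none. As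
  \<open>t'\<close> is as long as \<open>t\<close>, no term degenerates to a vertex, and the number
  of terms does not grow.\<close>

lemma closed_path_sum_conjugate:
  assumes q: "awalk v q v"
    and ts: "\<forall>(k, t)\<in>set ts. awalk v t v \<and> t \<noteq> []"
  shows "\<exists>ts'. length ts' \<le> length ts \<and> (\<forall>(k, t)\<in>set ts'. awalk v t v \<and> t \<noteq> []) \<and>
    gpth v q * (\<Sum>(k, t)\<leftarrow>ts. scal k * pth v t) * pth v q \<approx> (\<Sum>(k, t)\<leftarrow>ts'. scal k * pth v t)"
  using ts
proof (induction ts)
  case Nil
  then show ?case by (auto intro!: exI[of _ "[]"])
next
  case (Cons kt ts)
  obtain k t where kt: "kt = (k, t)" by (cases kt)
  have t: "awalk v t v" "t \<noteq> []" using Cons.prems kt by auto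
  obtain ts' where ts': "length ts' \<le> length ts" "\<forall>(k, t)\<in>set ts'. awalk v t v \<and> t \<noteq> []"
    "gpth v q * (\<Sum>(k, t)\<leftarrow>ts. scal k * pth v t) * pth v q \<approx> (\<Sum>(k, t)\<leftarrow>ts'. scal k * pth v t)"
    using Cons by auto
  have tq: "awalk v (t @ q) v" using t q by (auto simp: awalk_append_iff)
  have split: "gpth v q * (\<Sum>(k, t)\<leftarrow>kt # ts. scal k * pth v t) * pth v q =
    scal k * (gpth v q * (pth v t * pth v q)) + gpth v q * (\<Sum>(k, t)\<leftarrow>ts. scal k * pth v t) * pth v q"
    using scal_commute[of k "gpth v q"] by (simp add: kt distrib_left distrib_right mult.assoc[symmetric])
  have step: "scal k * (gpth v q * (pth v t * pth v q)) \<approx> scal k * (gpth v q * pth v (t @ q))"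
    by (intro eqv_left scal_alg path_in_alg[OF q] pth_append(1)[OF t(1) q])
  show ?case
  proof (cases "\<exists>t'. t @ q = q @ t'")
    case True
    then obtain t' where t': "t @ q = q @ t'" by blast
    have aw: "awalk v t' v" by (rule awalk_append_cancel[OF tq[unfolded t'] q])
    have "length t' = length t" using arg_cong[OF t', of length] by simp
    then have ne: "t' \<noteq> []" using t by auto
    have "scal k * (gpth v q * (pth v t * pth v q)) \<approx> scal k * pth v t'"
      using step eqv_left[OF scal_alg gpth_pth_append(1)[OF q aw], of k] t' eqv_trans by simp
    then show ?thesis using ts' aw ne
      by (intro exI[of _ "(k, t') # ts'"]) (auto simp only: split, auto intro!: eqv_add)
  next
    case False
    moreover have "\<nexists>t'. q = (t @ q) @ t'" using t by (auto dest: arg_cong[where f = length])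
    ultimately have "gpth v q * pth v (t @ q) \<approx> 0" using gpth_pth_orth[OF q tq] by blast
    from eqv_left[OF scal_alg this, of k] have "scal k * (gpth v q * (pth v t * pth v q)) \<approx> 0"
      using step eqv_trans by simp
    from eqv_add[OF this ts'(3)] show ?thesis using ts' unfolding split by (intro exI[of _ ts']) auto
  qed
qed

text \<open>
  Conjugating by a simple closed path that is not an initial segment of the closed path \<open>t\<close>
  kills \<open>t\<close> and maps every other closed path to a closed path of the same length or to zero.
\<close>

lemma vertex_in_ideal_of_closed_paths:
  assumes K: "condition_K E" and I: "bi_ideal I" and v: "v \<in> verts E" and k0: "k0 \<noteq> 0"
    and ts: "\<forall>(k, t)\<in>set ts. awalk v t v \<and> t \<noteq> []"
    and mem: "scal k0 * vx v + (\<Sum>(k, t)\<leftarrow>ts. scal k * pth v t) \<in> I"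
  shows "vx v \<in> I"
  using ts mem
proof (induction ts rule: length_induct)
  case (1 ts)
  show ?case
  proof (cases ts)
    case Nil
    then show ?thesis using 1 bi_ideal_scal[OF I _ k0] by simp
  next
    case (Cons kt ts1)
    obtain k t where kt: "kt = (k, t)" by (cases kt)
    have t: "awalk v t v" "t \<noteq> []" and ts1: "\<forall>(k, t)\<in>set ts1. awalk v t v \<and> t \<noteq> []"
      using 1 Cons kt by auto
    obtain s t' where s: "t = s @ t'" "simple_closed_path E v s" using simple_closed_path_prefix[OF t] by blast
    obtain q where q: "simple_closed_path E v q" "q \<noteq> s" using another_simple_closed_path[OF K s(2)] by blast
    have qw: "awalk v q v" using q by (auto simp: simple_closed_path_def)
    note in_alg = path_in_alg[OF qw]
    have tq: "awalk v (t @ q) v" using t qw by (auto simp: awalk_append_iff)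
    \<comment> \<open>\<open>t @ q\<close> begins with \<open>s\<close>, and by the prefix property
      a simple closed path that begins it equals \<open>s\<close>.\<close>
    have "\<nexists>r. t @ q = q @ r"
      using simple_closed_path_eq[OF s(2) q(1)] q(2) unfolding s(1) by auto
    moreover have "\<nexists>r. q = (t @ q) @ r" using t by (auto dest: arg_cong[where f = length])
    ultimately have "gpth v q * pth v (t @ q) \<approx> 0" using gpth_pth_orth[OF qw tq] by blast
    moreover have "scal k * (gpth v q * (pth v t * pth v q)) \<approx> scal k * (gpth v q * pth v (t @ q))"
      by (intro eqv_left scal_alg in_alg pth_append(1)[OF t(1) qw])
    ultimately have kill: "scal k * (gpth v q * (pth v t * pth v q)) \<approx> 0"
      using eqv_left[OF scal_alg, of "gpth v q * pth v (t @ q)" 0 k] eqv_trans by simp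
    obtain ts' where ts': "length ts' \<le> length ts1" "\<forall>(k, t)\<in>set ts'. awalk v t v \<and> t \<noteq> []"
      "gpth v q * (\<Sum>(k, t)\<leftarrow>ts1. scal k * pth v t) * pth v q \<approx> (\<Sum>(k, t)\<leftarrow>ts'. scal k * pth v t)"
      using closed_path_sum_conjugate[OF qw ts1] by blast
    let ?X = "scal k0 * vx v + (\<Sum>(k, t)\<leftarrow>ts. scal k * pth v t)"
    have "gpth v q * vx v * pth v q \<approx> vx v"
      using eqv_trans[OF eqv_right[OF in_alg(1) vx_pth(2)[OF qw]] gpth_pth[OF qw]] .
    then have main: "scal k0 * (gpth v q * vx v * pth v q) \<approx> scal k0 * vx v"
      by (intro eqv_left scal_alg)
    \<comment> \<open>The conjugation fixes the vertex term, so its coefficient stays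
      \<open>k0\<close>, while the term of \<open>t\<close> disappears. This is the decrease in the
      induction.\<close>
    have "gpth v q * ?X * pth v q = scal k0 * (gpth v q * vx v * pth v q) +
      (scal k * (gpth v q * (pth v t * pth v q)) +
        gpth v q * (\<Sum>(k, t)\<leftarrow>ts1. scal k * pth v t) * pth v q)"
      using scal_commute[of k "gpth v q"] scal_commute[of k0 "gpth v q"]
      by (simp add: Cons kt distrib_left distrib_right mult.assoc[symmetric])
    also have "\<dots> \<approx> scal k0 * vx v + (0 + (\<Sum>(k, t)\<leftarrow>ts'. scal k * pth v t))"
      by (intro eqv_add main kill ts'(3))
    finally have "gpth v q * ?X * pth v q \<approx> scal k0 * vx v + (\<Sum>(k, t)\<leftarrow>ts'. scal k * pth v t)" by simp
    moreover have "gpth v q * ?X * pth v q \<in> I"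
      using 1 in_alg by (intro bi_ideal_alg[OF I]) auto
    ultimately have "scal k0 * vx v + (\<Sum>(k, t)\<leftarrow>ts'. scal k * pth v t) \<in> I"
      using bi_ideal_eqv[OF I] by blast
    moreover have "length ts' < length ts" using ts'(1) Cons by simp
    ultimately show ?thesis using 1(1) ts'(2) by blast
  qed
qed

definition path_word :: "'v \<Rightarrow> 'e list \<Rightarrow> ('v, 'e) generator word"
  where "path_word u p = Word (Vertex u # map Edge p)"

lemma path_word_eq_iff [simp]: "path_word u p = path_word u' p' \<longleftrightarrow> u = u' \<and> p = p'"
proof -
  have "inj (Edge :: 'e \<Rightarrow> ('v, 'e) generator)" by (auto intro: injI)
  then show ?thesis by (auto simp: path_word_def inj_map_eq_map)
qed

lemma single_path_word: "Poly_Mapping.single (path_word u p) k = scal k * pth u p"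
  by (simp add: pth_def path_word_def mult_single)

text \<open>These are elements of the free algebra, not classes modulo \<open>N\<close>, so being
  nonzero is a matter of coefficients. The paths share their end \<open>v\<close> but may start
  anywhere.\<close>

definition path_poly :: "'v \<Rightarrow> ('v, 'e, 'k) free_lpa set"
  where "path_poly v = {y. \<forall>w\<in>Poly_Mapping.keys y. \<exists>u p. w = path_word u p \<and> awalk u p v}"

lemma path_poly_zero: "0 \<in> path_poly v"
  by (simp add: path_poly_def)

lemma path_poly_add: "x \<in> path_poly v \<Longrightarrow> y \<in> path_poly v \<Longrightarrow> x + y \<in> path_poly v"
  unfolding path_poly_def using Poly_Mapping.keys_add[of x y] by blast

lemma path_poly_pth: "awalk u p v \<Longrightarrow> scal k * pth u p \<in> path_poly v"
  by (auto simp: path_poly_def pth_def path_word_def mult_single)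

lemma path_poly_eqv_vx:
  assumes "y \<in> path_poly v" "v \<in> verts E"
  shows "y * vx v \<approx> y"
proof -
  have "y * vx v = (\<Sum>w\<in>Poly_Mapping.keys y. Poly_Mapping.single w (Poly_Mapping.lookup y w) * vx v)"
    by (subst poly_mapping_sum_single[of y]) (simp add: sum_distrib_right)
  also have "\<dots> \<approx> (\<Sum>w\<in>Poly_Mapping.keys y. Poly_Mapping.single w (Poly_Mapping.lookup y w))"
  proof (rule eqv_sum)
    fix w assume "w \<in> Poly_Mapping.keys y"
    then obtain u p where w: "w = path_word u p" "awalk u p v" using assms by (auto simp: path_poly_def)
    have "scal c * (pth u p * vx v) \<approx> scal c * pth u p" for c
      by (intro eqv_left scal_alg pth_vx[OF w(2)])
    then show "Poly_Mapping.single w (Poly_Mapping.lookup y w) * vx v \<approx>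
        Poly_Mapping.single w (Poly_Mapping.lookup y w)"
      by (simp add: w(1) single_path_word mult.assoc)
  qed
  also have "\<dots> = y" by (rule poly_mapping_sum_single[symmetric])
  finally show ?thesis .
qed

text \<open>Multiply by the ghost of a shortest path \<open>p\<close> of \<open>y\<close>. The term
  of \<open>p\<close> becomes a nonzero multiple of \<open>v\<close>; any other path survives only
  if it extends \<open>p\<close>, and then it becomes a nontrivial closed path at
  \<open>v\<close>.\<close>

lemma vertex_in_ideal_of_path_poly:
  assumes K: "condition_K E" and I: "bi_ideal I"
    and y: "y \<in> path_poly v" "y \<noteq> 0" "y \<in> I"
  shows "vx v \<in> I"
proof -
  let ?K = "Poly_Mapping.keys y" and ?c = "Poly_Mapping.lookup y"
  have "?K \<noteq> {}" using y(2) by (metis keys_zero poly_mapping_eqI lookup_zero in_keys_iff empty_iff)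
  \<comment> \<open>Minimal length excludes that another path of \<open>y\<close> is a proper
    initial segment of \<open>p\<close>, which would leave a ghost path behind.\<close>
  then obtain w0 where w0: "w0 \<in> ?K" "\<And>w. w \<in> ?K \<Longrightarrow> length (letters w0) \<le> length (letters w)"
    using ex_has_least_nat[of "\<lambda>w. w \<in> ?K" _ "\<lambda>w. length (letters w)"] by blast
  obtain u p where up: "w0 = path_word u p" "awalk u p v" using y(1) w0(1) by (auto simp: path_poly_def)
  note in_alg = path_in_alg[OF up(2)]
  have "\<exists>ts. (\<forall>(k, t)\<in>set ts. awalk v t v \<and> t \<noteq> []) \<and>
      gpth u p * (\<Sum>w\<in>S. Poly_Mapping.single w (?c w)) \<approx> (\<Sum>(k, t)\<leftarrow>ts. scal k * pth v t)"
    if "S \<subseteq> ?K - {w0}" for S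
    using finite_subset[OF that finite_Diff[OF finite_keys]] that
  proof (induction S rule: finite_induct)
    case empty
    show ?case by (intro exI[of _ "[]"]) auto
  next
    case (insert w S)
    then obtain ts where ts: "\<forall>(k, t)\<in>set ts. awalk v t v \<and> t \<noteq> []"
      "gpth u p * (\<Sum>w\<in>S. Poly_Mapping.single w (?c w)) \<approx> (\<Sum>(k, t)\<leftarrow>ts. scal k * pth v t)" by auto
    have w: "w \<in> ?K" "w \<noteq> w0" using insert.prems by auto
    then obtain u' p' where up': "w = path_word u' p'" "awalk u' p' v" using y(1) by (auto simp: path_poly_def)
    have len: "length p \<le> length p'" using w0(2)[OF w(1)] by (simp add: up up' path_word_def)
    have single: "Poly_Mapping.single w (?c w) = scal (?c w) * pth u' p'"
      by (simp add: up'(1) single_path_word)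
    have split: "gpth u p * (\<Sum>w\<in>insert w S. Poly_Mapping.single w (?c w)) =
      scal (?c w) * (gpth u p * pth u' p') + gpth u p * (\<Sum>w\<in>S. Poly_Mapping.single w (?c w))"
      using insert.hyps scal_commute[of "?c w" "gpth u p"]
      by (simp add: distrib_left single mult.assoc[symmetric])
    show ?case
    proof (cases "u = u' \<and> (\<exists>t. p' = p @ t)")
      case True
      then obtain t where t: "p' = p @ t" by blast
      have aw: "awalk v t v" using awalk_append_cancel[OF _ up(2)] up'(2) True t by blast
      have ne: "t \<noteq> []" using t w(2) up up' True by auto
      have "scal (?c w) * (gpth u p * pth u' p') \<approx> scal (?c w) * pth v t"
        using gpth_pth_append(1)[OF up(2) aw] True t by (intro eqv_left scal_alg) simp
      from eqv_add[OF this ts(2)] show ?thesis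
        unfolding split using ts(1) aw ne by (intro exI[of _ "(?c w, t) # ts"]) simp
    next
      case False
      have "gpth u p * pth u' p' \<approx> 0"
      proof (cases "u = u'")
        case True
        have "\<nexists>t. p = p' @ t"
        proof
          assume "\<exists>t. p = p' @ t"
          then obtain t where "p = p' @ t" by blast
          with len have "p' = p" by simp
          then show False using up(1) up'(1) w(2) True by simp
        qed
        then show ?thesis using gpth_pth_orth[OF up(2)] up'(2) True False by auto
      next
        case neq: False
        then show ?thesis using gpth_pth_source_orth[OF up(2) up'(2)] by blast
      qed
      from eqv_left[OF scal_alg this] have "scal (?c w) * (gpth u p * pth u' p') \<approx> 0" by simp
      from eqv_add[OF this ts(2)] show ?thesis
        unfolding split using ts(1) by (intro exI[of _ ts]) simp
    qed
  qed
  from this[OF order_refl] obtain ts where ts: "\<forall>(k, t)\<in>set ts. awalk v t v \<and> t \<noteq> []"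
    "gpth u p * (\<Sum>w\<in>?K - {w0}. Poly_Mapping.single w (?c w)) \<approx> (\<Sum>(k, t)\<leftarrow>ts. scal k * pth v t)"
    by blast
  have "gpth u p * y = gpth u p * Poly_Mapping.single w0 (?c w0) +
    gpth u p * (\<Sum>w\<in>?K - {w0}. Poly_Mapping.single w (?c w))"
    by (subst poly_mapping_sum_single[of y], subst sum.remove[OF finite_keys w0(1)])
      (simp add: distrib_left)
  also have "gpth u p * Poly_Mapping.single w0 (?c w0) = scal (?c w0) * (gpth u p * pth u p)"
    using scal_commute[of "?c w0" "gpth u p"]
    by (simp add: up(1) single_path_word mult.assoc[symmetric])
  also have "scal (?c w0) * (gpth u p * pth u p) + gpth u p * (\<Sum>w\<in>?K - {w0}. Poly_Mapping.single w (?c w)) \<approx>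
      scal (?c w0) * vx v + (\<Sum>(k, t)\<leftarrow>ts. scal k * pth v t)"
    by (intro eqv_add eqv_left scal_alg gpth_pth[OF up(2)] ts(2))
  finally have "gpth u p * y \<approx> scal (?c w0) * vx v + (\<Sum>(k, t)\<leftarrow>ts. scal k * pth v t)" .
  moreover have "gpth u p * y \<in> I" by (rule bi_ideal_alg(1)[OF I y(3) in_alg(2)])
  ultimately have "scal (?c w0) * vx v + (\<Sum>(k, t)\<leftarrow>ts. scal k * pth v t) \<in> I"
    using bi_ideal_eqv[OF I] by blast
  moreover have "?c w0 \<noteq> 0" using w0(1) by (simp add: in_keys_iff)
  ultimately show ?thesis
    using vertex_in_ideal_of_closed_paths[OF K I _ _ ts(1)] up(2) by blast
qed

text \<open>Appending \<open>e\<close> is injective on words, so nothing cancels in the free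
  algebra.\<close>

lemma path_poly_times_edge:
  assumes y: "y \<in> path_poly v" and e: "e \<in> out_arcs E v"
  shows "y * ed e \<in> path_poly (head E e)" and "y \<noteq> 0 \<Longrightarrow> y * ed e \<noteq> 0"
proof -
  let ?K = "Poly_Mapping.keys y" and ?c = "Poly_Mapping.lookup y"
  let ?ext = "\<lambda>w :: ('v, 'e) generator word. w + Word [Edge e]"
  have inj: "?ext w = ?ext w' \<longleftrightarrow> w = w'" for w w'
    by (cases w; cases w') (simp add: plus_word_def)
  have eq: "y * ed e = (\<Sum>w\<in>?K. Poly_Mapping.single (?ext w) (?c w))"
    by (subst poly_mapping_sum_single[of y]) (simp add: sum_distrib_right mult_single)
  have "?ext (path_word u p) = path_word u (p @ [e])" for u p
    by (simp add: path_word_def plus_word_def)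
  moreover have "awalk u (p @ [e]) (head E e)" if "awalk u p v" for u p
    using that e arc_implies_awalk[of e] by (auto simp: awalk_append_iff)
  ultimately have ext_poly: "Poly_Mapping.single (?ext w) (?c w) \<in> path_poly (head E e)" if "w \<in> ?K" for w
    using y that by (force simp: path_poly_def)
  have "(\<Sum>w\<in>S. Poly_Mapping.single (?ext w) (?c w)) \<in> path_poly (head E e)" if "S \<subseteq> ?K" for S
    using finite_subset[OF that finite_keys] that
    by (induction S rule: finite_induct) (auto intro!: path_poly_zero path_poly_add ext_poly)
  then show "y * ed e \<in> path_poly (head E e)" unfolding eq by blast
  assume "y \<noteq> 0"
  then obtain w0 where w0: "w0 \<in> ?K" by (metis lookup_zero in_keys_iff poly_mapping_eqI)
  have "Poly_Mapping.lookup (y * ed e) (?ext w0) = (\<Sum>w\<in>?K. if w = w0 then ?c w else 0)"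
    unfolding eq lookup_sum lookup_single by (intro sum.cong) (auto simp: when_def inj)
  also have "\<dots> = ?c w0" using w0 by simp
  finally show "y * ed e \<noteq> 0" using w0 by (auto simp: in_keys_iff)
qed

section \<open>Primitivity of prime ideals\<close>

lemma scal_scal: "scal a * (scal b * x) = scal (a * b) * x"
  by (simp add: mult_single flip: mult.assoc)

section \<open>Vertices with finitely many live edges\<close>

definition live_out :: "('v, 'e, 'k) free_lpa set \<Rightarrow> 'v \<Rightarrow> 'e set"
  where "live_out I u = {e\<in>out_arcs E u. vx (head E e) \<notin> I}"

text \<open>At a breaking vertex of the hereditary set of vertices in \<open>I\<close> this is the
  familiar element attached to it. At a sink it is the vertex itself, and at a regular vertex it
  lies in an ideal \<open>I\<close> by the sum relation. For infinite \<open>live_out I u\<close>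
  the sum defaults to \<open>0\<close>, so finiteness is assumed wherever the gap has to cancel
  edges.\<close>

definition gap :: "('v, 'e, 'k) free_lpa set \<Rightarrow> 'v \<Rightarrow> ('v, 'e, 'k) free_lpa"
  where "gap I u = vx u - (\<Sum>e\<in>live_out I u. ed e * gh e)"

lemma gap_A:
  assumes "u \<in> verts E"
  shows "gap I u \<in> A"
proof -
  have "(\<Sum>e\<in>live_out I u. ed e * gh e) \<in> A"
    by (rule additive_closed_sum[OF additive_closed_A]) (auto simp: live_out_def intro!: A_mult)
  then show ?thesis unfolding gap_def using assms A_diff by simp
qed

text \<open>A live edge of \<open>u\<close> is cancelled by its own summand because
  \<open>e e\<^sup>* e = e\<close>; an edge of \<open>u\<close> that is not live is in
  \<open>I\<close> along with its head; an edge with another tail is orthogonal to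
  \<open>u\<close>.\<close>

lemma gap_edge:
  assumes I: "bi_ideal I" and fin: "finite (live_out I u)" and u: "u \<in> verts E" and e: "e \<in> arcs E"
  shows "gap I u * ed e \<in> I" "gh e * gap I u \<in> I"
proof -
  have arcs: "f \<in> arcs E" if "f \<in> live_out I u" for f using that by (auto simp: live_out_def)
  have l: "(ed f * gh f) * ed e \<approx> (if f = e then ed e else 0)" if "f \<in> live_out I u" for f
  proof (cases "f = e")
    case True
    have "ed e * (gh e * ed e) \<approx> ed e * vx (head E e)" using e by (intro eqv_left eqv_gh_ed) auto
    also have "\<dots> \<approx> ed e" by (rule eqv_ed_head[OF e])
    finally show ?thesis using True by (simp add: mult.assoc)
  next
    case False
    have "ed f * (gh f * ed e) \<approx> ed f * 0" using False e arcs[OF that] by (intro eqv_left eqv_gh_ed_orth) auto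
    then show ?thesis using False by (simp add: mult.assoc)
  qed
  have r: "gh e * (ed f * gh f) \<approx> (if f = e then gh e else 0)" if "f \<in> live_out I u" for f
  proof (cases "f = e")
    case True
    have "(gh e * ed e) * gh e \<approx> vx (head E e) * gh e" using e by (intro eqv_right eqv_gh_ed) auto
    also have "\<dots> \<approx> gh e" by (rule eqv_head_gh[OF e])
    finally show ?thesis using True by (simp add: mult.assoc)
  next
    case False
    have "(gh e * ed f) * gh f \<approx> 0 * gh f" using False e arcs[OF that] by (intro eqv_right eqv_gh_ed_orth) auto
    then show ?thesis using False by (simp add: mult.assoc)
  qed
  have sums: "(\<Sum>f\<in>live_out I u. ed f * gh f) * ed e \<approx> (if e \<in> live_out I u then ed e else 0)"
    "gh e * (\<Sum>f\<in>live_out I u. ed f * gh f) \<approx> (if e \<in> live_out I u then gh e else 0)"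
  proof -
    have "(\<Sum>f\<in>live_out I u. (ed f * gh f) * ed e) \<approx> (\<Sum>f\<in>live_out I u. if f = e then ed e else 0)"
      by (rule eqv_sum) (rule l)
    then show "(\<Sum>f\<in>live_out I u. ed f * gh f) * ed e \<approx> (if e \<in> live_out I u then ed e else 0)"
      using fin by (simp add: sum_distrib_right)
    have "(\<Sum>f\<in>live_out I u. gh e * (ed f * gh f)) \<approx> (\<Sum>f\<in>live_out I u. if f = e then gh e else 0)"
      by (rule eqv_sum) (rule r)
    then show "gh e * (\<Sum>f\<in>live_out I u. ed f * gh f) \<approx> (if e \<in> live_out I u then gh e else 0)"
      using fin by (simp add: sum_distrib_left)
  qed
  have "gap I u * ed e \<in> I \<and> gh e * gap I u \<in> I"
  proof (cases "tail E e = u")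
    case True
    have v: "vx u * ed e \<approx> ed e" "gh e * vx u \<approx> gh e" using eqv_tail_ed[OF e] eqv_gh_tail[OF e] True by auto
    show ?thesis
    proof (cases "e \<in> live_out I u")
      case True
      then have "gap I u * ed e \<approx> ed e - ed e" "gh e * gap I u \<approx> gh e - gh e"
        using eqv_diff[OF v(1) sums(1)] eqv_diff[OF v(2) sums(2)]
        by (simp_all add: gap_def left_diff_distrib right_diff_distrib)
      then show ?thesis using bi_idealD(3)[OF I] by (auto simp: eqv_zero_iff)
    next
      case False
      then have "vx (head E e) \<in> I" using True e by (auto simp: live_out_def)
      then have "ed e \<in> I" "gh e \<in> I" using bi_ideal_edge[OF I e] by auto
      moreover have "gap I u * ed e \<approx> ed e - 0" "gh e * gap I u \<approx> gh e - 0"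
        using False eqv_diff[OF v(1) sums(1)] eqv_diff[OF v(2) sums(2)]
        by (simp_all add: gap_def left_diff_distrib right_diff_distrib)
      ultimately show ?thesis using bi_ideal_eqv[OF I] by auto
    qed
  next
    case False
    then have ne: "e \<notin> live_out I u" by (auto simp: live_out_def)
    have "vx u * ed e \<approx> 0" using eqv_lv_orth[of "Edge e" u] e u False by simp
    moreover have "gh e * vx u \<approx> 0" using eqv_rv_orth[of "Ghost e" u] e u False by simp
    ultimately have "gap I u * ed e \<approx> 0 - 0" "gh e * gap I u \<approx> 0 - 0"
      using ne eqv_diff[OF _ sums(1), of "vx u * ed e" 0] eqv_diff[OF _ sums(2), of "gh e * vx u" 0]
      by (simp_all add: gap_def left_diff_distrib right_diff_distrib)
    then show ?thesis using bi_idealD(3)[OF I] by (auto simp: eqv_zero_iff)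
  qed
  then show "gap I u * ed e \<in> I" "gh e * gap I u \<in> I" by auto
qed

lemma gap_vx:
  assumes u: "u \<in> verts E"
  shows "gap I u * vx u \<approx> gap I u"
proof -
  have "(\<Sum>e\<in>live_out I u. ed e * gh e) * vx u \<approx> (\<Sum>e\<in>live_out I u. ed e * gh e)"
    unfolding sum_distrib_right
  proof (rule eqv_sum)
    fix e assume "e \<in> live_out I u"
    then have e: "e \<in> arcs E" "tail E e = u" by (auto simp: live_out_def)
    have "ed e * (gh e * vx u) \<approx> ed e * gh e" using e eqv_gh_tail[OF e(1)] by (intro eqv_left) auto
    then show "ed e * gh e * vx u \<approx> ed e * gh e" by (simp add: mult.assoc)
  qed
  from eqv_diff[OF eqv_vx_idem[OF u] this] show ?thesis
    by (simp add: gap_def left_diff_distrib)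
qed

text \<open>
  If some \<^term>\<open>gap P u\<close> survives in the quotient by \<open>P\<close>, it behaves like a sink there: it spans
  its own corner.
\<close>

lemma gap_corner:
  assumes I: "bi_ideal I" and fin: "finite (live_out I u)" and u: "u \<in> verts E" and x: "x \<in> A"
  shows "\<exists>k. gap I u * x * gap I u - scal k * gap I u \<in> I"
    and "gap I u * gap I u - gap I u \<in> I"
proof -
  let ?g = "gap I u"
  have gA: "?g \<in> A" by (rule gap_A[OF u])
  then have galg: "?g \<in> alg" by (rule A_in_alg)
  note add = additive_closedD[OF bi_idealD(2)[OF I]]
  note edge = gap_edge[OF I fin u]
  have "?g * (\<Sum>e\<in>live_out I u. ed e * gh e) \<in> I"
    unfolding sum_distrib_left mult.assoc[symmetric]
    by (intro bi_ideal_sum[OF I] bi_ideal_alg(2)[OF I] edge(1)) (auto simp: live_out_def)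
  moreover have "?g * vx u - ?g \<in> I" using gap_vx[OF u] bi_idealD(3)[OF I] by (auto simp: eqv_def)
  ultimately have "(?g * vx u - ?g) - ?g * (\<Sum>e\<in>live_out I u. ed e * gh e) \<in> I" by (rule add(2)[rotated])
  moreover have eq: "y * ?g = y * vx u - y * (\<Sum>e\<in>live_out I u. ed e * gh e)" for y
    by (simp add: gap_def right_diff_distrib)
  ultimately show gg: "?g * ?g - ?g \<in> I" unfolding eq[of ?g] by (simp add: algebra_simps)
  have path: "?g * pth v (e # p) \<in> I" "gpth v (e # p) * ?g \<in> I" if "awalk v (e # p) w" for v e p w
  proof -
    note e = awalk_ConsD[OF that]
    note in_alg = path_in_alg[OF e(3)]
    show "?g * pth v (e # p) \<in> I"
      using bi_ideal_eqv[OF I eqv_left[OF galg pth_Cons(1)[OF that]]]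
        bi_ideal_alg(2)[OF I edge(1)[OF e(1)] in_alg(1)] by (simp add: mult.assoc)
    show "gpth v (e # p) * ?g \<in> I"
      using bi_ideal_eqv[OF I eqv_right[OF galg pth_Cons(2)[OF that]]]
        bi_ideal_alg(1)[OF I edge(2)[OF e(1)] in_alg(2)] by (simp add: mult.assoc)
  qed
  have vert: "?g * vx v * ?g - scal (if u = v then 1 else 0) * ?g \<in> I" if v: "v \<in> verts E" for v
  proof (cases "u = v")
    case True
    have "?g * vx v * ?g \<approx> ?g * ?g" using gap_vx[OF u] galg True by (intro eqv_right) auto
    then have "?g * vx v * ?g - ?g * ?g \<in> I" using bi_idealD(3)[OF I] by (auto simp: eqv_def)
    from add(4)[OF this gg] True show ?thesis by (simp add: single_one)
  next
    case False
    have "?g * vx v \<approx> ?g * vx u * vx v" using eqv_right[OF _ eqv_sym[OF gap_vx[OF u]]] v by simp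
    also have "\<dots> = ?g * (vx u * vx v)" by (simp add: mult.assoc)
    also have "\<dots> \<approx> ?g * 0" using False u v galg by (intro eqv_left eqv_vx_orth)
    finally have "?g * vx v * ?g \<approx> 0" using eqv_right[OF galg] by fastforce
    then show ?thesis using False bi_idealD(3)[OF I] by (auto simp: eqv_def)
  qed
  \<comment> \<open>Between two gaps only monomials with two empty paths can survive modulo
    \<open>I\<close>, and these are multiples of vertices.\<close>
  have mon: "\<exists>k. ?g * mon t * ?g - scal k * ?g \<in> I" if t: "valid t" for t
  proof -
    obtain k v p v' q w where teq: "t = (k, v, p, v', q)" and p: "awalk v p w" and q: "awalk v' q w"
      using t by (cases t) (auto simp: valid_def)
    have split: "?g * mon t * ?g = scal k * ((?g * pth v p) * (gpth v' q * ?g))"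
      using scal_commute[of k ?g] by (simp add: mon_def teq mult.assoc[symmetric])
    show ?thesis
    proof (cases "p = [] \<and> q = []")
      case True
      then have vv: "v = w" "v' = w" "w \<in> verts E" using p q by (auto simp: awalk_Nil_iff)
      have "?g * (vx w * vx w) * ?g \<approx> ?g * vx w * ?g"
        using vv galg by (intro eqv_right eqv_left eqv_vx_idem)
      then have "?g * (vx w * vx w) * ?g - ?g * vx w * ?g \<in> I"
        using bi_idealD(3)[OF I] by (auto simp: eqv_def)
      from add(4)[OF this vert[OF vv(3)]]
      have "?g * (vx w * vx w) * ?g - scal (if u = w then 1 else 0) * ?g \<in> I" by simp
      from bi_ideal_alg(1)[OF I this scal_alg[of k]]
      have "?g * mon t * ?g - scal (k * (if u = w then 1 else 0)) * ?g \<in> I"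
        unfolding split using True vv
        by (simp add: pth_Nil gpth_Nil right_diff_distrib mult.assoc scal_scal)
      then show ?thesis by blast
    next
      case False
      have "?g * mon t * ?g \<in> I"
      proof (cases p)
        case Nil
        then obtain f q' where "q = f # q'" using False by (cases q) auto
        then have "gpth v' q * ?g \<in> I" using path(2) q by blast
        then show ?thesis unfolding split
          using bi_ideal_alg(1)[OF I bi_ideal_alg(1)[OF I _ alg_mult[OF galg path_in_alg(1)[OF p]]] scal_alg]
          by blast
      next
        case (Cons f p')
        then have "?g * pth v p \<in> I" using path(1) p by blast
        then show ?thesis unfolding split
          using bi_ideal_alg(1)[OF I bi_ideal_alg(2)[OF I _ alg_mult[OF path_in_alg(2)[OF q] galg]] scal_alg]
          by blast
      qed
      then show ?thesis by (intro exI[of _ 0]) simp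
    qed
  qed
  obtain ts where ts: "\<forall>t\<in>set ts. valid t" "x \<approx> sum_list (map mon ts)"
    using spanned_A[OF x] by (auto simp: spanned_def)
  have "\<exists>k. ?g * sum_list (map mon ts) * ?g - scal k * ?g \<in> I"
    using ts(1)
  proof (induction ts)
    case Nil
    then show ?case using add(1) by (intro exI[of _ 0]) simp
  next
    case (Cons t ts)
    then obtain k where k: "?g * sum_list (map mon ts) * ?g - scal k * ?g \<in> I" by auto
    have "valid t" using Cons.prems by simp
    from mon[OF this] obtain k' where "?g * mon t * ?g - scal k' * ?g \<in> I" by blast
    note k this
    from add(4)[OF this] show ?case
      by (intro exI[of _ "k + k'"]) (simp add: single_add algebra_simps)
  qed
  then obtain k where k: "?g * sum_list (map mon ts) * ?g - scal k * ?g \<in> I" by blast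
  have "?g * x * ?g - ?g * sum_list (map mon ts) * ?g \<in> I"
    using eqv_right[OF galg eqv_left[OF galg ts(2)]] bi_idealD(3)[OF I] by (auto simp: eqv_def)
  from add(4)[OF this k] show "\<exists>k. ?g * x * ?g - scal k * ?g \<in> I" by auto
qed

text \<open>\<open>J\<close> is the left annihilator of the gap modulo \<open>P\<close>, so
  \<open>A\<close> modulo \<open>J\<close> is the left ideal that the gap generates in the quotient.
  Every ideal above \<open>P\<close> contains the gap itself: primeness, applied twice, yields a
  product \<open>g a y b g\<close> outside \<open>P\<close>, and this is a nonzero multiple of
  \<open>g\<close> because the corner is spanned by \<open>g\<close>.\<close>

lemma primitive_of_gap:
  assumes P: "elementwise_prime P" and fin: "finite (live_out P u)" and u: "u \<in> verts E"
    and g: "gap P u \<notin> P"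
  shows "\<exists>T w. modular_maximal T w \<and> P = core T"
proof -
  note I = elementwise_primeD(1)[OF P]
  note add = additive_closedD[OF bi_idealD(2)[OF I]]
  let ?g = "gap P u"
  have gA: "?g \<in> A" by (rule gap_A[OF u])
  note corner = gap_corner[OF I fin u]
  define J where "J = {x\<in>A. x * ?g \<in> P}"
  have PJ: "P \<subseteq> J" using bi_idealD(4,6)[OF I] gA by (auto simp: J_def)
  have "left_ideal J"
    unfolding left_ideal_def
  proof (intro conjI ballI)
    show "additive_closed J"
      using A_add add by (auto simp: additive_closed_def J_def left_diff_distrib)
    show "N \<subseteq> J" using bi_idealD(3)[OF I] PJ by blast
    show "a * x \<in> J" if "a \<in> A" "x \<in> J" for a x
      using that A_mult bi_idealD(5)[OF I] by (auto simp: J_def mult.assoc)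
  qed (auto simp: J_def)
  moreover have "?g \<notin> J"
    using additive_closed_cong[OF bi_idealD(2)[OF I] corner(2)[OF gA]] g by (simp add: J_def)
  moreover have "x - x * ?g \<in> J" if x: "x \<in> A" for x
  proof -
    have "- (x * (?g * ?g - ?g)) \<in> P" by (intro add(3) bi_idealD(5)[OF I] x corner(2)[OF gA])
    then show ?thesis using x gA A_closed by (simp add: J_def algebra_simps)
  qed
  moreover have "\<exists>i\<in>I'. ?g - i \<in> J" if I': "bi_ideal I'" "P \<subset> I'" for I'
  proof -
    obtain y where y: "y \<in> I'" "y \<notin> P" using I'(2) by blast
    have yA: "y \<in> A" using bi_idealD(4)[OF I'(1)] y by blast
    obtain a where a: "a \<in> A" "?g * a * y \<notin> P" using elementwise_primeD(3)[OF P gA yA g y(2)] by blast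
    obtain b where b: "b \<in> A" "?g * a * y * b * ?g \<notin> P"
      using elementwise_primeD(3)[OF P _ gA a(2) g] A_mult gA a yA by blast
    have aybA: "a * y * b \<in> A" using a b yA A_mult by blast
    obtain k where k: "?g * (a * y * b) * ?g - scal k * ?g \<in> P" using corner(1)[OF aybA] by blast
    have k0: "k \<noteq> 0"
      using k b by (auto simp: mult.assoc)
    have "?g * (a * y * b) * ?g \<in> I'"
      using bi_idealD(5,6)[OF I'(1)] y a b gA by blast
    moreover have "?g * (a * y * b) * ?g - scal k * ?g \<in> I'" using k I'(2) by blast
    ultimately have "scal k * ?g \<in> I'" using additive_closed_cong[OF bi_idealD(2)[OF I'(1)]] by blast
    then have "?g \<in> I'" using bi_ideal_scal[OF I'(1) _ k0] by blast
    then show ?thesis using additive_closed_zero[of J] \<open>left_ideal J\<close>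
      by (intro bexI[of _ ?g]) (auto simp: left_ideal_def)
  qed
  ultimately show ?thesis using primitive_criterion[OF I, of J ?g] PJ gA by blast
qed

section \<open>Removing ghost edges\<close>

lemma mon_times_edge:
  assumes p: "awalk u p w" and q: "awalk v q w" and e: "e \<in> out_arcs E v"
  shows "q = [] \<Longrightarrow> mon (k, u, p, v, q) * ed e \<approx> mon (k, u, p @ [e], head E e, [])"
    and "q = e # q' \<Longrightarrow> mon (k, u, p, v, q) * ed e \<approx> mon (k, u, p, head E e, q')"
    and "q = f # q' \<Longrightarrow> f \<noteq> e \<Longrightarrow> mon (k, u, p, v, q) * ed e \<approx> 0"
proof -
  have eA: "e \<in> arcs E" "tail E e = v" using e by auto
  note in_alg = path_in_alg[OF p]
  have split: "mon (k, u, p, v, q) * ed e = scal k * (pth u p * (gpth v q * ed e))"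
    by (simp add: mon_def mult.assoc)
  {
    assume Nil: "q = []"
    then have vw: "v = w" using q by (simp add: awalk_Nil_iff)
    have ew: "awalk w [e] (head E e)" using eA vw arc_implies_awalk by blast
    have pe: "awalk u (p @ [e]) (head E e)" using p ew by (auto simp: awalk_append_iff)
    have "vx w * ed e \<approx> pth w [e]" by (simp add: pth_eds eds_def)
    then have "pth u p * (gpth v q * ed e) \<approx> pth u p * pth w [e]"
      unfolding Nil gpth_Nil vw by (intro eqv_left in_alg)
    also have "\<dots> \<approx> pth u (p @ [e])" by (rule pth_append(1)[OF p ew])
    also have "\<dots> \<approx> pth u (p @ [e]) * gpth (head E e) []"
      using eqv_sym[OF pth_vx(1)[OF pe]] by (simp add: gpth_Nil)
    finally show "mon (k, u, p, v, q) * ed e \<approx> mon (k, u, p @ [e], head E e, [])"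
      unfolding split by (simp add: mon_def eqv_left)
  }
  {
    assume "q = e # q'"
    then have qe: "awalk v (e # q') w" using q by simp
    note h = awalk_ConsD(3)[OF qe]
    have "gpth v (e # q') * ed e \<approx> gpth (head E e) q' * gh e * ed e"
      using eA by (intro eqv_right pth_Cons(2)[OF qe]) auto
    also have "\<dots> = gpth (head E e) q' * (gh e * ed e)" by (simp add: mult.assoc)
    also have "\<dots> \<approx> gpth (head E e) q' * vx (head E e)"
      using eA by (intro eqv_left path_in_alg[OF h] eqv_gh_ed)
    also have "\<dots> \<approx> gpth (head E e) q'" by (rule vx_pth(2)[OF h])
    finally show "mon (k, u, p, v, q) * ed e \<approx> mon (k, u, p, head E e, q')"
      unfolding \<open>q = e # q'\<close> by (simp add: mon_def mult.assoc eqv_left in_alg)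
  }
  {
    assume "q = f # q'" and ne: "f \<noteq> e"
    then have qf: "awalk v (f # q') w" using q by simp
    note h = awalk_ConsD[OF qf]
    have "gpth v (f # q') * ed e \<approx> gpth (head E f) q' * gh f * ed e"
      using eA by (intro eqv_right pth_Cons(2)[OF qf]) auto
    also have "\<dots> = gpth (head E f) q' * (gh f * ed e)" by (simp add: mult.assoc)
    also have "\<dots> \<approx> gpth (head E f) q' * 0"
      using eA h ne by (intro eqv_left path_in_alg[OF h(3)] eqv_gh_ed_orth)
    finally have "pth u p * (gpth v q * ed e) \<approx> pth u p * 0"
      unfolding \<open>q = f # q'\<close> by (intro eqv_left in_alg) simp
    then have "scal k * (pth u p * (gpth v q * ed e)) \<approx> scal k * 0"
      by (intro eqv_left scal_alg) simp
    then show "mon (k, u, p, v, q) * ed e \<approx> 0" unfolding split by simp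
  }
qed

text \<open>Only the first edge of the ghost path contributes, by
  \<open>e\<^sup>* e e\<^sup>* = e\<^sup>*\<close>. So a finite sum acts as a right identity even if
  \<open>v\<close> emits infinitely many edges.\<close>

lemma mon_expand_edges:
  assumes p: "awalk u p w" and q: "awalk v (e # q) w" and S: "finite S" "e \<in> S" "S \<subseteq> arcs E"
  shows "(\<Sum>f\<in>S. mon (k, u, p, v, e # q) * (ed f * gh f)) \<approx> mon (k, u, p, v, e # q)"
proof -
  note e = awalk_ConsD[OF q]
  note h = path_in_alg[OF e(3)]
  let ?G = "gpth (head E e) q * gh e"
  have Galg: "?G \<in> alg" using e by (intro alg_mult h) auto
  have "(\<Sum>f\<in>S. ?G * (ed f * gh f)) \<approx> (\<Sum>f\<in>S. if f = e then ?G else 0)"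
  proof (rule eqv_sum)
    fix f assume "f \<in> S"
    then have f: "f \<in> arcs E" using S by blast
    show "?G * (ed f * gh f) \<approx> (if f = e then ?G else 0)"
    proof (cases "f = e")
      case True
      have "gpth (head E e) q * ((gh e * ed e) * gh e) \<approx> gpth (head E e) q * (vx (head E e) * gh e)"
        using e by (intro eqv_left eqv_right h eqv_gh_ed) auto
      also have "\<dots> \<approx> gpth (head E e) q * gh e"
        using e by (intro eqv_left h eqv_head_gh)
      finally show ?thesis using True by (simp add: mult.assoc)
    next
      case False
      have "gpth (head E e) q * ((gh e * ed f) * gh f) \<approx> gpth (head E e) q * (0 * gh f)"
        using e f False by (intro eqv_left eqv_right h eqv_gh_ed_orth) auto
      then show ?thesis using False by (simp add: mult.assoc)
    qed
  qed
  also have "\<dots> = ?G" using S by simp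
  finally have G: "?G * (\<Sum>f\<in>S. ed f * gh f) \<approx> ?G" by (simp add: sum_distrib_left)
  have Salg: "(\<Sum>f\<in>S. ed f * gh f) \<in> alg"
    using S by (intro additive_closed_sum[OF additive_closed_alg] alg_mult) auto
  have "gpth v (e # q) * (\<Sum>f\<in>S. ed f * gh f) \<approx> ?G * (\<Sum>f\<in>S. ed f * gh f)"
    by (intro eqv_right Salg pth_Cons(2)[OF q])
  also note G
  also have "?G \<approx> gpth v (e # q)" by (rule eqv_sym[OF pth_Cons(2)[OF q]])
  finally have "scal k * (pth u p * (gpth v (e # q) * (\<Sum>f\<in>S. ed f * gh f))) \<approx>
    scal k * (pth u p * gpth v (e # q))"
    by (intro eqv_left scal_alg path_in_alg[OF p])
  then show ?thesis by (simp add: mon_def sum_distrib_left mult.assoc)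
qed

abbreviation ghost_source :: "'k \<times> 'v \<times> 'e list \<times> 'v \<times> 'e list \<Rightarrow> 'v"
  where "ghost_source t \<equiv> fst (snd (snd (snd t)))"

abbreviation ghost_edges :: "'k \<times> 'v \<times> 'e list \<times> 'v \<times> 'e list \<Rightarrow> 'e list"
  where "ghost_edges t \<equiv> snd (snd (snd (snd t)))"

lemma real_part:
  assumes "\<forall>t\<in>set ts. valid t \<and> ghost_source t = v \<and> ghost_edges t = []"
  shows "\<exists>y\<in>path_poly v. sum_list (map mon ts) \<approx> y"
  using assms
proof (induction ts)
  case Nil
  then show ?case using path_poly_zero by auto
next
  case (Cons t ts)
  then obtain y where y: "y \<in> path_poly v" "sum_list (map mon ts) \<approx> y" by auto
  obtain k u p where t: "t = (k, u, p, v, [])" "awalk u p v"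
    using Cons.prems by (cases t) (auto simp: valid_def awalk_Nil_iff)
  have "mon t \<approx> scal k * pth u p"
    unfolding t(1) mon_def by (auto simp: gpth_Nil intro!: eqv_left pth_vx[OF t(2)])
  then show ?case
    using path_poly_add[OF path_poly_pth[OF t(2), of k] y(1)] eqv_add[OF _ y(2)] by auto
qed

text \<open>
  Multiplying by real edges on the right removes ghost edges. The only obstruction would be that
  all products \<open>x e\<close> with an edge \<open>e\<close> lie in \<open>P\<close>: this is excluded by the gap hypothesis at
  vertices with finitely many live edges; at the others some live edge does not occur in \<open>x\<close>.
\<close>

lemma reduce_to_real_paths:
  assumes K: "condition_K E" and I: "bi_ideal P"
    and gap: "\<And>u. u \<in> live P \<Longrightarrow> finite (live_out P u) \<Longrightarrow> gap P u \<in> P"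
    and ts: "\<forall>t\<in>set ts. valid t \<and> ghost_source t = v \<and> length (ghost_edges t) \<le> n"
    and x: "x \<in> A" "x \<approx> sum_list (map mon ts)" "x \<notin> P" "v \<in> verts E"
  shows "\<exists>b\<in>alg. \<exists>v'\<in>verts E. \<exists>y\<in>path_poly v'. x * b \<approx> y \<and> x * b \<notin> P"
  using ts x
proof (induction n arbitrary: ts v x)
  case 0
  then obtain y where "y \<in> path_poly v" "sum_list (map mon ts) \<approx> y"
    using real_part[of ts v] by auto
  then show ?case
    using 0 eqv_trans scal_alg[of 1] by (intro bexI[of _ 1] bexI[of _ v] bexI[of _ y]) auto
next
  case (Suc n)
  note ts = Suc.prems(1) and x = Suc.prems(2-4) and v = Suc.prems(5)
  have xv: "x * vx v \<approx> x"
  proof -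
    have "sum_list (map mon ts) * vx v \<approx> sum_list (map mon ts)"
      using ts
    proof (induction ts)
      case (Cons t ts)
      obtain k u p q w where t: "t = (k, u, p, v, q)" "awalk u p w" "awalk v q w"
        using Cons.prems by (cases t) (auto simp: valid_def)
      have "mon t * vx v \<approx> mon t"
        using eqv_left[OF scal_alg eqv_left[OF path_in_alg(1)[OF t(2)] vx_pth(2)[OF t(3)]], of k]
        by (simp add: t(1) mon_def mult.assoc)
      from eqv_add[OF this Cons.IH] Cons.prems show ?case by (simp add: distrib_right)
    qed simp
    then show ?thesis
      using eqv_right[OF gens_alg(1)[OF v] x(2)] eqv_sym[OF x(2)] eqv_trans by blast
  qed
  have vP: "v \<in> live P"
    using v bi_ideal_alg(1)[OF I _ A_in_alg[OF x(1)]] bi_ideal_eqv[OF I xv] x(3)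
    by (auto simp: live_def)
  have xe: "\<exists>ts'. (\<forall>t\<in>set ts'. valid t \<and> ghost_source t = head E e \<and>
      length (ghost_edges t) \<le> n) \<and> sum_list (map mon ts) * ed e \<approx> sum_list (map mon ts')"
    if e: "e \<in> out_arcs E v" for e
    using ts
  proof (induction ts)
    case Nil
    then show ?case by (auto intro!: exI[of _ "[]"])
  next
    case (Cons t ts)
    then obtain ts' where ts': "\<forall>t\<in>set ts'. valid t \<and> ghost_source t = head E e \<and>
      length (ghost_edges t) \<le> n" "sum_list (map mon ts) * ed e \<approx> sum_list (map mon ts')"
      by auto
    obtain k u p q w where t: "t = (k, u, p, v, q)" "awalk u p w" "awalk v q w" "length q \<le> Suc n"
      using Cons.prems by (cases t) (auto simp: valid_def)
    note step = mon_times_edge[OF t(2,3) e, where k = k]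
    have add_t: ?case if "valid t'" "fst (snd (snd (snd t'))) = head E e" "length (snd (snd (snd (snd t')))) \<le> n"
      "mon t * ed e \<approx> mon t'" for t'
      using eqv_add[OF that(4) ts'(2)] ts'(1) that
      by (intro exI[of _ "t' # ts'"]) (auto simp: distrib_right)
    have eA: "e \<in> arcs E" "tail E e = v" using e by auto
    show ?case
    proof (cases q)
      case Nil
      then have "v = w" using t by (simp add: awalk_Nil_iff)
      then have "awalk u (p @ [e]) (head E e)"
        using t(2) eA arc_implies_awalk[of e] by (auto simp: awalk_append_iff)
      moreover have "awalk (head E e) [] (head E e)" using eA by (simp add: awalk_Nil_iff)
      ultimately show ?thesis
        using step(1)[OF Nil] t(1) by (intro add_t[of "(k, u, p @ [e], head E e, [])"]) (auto simp: valid_def)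
    next
      case (Cons f q')
      show ?thesis
      proof (cases "f = e")
        case True
        then show ?thesis
          using step(2)[of q'] t Cons awalk_ConsD(3)[of v f q' w]
          by (intro add_t[of "(k, u, p, head E e, q')"]) (auto simp: valid_def)
      next
        case False
        then have "mon t * ed e \<approx> 0" using step(3)[OF Cons] t(1) by simp
        from eqv_add[OF this ts'(2)] show ?thesis
          using ts'(1) by (intro exI[of _ ts']) (auto simp: distrib_right)
      qed
    qed
  qed
  show ?case
  \<comment> \<open>Multiplication by an edge shortens a nonempty ghost path or kills its term, and
    only lengthens the real path of the other terms. So the bound drops from \<open>Suc n\<close> to
    \<open>n\<close>.\<close>
  proof (cases "\<exists>e\<in>out_arcs E v. x * ed e \<notin> P")
    case True
    then obtain e where e: "e \<in> out_arcs E v" "x * ed e \<notin> P" by blast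
    then have eA: "e \<in> arcs E" by auto
    obtain ts' where ts': "\<forall>t\<in>set ts'. valid t \<and> ghost_source t = head E e \<and>
      length (ghost_edges t) \<le> n" "sum_list (map mon ts) * ed e \<approx> sum_list (map mon ts')"
      using xe[OF e(1)] by blast
    have "x * ed e \<approx> sum_list (map mon ts')"
      using eqv_trans[OF eqv_right[OF gens_alg(2)[OF eA] x(2)] ts'(2)] .
    then obtain b v' y where b: "b \<in> alg" "v' \<in> verts E" "y \<in> path_poly v'"
      "x * ed e * b \<approx> y" "x * ed e * b \<notin> P"
      using Suc.IH[OF ts'(1) A_mult[OF x(1) gens_A(2)[OF eA]] _ e(2)] eA by auto
    then show ?thesis
      using alg_mult[OF gens_alg(2)[OF eA] b(1)] by (intro bexI[of _ "ed e * b"]) (auto simp: mult.assoc)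
  next
    case False
    then have xP: "x * ed e \<in> P" if "e \<in> out_arcs E v" for e using that by blast
    have xsum: "(\<Sum>e\<in>S. x * (ed e * gh e)) \<in> P" if "S \<subseteq> out_arcs E v" for S
    proof (rule bi_ideal_sum[OF I])
      fix e assume "e \<in> S"
      then have e: "e \<in> out_arcs E v" using that by blast
      then have "x * ed e * gh e \<in> P" by (intro bi_ideal_alg(2)[OF I xP]) auto
      then show "x * (ed e * gh e) \<in> P" by (simp add: mult.assoc)
    qed
    have False
    proof (cases "finite (live_out P v)")
      case True
      \<comment> \<open>\<open>x\<close> is recovered from \<open>x * gap P v\<close> and its
        products with the finitely many live edges, all of them in \<open>P\<close>.\<close>
      have "x * gap P v + (\<Sum>e\<in>live_out P v. x * (ed e * gh e)) \<in> P"
        by (intro additive_closed_add[OF bi_idealD(2)[OF I]] xsum bi_ideal_alg(1)[OF I gap[OF vP True]]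
            A_in_alg[OF x(1)]) (auto simp: live_out_def)
      then have "x * vx v \<in> P" by (simp add: gap_def right_diff_distrib sum_distrib_left)
      then show False using bi_ideal_eqv[OF I xv] x(3) by blast
    next
      case inf: False
      define ts0 where "ts0 = filter (\<lambda>t. ghost_edges t = []) ts"
      define ts1 where "ts1 = filter (\<lambda>t. ghost_edges t \<noteq> []) ts"
      define S where "S = (\<lambda>t. hd (ghost_edges t)) ` set ts1"
      have S: "finite S" by (simp add: S_def)
      have ts1: "\<exists>k u p w e q. t = (k, u, p, v, e # q) \<and> e \<in> S \<and> awalk u p w \<and>
          awalk v (e # q) w" if mem: "t \<in> set ts1" for t
      proof -
        obtain k u p q w where t: "t = (k, u, p, v, q)" "awalk u p w" "awalk v q w"
          using mem ts by (cases t rule: prod_cases5) (auto simp: valid_def ts1_def)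
        then obtain e q' where q: "q = e # q'" using mem by (cases q) (auto simp: ts1_def)
        then have "e \<in> S" using mem t(1) unfolding S_def by (intro image_eqI[of _ _ t]) auto
        then show ?thesis using t q by blast
      qed
      have S_out: "S \<subseteq> out_arcs E v"
      proof
        fix e assume "e \<in> S"
        then obtain t where t: "t \<in> set ts1" "e = hd (ghost_edges t)" by (auto simp: S_def)
        obtain k u p w f q where f: "t = (k, u, p, v, f # q)" "awalk v (f # q) w" using ts1[OF t(1)] by blast
        then have "f = e" using t(2) by simp
        then show "e \<in> out_arcs E v" using awalk_ConsD(1,2)[OF f(2)] by simp
      qed
      have sum_split: "sum_list (map mon ts) = sum_list (map mon ts0) + sum_list (map mon ts1)"
        unfolding ts0_def ts1_def by (induction ts) (auto simp: algebra_simps)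
      obtain y where y: "y \<in> path_poly v" "sum_list (map mon ts0) \<approx> y"
        using real_part[of ts0 v] ts by (auto simp: ts0_def)
      \<comment> \<open>A live edge that begins no ghost path of \<open>x\<close> kills all terms
        with ghost edges, so that \<open>x * ed f\<close> is the real part \<open>y\<close> extended
        by \<open>f\<close>.\<close>
      obtain f where f: "f \<in> live_out P v" "f \<notin> S" using inf S by (meson finite_subset subsetI)
      have fA: "f \<in> arcs E" "f \<in> out_arcs E v" "vx (head E f) \<notin> P" using f by (auto simp: live_out_def)
      have "sum_list (map mon ts1') * ed f \<approx> 0" if "set ts1' \<subseteq> set ts1" for ts1'
        using that
      proof (induction ts1')
        case (Cons t ts1')
        then have t1: "t \<in> set ts1" by simp
        then obtain k u p w e q where t: "t = (k, u, p, v, e # q)" "e \<in> S" "awalk u p w"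
          "awalk v (e # q) w" using ts1 by blast
        have "e \<noteq> f" using t(2) f(2) by blast
        then have "mon t * ed f \<approx> 0" using mon_times_edge(3)[OF t(3,4) fA(2) refl, of k] t(1) by simp
        from eqv_add[OF this Cons.IH] Cons.prems show ?case by (simp add: distrib_right)
      qed simp
      from this[OF order_refl] have "sum_list (map mon ts1) * ed f \<approx> 0" .
      from eqv_add[OF eqv_right[OF gens_alg(2)[OF fA(1)] y(2)] this]
      have "sum_list (map mon ts) * ed f \<approx> y * ed f" by (simp add: sum_split distrib_right)
      then have "y * ed f \<in> P"
        using bi_ideal_eqv[OF I] eqv_right[OF gens_alg(2)[OF fA(1)] x(2)] xP[OF fA(2)] by blast
      \<comment> \<open>Otherwise \<open>y * ed f\<close> would be a nonzero combination of real
        paths in \<open>P\<close> and would put the head of \<open>f\<close> into \<open>P\<close>.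
        So all terms have ghost paths that begin in \<open>S\<close>, and the finite sum over
        \<open>S\<close> recovers \<open>x\<close> from products in \<open>P\<close>.\<close>
      then have "y = 0"
        using vertex_in_ideal_of_path_poly[OF K I path_poly_times_edge(1)[OF y(1) fA(2)]]
          path_poly_times_edge(2)[OF y(1) fA(2)] fA(3) by blast
      then have x1: "x \<approx> sum_list (map mon ts1)"
        using eqv_trans[OF x(2), of "sum_list (map mon ts1)"] eqv_add[OF y(2) eqv_refl, of "sum_list (map mon ts1)"]
        by (simp add: sum_split)
      have "(\<Sum>e\<in>S. sum_list (map mon ts1') * (ed e * gh e)) \<approx> sum_list (map mon ts1')"
        if "set ts1' \<subseteq> set ts1" for ts1'
        using that
      proof (induction ts1')
        case (Cons t ts1')
        then have t1: "t \<in> set ts1" by simp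
        then obtain k u p w e q where t: "t = (k, u, p, v, e # q)" "e \<in> S" "awalk u p w"
          "awalk v (e # q) w" using ts1 by blast
        have "(\<Sum>e\<in>S. mon t * (ed e * gh e)) \<approx> mon t"
          unfolding t(1) using S_out by (intro mon_expand_edges[OF t(3,4) S t(2)]) auto
        from eqv_add[OF this Cons.IH] Cons.prems show ?case by (simp add: distrib_right sum.distrib)
      qed simp
      from this[OF order_refl]
      have "(\<Sum>e\<in>S. sum_list (map mon ts1) * (ed e * gh e)) \<approx> sum_list (map mon ts1)" .
      moreover have "(\<Sum>e\<in>S. x * (ed e * gh e)) \<approx> (\<Sum>e\<in>S. sum_list (map mon ts1) * (ed e * gh e))"
        using S_out by (intro eqv_sum eqv_right x1 alg_mult) auto
      ultimately have "(\<Sum>e\<in>S. x * (ed e * gh e)) \<approx> x" using eqv_trans eqv_sym[OF x1] by blast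
      then show False using xsum[OF S_out] bi_ideal_eqv[OF I] x(3) by blast
    qed
    then show ?thesis ..
  qed
qed

text \<open>An element of \<open>I\<close> outside \<open>P\<close> is multiplied into a combination
  \<open>y\<close> of real paths that end at one vertex \<open>v'\<close>. Condition (K) extracts
  \<open>v'\<close> from \<open>y\<close> inside \<open>I\<close>, and \<open>v'\<close> is not in
  \<open>P\<close> because \<open>y v' = y\<close> is not.\<close>

lemma larger_ideal_has_live_vertex:
  assumes K: "condition_K E" and P: "bi_ideal P"
    and gap: "\<And>u. u \<in> live P \<Longrightarrow> finite (live_out P u) \<Longrightarrow> gap P u \<in> P"
    and I: "bi_ideal I" "P \<subset> I"
  shows "\<exists>v\<in>live P. vx v \<in> I"
proof -
  obtain x where x: "x \<in> I" "x \<notin> P" using I(2) by blast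
  have xA: "x \<in> A" using x bi_idealD(4)[OF I(1)] by blast
  obtain v where v: "v \<in> verts E" "x * vx v \<notin> P" using not_in_ideal_vertex[OF P xA x(2)] by blast
  obtain ts where ts: "\<forall>t\<in>set ts. valid t" "x \<approx> sum_list (map mon ts)"
    using spanned_A[OF xA] by (auto simp: spanned_def)
  \<comment> \<open>The reduction requires all ghost paths to start at one vertex, which right
    multiplication by \<open>v\<close> enforces.\<close>
  define ts' where "ts' = filter (\<lambda>t. ghost_source t = v) ts"
  have "sum_list (map mon ts) * vx v \<approx> sum_list (map mon ts')"
    using ts(1) unfolding ts'_def
  proof (induction ts)
    case (Cons t ts)
    obtain k u p v' q w where t: "t = (k, u, p, v', q)" "awalk u p w" "awalk v' q w"
      using Cons.prems by (cases t) (auto simp: valid_def)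
    have split: "mon t * vx v = scal k * (pth u p * (gpth v' q * vx v))"
      by (simp add: t(1) mon_def mult.assoc)
    have "mon t * vx v \<approx> (if v' = v then mon t else 0)"
    proof (cases "v' = v")
      case True
      then show ?thesis unfolding split
        using eqv_left[OF scal_alg eqv_left[OF path_in_alg(1)[OF t(2)] vx_pth(2)[OF t(3)]], of k]
        by (simp add: t(1) mon_def)
    next
      case False
      then show ?thesis unfolding split
        using eqv_left[OF scal_alg eqv_left[OF path_in_alg(1)[OF t(2)] vx_pth_orth(2)[OF t(3) v(1)]], of k]
        by simp
    qed
    from eqv_add[OF this Cons.IH] Cons.prems show ?case by (cases "v' = v") (auto simp: distrib_right t(1))
  qed simp
  then have xv: "x * vx v \<approx> sum_list (map mon ts')"
    using eqv_trans[OF eqv_right[OF gens_alg(1)[OF v(1)] ts(2)]] by blast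
  have ts': "\<forall>t\<in>set ts'. valid t \<and> ghost_source t = v \<and>
      length (ghost_edges t) \<le> Max (insert 0 ((\<lambda>t. length (ghost_edges t)) ` set ts'))"
    using ts(1) by (auto simp: ts'_def intro!: Max_ge)
  obtain b v' y where b: "b \<in> alg" "v' \<in> verts E" "y \<in> path_poly v'" "x * vx v * b \<approx> y" "x * vx v * b \<notin> P"
    using reduce_to_real_paths[OF K P gap ts' A_mult[OF xA gens_A(1)[OF v(1)]] xv v(2) v(1)] by blast
  have "x * vx v * b \<in> I"
    using bi_ideal_alg(2)[OF I(1)] x(1) v(1) b(1) by auto
  then have yI: "y \<in> I" and yP: "y \<notin> P" using bi_ideal_eqv[OF I(1) b(4)] bi_ideal_eqv[OF P b(4)] b(5) by auto
  have "y \<noteq> 0" using yP additive_closed_zero[OF bi_idealD(2)[OF P]] by blast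
  then have "vx v' \<in> I" by (rule vertex_in_ideal_of_path_poly[OF K I(1) b(3) _ yI])
  moreover have "vx v' \<notin> P"
  proof
    assume "vx v' \<in> P"
    moreover have "y \<in> alg"
    proof -
      have *: "set (letters (path_word u p)) \<subseteq> generators E" if "awalk u p v'" for u p
        using that by (auto simp: path_word_def awalk_def generators_def)
      show ?thesis
        unfolding alg_iff
      proof
        fix w assume "w \<in> Poly_Mapping.keys y"
        then obtain u p where "w = path_word u p" "awalk u p v'" using b(3) unfolding path_poly_def by blast
        then show "set (letters w) \<subseteq> generators E" using * by simp
      qed
    qed
    ultimately have "y * vx v' \<in> P" by (intro bi_ideal_alg(1)[OF P])
    then show False using yP bi_ideal_eqv[OF P path_poly_eqv_vx[OF b(3,2)]] by blast
  qed
  ultimately show ?thesis using b(2) by (auto simp: live_def)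
qed

text \<open>The idempotents \<open>e n\<close>, built from the paths \<open>L n\<close>, decrease
  below \<open>vx w0\<close>, and none is in \<open>P\<close>. An ideal above \<open>P\<close>
  contains a live vertex, hence the end of some \<open>L n\<close>, hence \<open>e n\<close>; and
  \<open>e n\<close> equals \<open>vx w0\<close> modulo the left ideal \<open>J\<close>.\<close>

lemma primitive_of_no_gap:
  assumes K: "condition_K E" and P: "elementwise_prime P"
    and csp: "countable_separation E (live P)"
    and gap: "\<And>u. u \<in> live P \<Longrightarrow> finite (live_out P u) \<Longrightarrow> gap P u \<in> P"
  shows "\<exists>T w. modular_maximal T w \<and> P = core T"
proof -
  note I = elementwise_primeD(1)[OF P]
  note add = additive_closedD[OF bi_idealD(2)[OF I]]
  have directed: "\<exists>w\<in>live P. u \<rightarrow>\<^sup>*\<^bsub>E\<^esub> w \<and> v \<rightarrow>\<^sup>*\<^bsub>E\<^esub> w" if "u \<in> live P" "v \<in> live P" for u v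
    using maximal_tail_live[OF P] that by (auto simp: maximal_tail_def)
  obtain x where "x \<in> A" "x \<notin> P" using elementwise_primeD(2)[OF P] bi_idealD(4)[OF I] by blast
  then obtain w0 where w0: "w0 \<in> live P" using not_in_ideal_vertex[OF I] by (auto simp: live_def)
  then have w0E: "w0 \<in> verts E" by (simp add: live_def)
  obtain C where C: "countable C" "C \<subseteq> live P" "\<And>u. u \<in> live P \<Longrightarrow> \<exists>v\<in>C. u \<rightarrow>\<^sup>*\<^bsub>E\<^esub> v"
    using csp by (auto simp: countable_separation_def)
  have Cne: "C \<noteq> {}" using C(3)[OF w0] by blast
  define c where "c = from_nat_into C"
  have cC: "c n \<in> C" for n unfolding c_def by (rule from_nat_into[OF Cne])
  have csurj: "\<exists>n. c n = v" if "v \<in> C" for v unfolding c_def using from_nat_into_surj[OF C(1) that] by blast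
  define ok :: "'v \<times> 'e list \<Rightarrow> bool" where "ok = (\<lambda>(w, p). w \<in> live P \<and> awalk w0 p w)"
  \<comment> \<open>By directedness the next end point can be reached both from the current one and
    from the next vertex in the enumeration of \<open>C\<close>.\<close>
  define next_ok :: "nat \<Rightarrow> 'v \<times> 'e list \<Rightarrow> 'v \<times> 'e list \<Rightarrow> bool" where "next_ok = (\<lambda>n (w, p) (w', p'). (\<exists>m. p' = p @ m) \<and> c n \<rightarrow>\<^sup>*\<^bsub>E\<^esub> w')"
  have "\<exists>f. \<forall>n. ok (f n) \<and> next_ok n (f n) (f (Suc n))"
  proof (rule dependent_nat_choice)
    show "\<exists>x. ok x" using w0 w0E by (intro exI[of _ "(w0, [])"]) (auto simp: ok_def awalk_Nil_iff)
    fix x n assume x: "ok x"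
    obtain w p where wp: "x = (w, p)" by (cases x)
    then have w: "w \<in> live P" "awalk w0 p w" using x by (auto simp: ok_def)
    obtain w' where w': "w' \<in> live P" "w \<rightarrow>\<^sup>*\<^bsub>E\<^esub> w'" "c n \<rightarrow>\<^sup>*\<^bsub>E\<^esub> w'"
      using directed[OF w(1), of "c n"] cC C(2) by blast
    obtain m where "awalk w m w'" using w'(2) by (auto simp: reachable_awalk)
    then have "awalk w0 (p @ m) w'" using w(2) by (auto simp: awalk_append_iff)
    then show "\<exists>y. ok y \<and> next_ok n x y"
      using w' unfolding wp by (intro exI[of _ "(w', p @ m)"]) (auto simp: ok_def next_ok_def)
  qed
  then obtain fs where fs: "\<And>n. ok (fs n)" "\<And>n. next_ok n (fs n) (fs (Suc n))" by blast
  define W L where "W n = fst (fs n)" and "L n = snd (fs n)" for n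
  have W: "W n \<in> live P" and L: "awalk w0 (L n) (W n)" for n
    using fs(1)[of n] by (auto simp: ok_def W_def L_def split: prod.splits)
  have ext: "\<exists>m. L (Suc n) = L n @ m" and cW: "c n \<rightarrow>\<^sup>*\<^bsub>E\<^esub> W (Suc n)" for n
    using fs(2)[of n] by (auto simp: next_ok_def W_def L_def split: prod.splits)
  have ext': "\<exists>m. L j = L i @ m" if "i \<le> j" for i j
    using that
  proof (induction j rule: dec_induct)
    case (step j)
    then show ?case using ext[of j] by auto
  qed simp
  define e where "e n = pth w0 (L n) * gpth w0 (L n)" for n
  note in_alg = path_in_alg[OF L]
  have e_alg: "e n \<in> alg" and eA: "e n \<in> A" for n
    using path_A[OF L] in_alg by (auto simp: e_def intro!: alg_mult A_mult)
  have ee: "e i * e j \<approx> e j" if ij: "i \<le> j" for i j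
  proof -
    obtain m where m: "L j = L i @ m" using ext'[OF ij] by blast
    have aw: "awalk (W i) m (W j)" using awalk_append_cancel[OF _ L[of i]] L[of j] m by simp
    have "e i * e j = pth w0 (L i) * (gpth w0 (L i) * pth w0 (L i @ m)) * gpth w0 (L j)"
      by (simp add: e_def mult.assoc m)
    also have "\<dots> \<approx> pth w0 (L i) * pth (W i) m * gpth w0 (L j)"
      by (intro eqv_right eqv_left in_alg gpth_pth_append(1)[OF L aw])
    also have "\<dots> \<approx> pth w0 (L i @ m) * gpth w0 (L j)"
      by (intro eqv_right in_alg pth_append(1)[OF L aw])
    finally show ?thesis by (simp add: e_def m)
  qed
  have we: "vx w0 * e n \<approx> e n" for n
    using eqv_right[OF in_alg(2) vx_pth(1)[OF L]] by (simp add: e_def mult.assoc)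
  have e_notin: "e n \<notin> P" for n
  proof
    assume "e n \<in> P"
    then have "gpth w0 (L n) * e n * pth w0 (L n) \<in> P"
      using in_alg by (intro bi_ideal_alg[OF I]) auto
    moreover have "gpth w0 (L n) * e n * pth w0 (L n) =
        (gpth w0 (L n) * pth w0 (L n)) * (gpth w0 (L n) * pth w0 (L n))"
      by (simp add: e_def mult.assoc)
    moreover have "\<dots> \<approx> vx (W n) * vx (W n)"
      using eqv_trans[OF eqv_right[OF _ gpth_pth[OF L]] eqv_left[OF _ gpth_pth[OF L]]]
        in_alg alg_mult by blast
    moreover have "\<dots> \<approx> vx (W n)" using W by (intro eqv_vx_idem) (simp add: live_def)
    ultimately have "vx (W n) \<in> P" using bi_ideal_eqv[OF I] by metis
    then show False using W by (simp add: live_def)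
  qed
  \<comment> \<open>An increasing union of left annihilators modulo \<open>P\<close>: what
    \<open>e i\<close> kills is killed by every later \<open>e j\<close>. It contains
    \<open>vx w0 - e n\<close> for all \<open>n\<close>.\<close>
  define J where "J = {x\<in>A. \<exists>n. x * e n \<in> P}"
  have later: "x * e j \<in> P" if "x \<in> A" "x * e i \<in> P" "i \<le> j" for x i j
  proof -
    have "x * e i * e j \<in> P" by (rule bi_ideal_alg(2)[OF I that(2) e_alg])
    then show ?thesis
      using bi_ideal_eqv[OF I eqv_left[OF A_in_alg[OF that(1)] ee[OF that(3)]]] by (simp add: mult.assoc)
  qed
  have PJ: "P \<subseteq> J" using bi_idealD(4,6)[OF I] eA by (auto simp: J_def)
  have J: "left_ideal J"
    unfolding left_ideal_def
  proof (intro conjI ballI)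
    show "additive_closed J"
      unfolding additive_closed_def
    proof (intro conjI ballI)
      show "0 \<in> J" using PJ add(1) by blast
      fix x y assume "x \<in> J" "y \<in> J"
      then obtain i j where ij: "x \<in> A" "y \<in> A" "x * e i \<in> P" "y * e j \<in> P" by (auto simp: J_def)
      have "x * e (max i j) - y * e (max i j) \<in> P"
        by (intro add(2) later[OF ij(1,3)] later[OF ij(2,4)]) auto
      then show "x - y \<in> J" using ij A_diff unfolding J_def by (auto simp: left_diff_distrib)
    qed
    show "N \<subseteq> J" using bi_idealD(3)[OF I] PJ by blast
    show "a * x \<in> J" if "a \<in> A" "x \<in> J" for a x
      using that A_mult bi_idealD(5)[OF I] unfolding J_def mem_Collect_eq mult.assoc by blast
  qed (auto simp: J_def)
  have w: "vx w0 \<in> A" "vx w0 \<notin> J"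
    using w0E e_notin bi_ideal_eqv[OF I we] by (auto simp: J_def)
  have modular: "x - x * vx w0 \<in> J" if x: "x \<in> A" for x
  proof -
    have "x * (vx w0 * e 0) \<approx> x * e 0" by (rule eqv_left[OF A_in_alg[OF x] we])
    then have "x * e 0 - x * (vx w0 * e 0) \<approx> 0"
      using eqv_diff[OF eqv_refl, of "x * (vx w0 * e 0)" "x * e 0" "x * e 0"] by simp
    then have "(x - x * vx w0) * e 0 \<in> P"
      using bi_idealD(3)[OF I] by (auto simp: eqv_zero_iff left_diff_distrib mult.assoc)
    then show ?thesis using x w A_closed by (auto simp: J_def)
  qed
  have big: "\<exists>i\<in>I'. vx w0 - i \<in> J" if I': "bi_ideal I'" "P \<subset> I'" for I'
  proof -
    obtain u where u: "u \<in> live P" "vx u \<in> I'" using larger_ideal_has_live_vertex[OF K I gap I'] by blast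
    obtain n where n: "u \<rightarrow>\<^sup>*\<^bsub>E\<^esub> c n" using C(3)[OF u(1)] csurj by metis
    have "u \<rightarrow>\<^sup>*\<^bsub>E\<^esub> W (Suc n)" using reachable_trans[OF n cW] .
    then have "vx (W (Suc n)) \<in> I'" using bi_ideal_vx_path(1)[OF I'(1) _ u(2)] by (auto simp: reachable_awalk)
    then have "pth w0 (L (Suc n)) \<in> I'" using bi_ideal_vx_path(2)[OF I'(1) L] by blast
    then have eI: "e (Suc n) \<in> I'" unfolding e_def using bi_ideal_alg(2)[OF I'(1)] in_alg by blast
    have "vx w0 * e (Suc n) - e (Suc n) * e (Suc n) \<approx> e (Suc n) - e (Suc n)"
      by (intro eqv_diff we ee) simp
    then have "(vx w0 - e (Suc n)) * e (Suc n) \<in> P"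
      using bi_idealD(3)[OF I] by (auto simp: eqv_zero_iff left_diff_distrib)
    then have "vx w0 - e (Suc n) \<in> J" using w eA A_diff by (auto simp: J_def)
    then show ?thesis using eI by blast
  qed
  show ?thesis by (rule primitive_criterion[OF I J PJ w modular big])
qed

lemma prime_imp_primitive:
  assumes K: "condition_K E" and csp: "\<And>M. maximal_tail E M \<Longrightarrow> countable_separation E M"
    and P: "elementwise_prime P"
  shows "\<exists>T w. modular_maximal T w \<and> P = core T"
proof (cases "\<exists>u\<in>live P. finite (live_out P u) \<and> gap P u \<notin> P")
  case True
  then show ?thesis using primitive_of_gap[OF P] by (auto simp: live_def)
next
  case False
  then show ?thesis using primitive_of_no_gap[OF K P csp[OF maximal_tail_live[OF P]]] by blast
qed

end

section \<open>Branching systems\<close>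

text \<open>
  A branching system makes the free algebra act from the right on functions on \<open>X\<close>, with values in
  the Laurent polynomials \<^typ>\<open>int \<Rightarrow>\<^sub>0 'k\<close>. An edge \<open>e\<close> is a bijection from the points over its
  head to a part of the points over its tail; \<open>wt\<close> records a power of the Laurent variable
  that is picked up when an edge leads to a point.
\<close>

locale branching_system = leavitt E scalars
  for E :: "('v, 'e) pre_digraph" and scalars :: "'k::field itself" +
  fixes X :: "'x set" and src :: "'x \<Rightarrow> 'v" and up :: "'e \<Rightarrow> 'x \<Rightarrow> 'x"
    and down :: "'x \<Rightarrow> ('e \<times> 'x) option" and wt :: "'x \<Rightarrow> int"
  assumes src_verts: "x \<in> X \<Longrightarrow> src x \<in> verts E"
    and up: "\<lbrakk>e \<in> arcs E; y \<in> X; src y = head E e\<rbrakk> \<Longrightarrow>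
      up e y \<in> X \<and> src (up e y) = tail E e \<and> down (up e y) = Some (e, y)"
    and down: "\<lbrakk>x \<in> X; down x = Some (e, y)\<rbrakk> \<Longrightarrow>
      e \<in> arcs E \<and> y \<in> X \<and> src y = head E e \<and> up e y = x"
    and down_regular: "\<lbrakk>x \<in> X; regular_vertex E (src x)\<rbrakk> \<Longrightarrow> down x \<noteq> None"
begin

fun letter :: "('v, 'e) generator \<Rightarrow> ('x \<Rightarrow> int \<Rightarrow>\<^sub>0 'k) \<Rightarrow> 'x \<Rightarrow> int \<Rightarrow>\<^sub>0 'k"
  where "letter (Vertex v) \<xi> x = (if x \<in> X \<and> src x = v then \<xi> x else 0)"
  | "letter (Edge e) \<xi> x =
      (if x \<in> X \<and> src x = head E e then Poly_Mapping.single (wt (up e x)) 1 * \<xi> (up e x) else 0)"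
  | "letter (Ghost e) \<xi> x =
      (if x \<in> X then case down x of None \<Rightarrow> 0
        | Some (f, y) \<Rightarrow> if f = e then Poly_Mapping.single (- wt x) 1 * \<xi> y else 0
      else 0)"

text \<open>\<open>fold\<close> applies the first letter of a word first, which makes this a right
  action; scalars become constant Laurent polynomials.\<close>

definition rep :: "('v, 'e, 'k) free_lpa \<Rightarrow> ('x \<Rightarrow> int \<Rightarrow>\<^sub>0 'k) \<Rightarrow> 'x \<Rightarrow> int \<Rightarrow>\<^sub>0 'k"
  where "rep a \<xi> x =
    (\<Sum>w\<in>Poly_Mapping.keys a. Poly_Mapping.single 0 (Poly_Mapping.lookup a w) * fold letter (letters w) \<xi> x)"

lemma rep_add: "rep (a + b) \<xi> x = rep a \<xi> x + rep b \<xi> x"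
  unfolding rep_def
  by (rule setsum_keys_plus_distrib) (simp_all add: single_add distrib_right)

lemma rep_zero: "rep 0 \<xi> x = 0"
  by (simp add: rep_def)

lemma rep_diff: "rep (a - b) \<xi> x = rep a \<xi> x - rep b \<xi> x"
  using rep_add[of "a - b" b \<xi> x] by simp

lemma rep_sum: "rep (\<Sum>i\<in>S. f i) \<xi> x = (\<Sum>i\<in>S. rep (f i) \<xi> x)"
  by (induction S rule: infinite_finite_induct) (simp_all add: rep_zero rep_add)

lemma rep_single: "rep (Poly_Mapping.single w k) \<xi> x = Poly_Mapping.single 0 k * fold letter (letters w) \<xi> x"
  by (simp add: rep_def)

lemma rep_gen: "rep (gen g) \<xi> x = letter g \<xi> x"
  by (simp add: rep_single)

lemma letter_linear: "letter g (\<lambda>x. c * \<xi> x + \<eta> x) = (\<lambda>x. c * letter g \<xi> x + letter g \<eta> x)"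
  by (cases g) (auto simp: fun_eq_iff algebra_simps split: option.split)

lemma fold_letter_linear:
  "fold letter gs (\<lambda>x. c * \<xi> x + \<eta> x) = (\<lambda>x. c * fold letter gs \<xi> x + fold letter gs \<eta> x)"
  by (induction gs arbitrary: \<xi> \<eta>) (simp_all add: letter_linear)

lemma rep_linear: "rep a (\<lambda>x. c * \<xi> x + \<eta> x) = (\<lambda>x. c * rep a \<xi> x + rep a \<eta> x)"
  by (simp add: rep_def fold_letter_linear fun_eq_iff distrib_left sum.distrib sum_distrib_left mult.left_commute)

lemma rep_zero_fun: "rep a (\<lambda>x. 0) = (\<lambda>x. 0)"
  using rep_linear[of a "-1" "\<lambda>x. 0" "\<lambda>x. 0"] by (simp add: fun_eq_iff)

lemma rep_add_fun: "rep a (\<lambda>x. \<xi> x + \<eta> x) = (\<lambda>x. rep a \<xi> x + rep a \<eta> x)"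
  using rep_linear[of a 1 \<xi> \<eta>] by simp

lemma rep_scale: "rep a (\<lambda>x. c * \<xi> x) = (\<lambda>x. c * rep a \<xi> x)"
  using rep_linear[of a c \<xi> "\<lambda>x. 0"] by (simp add: rep_zero_fun)

lemma rep_mult: "rep (a * b) \<xi> = rep b (rep a \<xi>)"
proof (induction a rule: poly_mapping_additive_induct)
  case zero
  have "rep 0 \<eta> = (\<lambda>x. 0)" for \<eta> by (simp add: fun_eq_iff rep_zero)
  then show ?case by (simp add: rep_zero_fun)
next
  case (add x y)
  have "rep (x + y) \<xi> = (\<lambda>z. rep x \<xi> z + rep y \<xi> z)" by (simp add: fun_eq_iff rep_add)
  then show ?case using add by (simp add: fun_eq_iff distrib_right rep_add rep_add_fun)
next
  case (single w k)
  show ?case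
  proof (induction b rule: poly_mapping_additive_induct)
    case (single w' k')
    let ?k = "Poly_Mapping.single 0 k :: int \<Rightarrow>\<^sub>0 'k" and ?k' = "Poly_Mapping.single 0 k' :: int \<Rightarrow>\<^sub>0 'k"
    have scale: "fold letter gs (\<lambda>x. c * \<eta> x) = (\<lambda>x. c * fold letter gs \<eta> x)" for gs c \<eta>
      using rep_scale[of "Poly_Mapping.single (Word gs) 1" c \<eta>] by (simp add: rep_single fun_eq_iff)
    have "rep (Poly_Mapping.single w k) \<xi> = (\<lambda>x. ?k * fold letter (letters w) \<xi> x)"
      by (simp add: fun_eq_iff rep_single)
    then have "rep (Poly_Mapping.single w' k') (rep (Poly_Mapping.single w k) \<xi>) x =
        (?k' * ?k) * fold letter (letters w') (fold letter (letters w) \<xi>) x" for x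
      by (simp only: rep_single scale mult.assoc)
    moreover have "rep (Poly_Mapping.single w k * Poly_Mapping.single w' k') \<xi> x =
        (?k' * ?k) * fold letter (letters w') (fold letter (letters w) \<xi>) x" for x
      by (simp add: mult_single rep_single plus_word_def mult.commute)
    ultimately show ?case by (simp add: fun_eq_iff)
  qed (simp_all add: fun_eq_iff rep_zero rep_add distrib_left)
qed

text \<open>An edge and its ghost carry inverse weights, which cancel. In the sum relation at a
  regular vertex, only the edge returned by \<open>down\<close> contributes at a given point, and
  \<open>down_regular\<close> ensures that there is one.\<close>

lemma rep_relation:
  assumes "a \<in> leavitt_relations E"
  shows "rep a \<xi> x = 0"
proof -
  note simps = rep_diff rep_mult rep_gen rep_gen[abs_def]
  have fun_gen: "rep (gen g) \<xi> = letter g \<xi>" for g \<xi> by (simp add: fun_eq_iff rep_gen)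
  have cancel: "Poly_Mapping.single m 1 * (Poly_Mapping.single (- m) 1 * c) = c"
    "Poly_Mapping.single (- m) 1 * (Poly_Mapping.single m 1 * c) = c" for m and c :: "int \<Rightarrow>\<^sub>0 'k"
    by (simp_all add: mult_single flip: mult.assoc)
  have up': "up e x \<in> X" "src (up e x) = tail E e" "down (up e x) = Some (e, x)"
    if "e \<in> arcs E" "x \<in> X" "src x = head E e" for e x using up[OF that] by auto
  have down': "y \<in> X" "src y = head E e" "up e y = x" "src x = tail E e" "e \<in> arcs E"
    if "x \<in> X" "down x = Some (e, y)" for e x y
    using down[OF that] up[of e y] by auto
  from assms show ?thesis
    unfolding leavitt_relations_def
  proof (elim UnE, goal_cases)
    case 9
    then obtain v where v: "regular_vertex E v" "a = vx v - (\<Sum>e \<in> out_arcs E v. ed e * gh e)"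
      by auto
    have "rep (\<Sum>e \<in> out_arcs E v. ed e * gh e) \<xi> x = (\<Sum>e \<in> out_arcs E v. letter (Ghost e) (letter (Edge e) \<xi>) x)"
      by (simp add: rep_sum rep_mult fun_gen)
    also have "\<dots> = letter (Vertex v) \<xi> x"
    proof (cases "x \<in> X")
      case True
      show ?thesis
      proof (cases "down x")
        case None
        then have "src x \<noteq> v" using down_regular[OF True] v by auto
        then show ?thesis using None True by simp
      next
        case (Some fy)
        obtain f y where fy: "down x = Some (f, y)" using Some by (cases fy) auto
        note d = down'[OF True fy]
        have "(\<Sum>e \<in> out_arcs E v. letter (Ghost e) (letter (Edge e) \<xi>) x) =
          (\<Sum>e \<in> out_arcs E v. if e = f then \<xi> x else 0)"
          using True d by (intro sum.cong) (auto simp: fy cancel)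
        also have "\<dots> = letter (Vertex v) \<xi> x"
          using v d True by (auto simp: regular_vertex_def sum.delta)
        finally show ?thesis .
      qed
    qed simp
    finally show ?case using v by (simp add: rep_diff rep_gen)
  qed (auto simp: rep_diff rep_mult fun_gen rep_gen up' down' cancel split: option.split)
qed

text \<open>The elements that act as zero form an ideal of the free algebra that contains the
  relations, so minimality of \<open>N\<close> applies.\<close>

lemma rep_N:
  assumes "a \<in> N"
  shows "rep a \<xi> = (\<lambda>x. 0)"
proof -
  define I where "I = {a\<in>alg. \<forall>\<xi>. rep a \<xi> = (\<lambda>x. 0)}"
  have "ideal I (free_algebra (generators E))"
  proof (rule idealI)
    interpret ring "free_algebra (generators E) :: ('v, 'e, 'k) free_lpa ring" by (rule ring_free_algebra)
    show "ring (free_algebra (generators E) :: ('v, 'e, 'k) free_lpa ring)" by (rule ring_free_algebra)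
    show "subgroup I (add_monoid (free_algebra (generators E)))"
    proof (rule add.subgroupI)
      show "I \<subseteq> carrier (free_algebra (generators E))" by (auto simp: I_def alg_def)
      show "I \<noteq> {}" using alg_add(1) by (auto simp: I_def fun_eq_iff rep_zero)
      show "\<ominus>\<^bsub>free_algebra (generators E)\<^esub> a \<in> I" if "a \<in> I" for a
        using that rep_diff[of 0 a] alg_add(3)[of a]
        by (simp add: I_def free_algebra_uminus fun_eq_iff rep_zero)
    qed (auto simp: free_algebra_def I_def alg_add fun_eq_iff rep_add)
  qed (auto simp: I_def alg_def[symmetric] alg_mult rep_mult rep_zero_fun,
      auto simp: free_algebra_def rep_mult rep_zero_fun I_def alg_mult)
  moreover have "leavitt_relations E \<subseteq> I"
    using relations_in_A A_subset_alg rep_relation by (auto simp: I_def fun_eq_iff)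
  ultimately have "N \<subseteq> I" by (rule N_minimal)
  then show ?thesis using assms by (auto simp: I_def)
qed

lemma bi_ideal_annihilator_rep:
  "bi_ideal {a\<in>A. \<forall>\<xi>. rep a \<xi> = (\<lambda>x. 0)}" (is "bi_ideal ?I")
  unfolding bi_ideal_def left_ideal_def
proof (intro conjI ballI)
  show "additive_closed ?I"
    using A_closed by (auto simp: additive_closed_def fun_eq_iff rep_zero rep_diff)
  show "N \<subseteq> ?I" using N_subset_A rep_N by auto
qed (auto simp: A_mult rep_mult rep_zero_fun)

lemma vx_annihilates_iff: "(\<forall>\<xi>. rep (vx v) \<xi> = (\<lambda>x. 0)) \<longleftrightarrow> (\<forall>x\<in>X. src x \<noteq> v)"
proof
  assume "\<forall>\<xi>. rep (vx v) \<xi> = (\<lambda>x. 0)"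
  then have *: "rep (vx v) (\<lambda>x. 1) x = 0" for x by (simp add: fun_eq_iff)
  show "\<forall>x\<in>X. src x \<noteq> v"
  proof
    fix x assume "x \<in> X"
    then show "src x \<noteq> v" using *[of x] by (auto simp: rep_gen)
  qed
qed (auto simp: fun_eq_iff rep_gen)

end

section \<open>A closed path without exit\<close>

context leavitt
begin

text \<open>Evaluating the Laurent variable at 1, that is, taking the sum \<open>s\<close> of the
  coefficients, kills the second factor but not \<open>1\<close>.\<close>

lemma no_unit_multiple:
  fixes d :: "int \<Rightarrow>\<^sub>0 'k"
  shows "d * (1 - Poly_Mapping.single 1 1) \<noteq> 1"
proof
  define s where "s = (\<lambda>d :: int \<Rightarrow>\<^sub>0 'k. \<Sum>n\<in>Poly_Mapping.keys d. Poly_Mapping.lookup d n)"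
  have s_add: "s (a + b) = s a + s b" for a b
    unfolding s_def by (rule setsum_keys_plus_distrib) simp_all
  have s_single: "s (Poly_Mapping.single n k) = k" for n k
    by (simp add: s_def)
  have shift: "s (d * Poly_Mapping.single 1 1) = s d" for d
    by (induction d rule: poly_mapping_additive_induct)
      (simp_all add: s_add s_single mult_single distrib_right)
  assume "d * (1 - Poly_Mapping.single 1 1) = 1"
  then have "d = 1 + d * Poly_Mapping.single 1 1" by (simp add: algebra_simps)
  then have "s d = s 1 + s d" using s_add shift by metis
  moreover have "s 1 = 1" using s_single[of 0 1] by simp
  ultimately show False by simp
qed

text \<open>A point \<open>p\<close> of \<open>X\<close> stands for the infinite path
  \<open>p c c c ...\<close>, written with the shortest \<open>p\<close> that reaches
  \<open>v\<close>. Prepending a full copy of \<open>c\<close> to \<open>c c c ...\<close> gives the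
  same point \<open>[]\<close> and is recorded by one power of the Laurent variable, so
  \<open>c\<close> acts there as the variable.\<close>

lemma condition_K_necessary:
  assumes "\<not> condition_K E"
  shows "\<exists>P. elementwise_prime P \<and> \<not> (\<exists>T w. modular_maximal T w \<and> P = core T)"
proof -
  obtain v c where v: "v \<in> verts E" and c: "simple_closed_path E v c"
    and uniq: "\<And>p. simple_closed_path E v p \<Longrightarrow> p = c"
    using assms unfolding condition_K_def by blast
  obtain e0 c' where c_eq: "c = e0 # c'" and cw: "awalk v (e0 # c') v" and c'_ne: "\<forall>e\<in>set c'. tail E e \<noteq> v"
    using c by (cases c) (auto simp: simple_closed_path_def)
  note e0 = awalk_ConsD[OF cw]
  define X where "X = {p. (\<exists>u. awalk u p v) \<and> (\<forall>e\<in>set p. tail E e \<noteq> v)}"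
  define src where "src = (\<lambda>p. if p = [] then v else tail E (hd p))"
  define up where "up = (\<lambda>e p. if tail E e = v then [] else e # p)"
  \<comment> \<open>\<open>[]\<close> is the infinite path \<open>c c c ...\<close>: its first edge
    is \<open>e0\<close>, and the rest is represented by \<open>c'\<close>.\<close>
  define down where "down = (\<lambda>p. case p of [] \<Rightarrow> Some (e0, c') | e # p' \<Rightarrow> Some (e, p'))"
  define wt :: "'e list \<Rightarrow> int" where "wt = (\<lambda>p. if p = [] then 1 else 0)"
  have src_awalk: "src p = u" if "awalk u p v" for u p
    using that by (cases p) (auto simp: src_def awalk_Nil_iff awalk_Cons_iff)
  have X_awalk: "awalk (src p) p v" if "p \<in> X" for p
    using that src_awalk by (auto simp: X_def)
  have Nil_X: "[] \<in> X" using v by (auto simp: X_def awalk_Nil_iff)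
  \<comment> \<open>Here the uniqueness of \<open>c\<close> enters: an edge out of \<open>v\<close>
    can only be prepended to \<open>c'\<close>.\<close>
  have closes: "e = e0 \<and> p = c'" if "e \<in> arcs E" "p \<in> X" "src p = head E e" "tail E e = v" for e p
  proof -
    have "awalk v (e # p) v" using that X_awalk[OF that(2)] by (auto simp: awalk_Cons_iff)
    then have "simple_closed_path E v (e # p)"
      using that(2) by (auto simp: simple_closed_path_def X_def)
    then show ?thesis using uniq c_eq by auto
  qed
  have c'_X: "c' \<in> X" "src c' = head E e0" using e0 c'_ne src_awalk by (auto simp: X_def)
  interpret B: branching_system E scalars X src up down wt
  proof unfold_locales
    show "src x \<in> verts E" if "x \<in> X" for x using X_awalk[OF that] by auto
    show "up e y \<in> X \<and> src (up e y) = tail E e \<and> down (up e y) = Some (e, y)"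
      if "e \<in> arcs E" "y \<in> X" "src y = head E e" for e y
    proof (cases "tail E e = v")
      case True
      then show ?thesis using closes[OF that] Nil_X by (simp add: up_def down_def src_def)
    next
      case False
      have "awalk (tail E e) (e # y) v" using that X_awalk[OF that(2)] by (auto simp: awalk_Cons_iff)
      then show ?thesis using False that(2) by (auto simp: up_def down_def src_def X_def)
    qed
    show "e \<in> arcs E \<and> y \<in> X \<and> src y = head E e \<and> up e y = x" if "x \<in> X" "down x = Some (e, y)" for x e y
    proof (cases x)
      case Nil
      then show ?thesis using that e0 c'_X by (auto simp: down_def up_def)
    next
      case (Cons f p)
      then have ey: "f = e" "p = y" using that(2) by (auto simp: down_def)
      have "awalk (src x) (e # y) v" using X_awalk[OF that(1)] Cons ey by simp
      note d = awalk_ConsD[OF this]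
      show ?thesis using that(1) d src_awalk[OF d(3)] Cons ey by (auto simp: X_def up_def)
    qed
    show "down x \<noteq> None" for x by (simp add: down_def split: list.split)
  qed
  define \<delta> :: "'e list \<Rightarrow> int \<Rightarrow>\<^sub>0 'k" where "\<delta> = (\<lambda>x. if x = [] then 1 else 0)"
  \<comment> \<open>The entry at \<open>[]\<close> of the image of the delta function there. As
    \<open>[]\<close> is the only point over \<open>v\<close>, the vertex acts with rank one, which
    makes \<open>g\<close> multiplicative across \<open>v\<close>.\<close>
  define g where "g a = B.rep a \<delta> []" for a
  have src_v: "x \<in> X \<and> src x = v \<longleftrightarrow> x = []" for x
    using Nil_X by (cases x) (auto simp: X_def src_def)
  have rep_v: "B.rep (vx v) \<eta> = (\<lambda>x. \<eta> [] * \<delta> x)" for \<eta>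
    by (auto simp: fun_eq_iff B.rep_gen src_v \<delta>_def)
  have edges: "fold B.letter (map Edge p) \<eta> y = \<eta> (p @ y)" if "p @ y \<in> X" for p \<eta> y
    using that
  proof (induction p arbitrary: \<eta>)
    case (Cons e p)
    have aw: "awalk (src (e # p @ y)) (e # (p @ y)) v" using X_awalk[of "e # p @ y"] Cons.prems by simp
    note d = awalk_ConsD[OF aw]
    have "p @ y \<in> X" using Cons.prems d by (auto simp: X_def)
    moreover have "up e (p @ y) = e # p @ y" using Cons.prems by (auto simp: X_def up_def)
    moreover have "wt (e # p @ y) = 0" by (simp add: wt_def)
    ultimately show ?case using Cons.IH src_awalk[OF d(3)] by simp
  qed simp
  have "g (pth v c) = fold B.letter (map Edge c') (B.letter (Edge e0) (B.letter (Vertex v) \<delta>)) []"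
    by (simp add: g_def pth_def B.rep_single c_eq)
  also have "\<dots> = B.letter (Edge e0) (B.letter (Vertex v) \<delta>) c'"
    using edges[of c' "[]"] c'_X by simp
  also have "\<dots> = Poly_Mapping.single 1 1"
  proof -
    have "up e0 c' = []" "wt [] = 1" "src [] = v" using e0(2) by (simp_all add: up_def wt_def src_def)
    then show ?thesis using c'_X Nil_X by (simp add: \<delta>_def)
  qed
  finally have g_c: "g (pth v c) = Poly_Mapping.single 1 1" .
  have g_v: "g (vx v) = 1" using rep_v[of \<delta>] by (simp add: g_def \<delta>_def)
  have cA: "pth v c \<in> A" using path_A(1)[OF cw] c_eq by simp
  show ?thesis
  \<comment> \<open>The corner element \<open>v - c\<close> is mapped to 1 minus the variable, which
    is nonzero and not invertible.\<close>
  proof (rule nonprimitive_prime_from_corner[of "vx v" g "vx v - pth v c"])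
    show "vx v \<in> A" "vx v * vx v - vx v \<in> N" using v eqv_vx_idem[OF v] by (auto simp: eqv_def)
    show "g (a - b) = g a - g b" for a b by (simp add: g_def B.rep_diff)
    show "g a = 0" if "a \<in> N" for a using B.rep_N[OF that] by (simp add: g_def)
    show "g (a * vx v * b) = g a * g b" for a b
      by (simp add: g_def B.rep_mult rep_v B.rep_scale)
    show "g (vx v) = 1" by (rule g_v)
    show "vx v - pth v c \<in> A" using v cA A_diff by simp
    have gt: "g (vx v - pth v c) = 1 - Poly_Mapping.single 1 1"
      using g_v g_c by (simp add: g_def B.rep_diff)
    show "g (vx v - pth v c) \<noteq> 0"
    proof
      assume "g (vx v - pth v c) = 0"
      then have "Poly_Mapping.lookup (1 - Poly_Mapping.single 1 1 :: int \<Rightarrow>\<^sub>0 'k) 0 = 0" using gt by simp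
      then show False by (simp add: lookup_minus lookup_single lookup_one)
    qed
    show "g y * g (vx v - pth v c) \<noteq> 1" for y unfolding gt by (rule no_unit_multiple)
  qed
qed

section \<open>The Countable Separation Property is necessary\<close>

text \<open>A point \<open>(p, w)\<close> stands for the path \<open>p\<close> followed by the walk
  from \<open>w\<close> along the chosen edges, which stops only at a vertex that is not regular.
  Chosen edges stay in \<open>M\<close>, so the points lie exactly over the vertices of
  \<open>M\<close>, and the kernel of the action contains exactly the other vertices.\<close>

lemma ideal_avoiding_maximal_tail:
  assumes M: "maximal_tail E M"
  shows "\<exists>I. bi_ideal I \<and> live I = M"
proof -
  have M_sub: "M \<subseteq> verts E" and up_closed: "\<And>u v. v \<in> M \<Longrightarrow> u \<in> verts E \<Longrightarrow> u \<rightarrow>\<^sup>*\<^bsub>E\<^esub> v \<Longrightarrow> u \<in> M"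
    using M by (auto simp: maximal_tail_def)
  obtain ch where ch: "\<And>v. v \<in> M \<Longrightarrow> regular_vertex E v \<Longrightarrow> ch v \<in> arcs E \<and> tail E (ch v) = v \<and> head E (ch v) \<in> M"
    using M unfolding maximal_tail_def by metis
  define chosen where "chosen e \<longleftrightarrow> tail E e \<in> M \<and> regular_vertex E (tail E e) \<and> e = ch (tail E e)" for e
  \<comment> \<open>A chosen edge at the end of \<open>p\<close> would already belong to the chosen
    walk; excluding it makes the representation unique, and \<open>up\<close> absorbs such an
    edge.\<close>
  define X where "X = {(p, w). w \<in> M \<and> (\<exists>u. awalk u p w) \<and> (p = [] \<or> \<not> chosen (last p))}"
  define src where "src = (\<lambda>(p, w). if p = [] then w else tail E (hd p))"
  define up where "up = (\<lambda>e (p, w). if p = [] \<and> chosen e then ([], tail E e) else (e # p, w))"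
  define down where "down = (\<lambda>(p, w). case p of e # p' \<Rightarrow> Some (e, (p', w))
    | [] \<Rightarrow> if regular_vertex E w then Some (ch w, ([], head E (ch w))) else None)"
  have src_awalk: "src (p, w) = u" if "awalk u p w" for u p w
    using that by (cases p) (auto simp: src_def awalk_Nil_iff awalk_Cons_iff)
  have X_awalk: "awalk (src (p, w)) p w" if "(p, w) \<in> X" for p w
    using that src_awalk by (auto simp: X_def)
  have src_M: "src (p, w) \<in> M" if "(p, w) \<in> X" for p w
    using X_awalk[OF that] that up_closed[of w "src (p, w)"] by (auto simp: X_def reachable_awalk)
  have Nil_X: "([], w) \<in> X" if "w \<in> M" for w using that M_sub by (auto simp: X_def awalk_Nil_iff)
  interpret B: branching_system E scalars X src up down "\<lambda>_. 0"
  proof unfold_locales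
    show "src x \<in> verts E" if "x \<in> X" for x using src_M that M_sub by (cases x) auto
    show "up e y \<in> X \<and> src (up e y) = tail E e \<and> down (up e y) = Some (e, y)"
      if "e \<in> arcs E" "y \<in> X" "src y = head E e" for e y
    proof -
      obtain p w where y: "y = (p, w)" by (cases y)
      show ?thesis
      proof (cases "p = [] \<and> chosen e")
        case True
        then have "tail E e \<in> M" "regular_vertex E (tail E e)" "ch (tail E e) = e" by (auto simp: chosen_def)
        moreover have "w = head E e" using that(3) y True by (simp add: src_def)
        ultimately show ?thesis using True y Nil_X by (simp add: up_def down_def src_def)
      next
        case False
        have "awalk (tail E e) (e # p) w" using that X_awalk[of p w] y by (auto simp: awalk_Cons_iff)
        moreover have "w \<in> M" using that(2) y by (simp add: X_def)
        ultimately have "(e # p, w) \<in> X" using False that(2) y by (auto simp: X_def)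
        then show ?thesis using False y by (auto simp: up_def down_def src_def)
      qed
    qed
    show "e \<in> arcs E \<and> y \<in> X \<and> src y = head E e \<and> up e y = x" if "x \<in> X" "down x = Some (e, y)" for x e y
    proof -
      obtain p w where x: "x = (p, w)" by (cases x)
      have w: "w \<in> M" using that(1) x by (simp add: X_def)
      show ?thesis
      proof (cases p)
        case Nil
        then have reg: "regular_vertex E w" and ey: "e = ch w" "y = ([], head E (ch w))"
          using that(2) x by (auto simp: down_def split: if_splits)
        then show ?thesis using ch[OF w reg] Nil_X x Nil w by (auto simp: src_def up_def chosen_def)
      next
        case (Cons f p')
        then have ey: "f = e" "y = (p', w)" using that(2) x by (auto simp: down_def)
        have "awalk (src x) (e # p') w" using X_awalk[of p w] that(1) x Cons ey by simp
        note d = awalk_ConsD[OF this]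
        have last: "\<not> chosen (last (e # p'))" using that(1) x Cons ey by (simp add: X_def)
        have "y \<in> X" using d(3) w last ey by (auto simp: X_def split: if_splits)
        moreover have "src y = head E e" using src_awalk[OF d(3)] ey by simp
        moreover have "up e y = x" using last x Cons ey by (auto simp: up_def)
        ultimately show ?thesis using d(1) by blast
      qed
    qed
    show "down x \<noteq> None" if "x \<in> X" "regular_vertex E (src x)" for x
      using that by (cases x) (auto simp: down_def src_def split: list.split)
  qed
  have "(\<exists>x\<in>X. src x = v) \<longleftrightarrow> v \<in> M" for v
    using src_M Nil_X[of v] by (force simp: src_def)
  then have "live {a\<in>A. \<forall>\<xi>. B.rep a \<xi> = (\<lambda>x. 0)} = M"
    using M_sub B.vx_annihilates_iff by (auto simp: live_def)
  then show ?thesis using B.bi_ideal_annihilator_rep by blast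
qed

text \<open>By maximality every ideal strictly above \<open>P\<close> contains a vertex of
  \<open>M\<close>. Two such ideals with product in \<open>P\<close> would share a vertex
  \<open>w\<close> of \<open>M\<close> that is reachable from a vertex of each, and
  \<open>w = w w\<close> would be in \<open>P\<close>.\<close>

lemma prime_with_live:
  assumes M: "maximal_tail E M" "M \<noteq> {}"
  shows "\<exists>P. elementwise_prime P \<and> live P = M"
proof -
  define F where "F = {I. bi_ideal I \<and> live I = M}"
  have "\<exists>P\<in>F. \<forall>I\<in>F. P \<subseteq> I \<longrightarrow> I = P"
  proof (rule subset_Zorn_nonempty)
    show "F \<noteq> {}" using ideal_avoiding_maximal_tail[OF M(1)] by (auto simp: F_def)
    fix C assume C: "C \<noteq> {}" "subset.chain F C"
    have CF: "C \<subseteq> F" and lin: "\<And>X Y. X \<in> C \<Longrightarrow> Y \<in> C \<Longrightarrow> X \<subseteq> Y \<or> Y \<subseteq> X"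
      using C by (auto simp: subset.chain_def)
    have bi: "bi_ideal X" and liv: "live X = M" if "X \<in> C" for X using that CF by (auto simp: F_def)
    have "additive_closed (\<Union>C)"
      unfolding additive_closed_def
    proof (intro conjI ballI)
      obtain X where "X \<in> C" using C(1) by blast
      then show "0 \<in> \<Union>C" using additive_closed_zero[OF bi_idealD(2)[OF bi]] by blast
      fix x y assume "x \<in> \<Union>C" "y \<in> \<Union>C"
      then obtain X where "X \<in> C" "x \<in> X" "y \<in> X" using lin by blast
      then show "x - y \<in> \<Union>C" using additive_closed_diff[OF bi_idealD(2)[OF bi]] by blast
    qed
    moreover have "a * x \<in> \<Union>C" "x * a \<in> \<Union>C" if "a \<in> A" "x \<in> \<Union>C" for a x
      using that bi_idealD(5,6)[OF bi] by blast+
    moreover have "N \<subseteq> \<Union>C" "\<Union>C \<subseteq> A" using C(1) bi_idealD(3,4)[OF bi] by blast+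
    ultimately have "bi_ideal (\<Union>C)" unfolding bi_ideal_def left_ideal_def by blast
    moreover have "live (\<Union>C) = M" using C(1) liv unfolding live_def by blast
    ultimately show "\<Union>C \<in> F" by (simp add: F_def)
  qed
  then obtain P where "P \<in> F" and max: "\<And>I. I \<in> F \<Longrightarrow> P \<subseteq> I \<Longrightarrow> I = P" by meson
  then have P: "bi_ideal P" "live P = M" by (auto simp: F_def)
  have hits: "\<exists>v\<in>M. vx v \<in> I" if I: "bi_ideal I" "P \<subseteq> I" "I \<noteq> P" for I
  proof (rule ccontr)
    assume "\<not> ?thesis"
    then have "live I = M" using P(2) I(2) by (auto simp: live_def)
    then show False using max[of I] I by (auto simp: F_def)
  qed
  have "x \<in> P \<or> y \<in> P" if x: "x \<in> A" and y: "y \<in> A" and xy: "\<forall>a\<in>A. x * a * y \<in> P" for x y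
  proof (rule ccontr)
    assume "\<not> ?thesis"
    then have xP: "x \<notin> P" and yP: "y \<notin> P" by auto
    define B where "B = {a\<in>A. \<forall>b\<in>A. a * b * y \<in> P}"
    have B: "bi_ideal B" "P \<subseteq> B" unfolding B_def by (rule left_annihilator_mod[OF P(1) y bi_ideal_N])+
    define D where "D = {b\<in>A. \<forall>a\<in>B. a * b \<in> P}"
    have D: "bi_ideal D" "P \<subseteq> D" unfolding D_def by (rule left_annihilator_mod[OF P(1) y B(1)])+
    have "x \<in> B" using x xy by (simp add: B_def)
    then obtain u where u: "u \<in> M" "vx u \<in> B" using hits[OF B] xP by blast
    have "y \<in> D"
    proof -
      obtain e where e: "e \<in> A" "e * y \<approx> y" using left_unit[OF y] by (auto simp: eqv_def)
      have "a * y \<in> P" if a: "a \<in> B" for a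
      proof -
        have aA: "a \<in> A" using a by (simp add: B_def)
        have "a * e * y \<in> P" using a e by (auto simp: B_def)
        then show ?thesis
          using bi_ideal_eqv[OF P(1) eqv_left[OF A_in_alg[OF aA] e(2)]] by (simp add: mult.assoc)
      qed
      then show ?thesis using y by (simp add: D_def)
    qed
    then obtain v where v: "v \<in> M" "vx v \<in> D" using hits[OF D] yP by blast
    obtain w where w: "w \<in> M" "u \<rightarrow>\<^sup>*\<^bsub>E\<^esub> w" "v \<rightarrow>\<^sup>*\<^bsub>E\<^esub> w"
      using M(1) u v unfolding maximal_tail_def by blast
    then have "vx w \<in> B" "vx w \<in> D"
      using bi_ideal_vx_path(1)[OF B(1) _ u(2)] bi_ideal_vx_path(1)[OF D(1) _ v(2)] by (auto simp: reachable_awalk)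
    then have "vx w * vx w \<in> P" by (auto simp: D_def)
    moreover have "w \<in> verts E" "vx w \<notin> P" using w(1) P(2) by (auto simp: live_def)
    ultimately show False using bi_ideal_eqv[OF P(1) eqv_vx_idem] by blast
  qed
  moreover have "P \<noteq> A" using M(2) P(2) by (auto simp: live_def)
  ultimately have "elementwise_prime P" using P(1) unfolding elementwise_prime_def by blast
  then show ?thesis using P(2) by blast
qed

section \<open>From a primitive ideal to the Countable Separation Property\<close>

definition endpoint :: "'v \<Rightarrow> 'e list \<Rightarrow> 'v"
  where "endpoint u p = (if p = [] then u else head E (last p))"

lemma endpoint_awalk: "awalk u p v \<Longrightarrow> endpoint u p = v"
proof (induction p arbitrary: u)
  case (Cons e p)
  then show ?case using awalk_ConsD[OF Cons.prems] by (cases p) (auto simp: endpoint_def awalk_Nil_iff)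
qed (simp add: endpoint_def awalk_Nil_iff)

text \<open>Computed from the initial segments of the list, so the set is finite for every list of
  edges.\<close>

definition on_path :: "'v \<Rightarrow> 'e list \<Rightarrow> 'v set"
  where "on_path u p = (\<lambda>i. endpoint u (take i p)) ` {..length p}"

lemma on_path_prefix: "awalk u p v \<Longrightarrow> v \<in> on_path u (p @ q)"
  using endpoint_awalk[of u p v] by (auto simp: on_path_def intro!: image_eqI[of _ _ "length p"])

lemma mon_product_not_in_ideal:
  assumes I: "bi_ideal I" and a: "a \<in> A" "a \<approx> sum_list (map mon ts)" "\<forall>t\<in>set ts. valid t"
    and b: "b \<in> A" "b \<approx> sum_list (map mon zs)" "\<forall>z\<in>set zs. valid z"
    and x: "x \<in> alg" and y: "y \<in> alg" and ne: "x * a * b * y \<notin> I"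
  shows "\<exists>t\<in>set ts. \<exists>z\<in>set zs. x * mon t * mon z * y \<notin> I"
proof (rule ccontr)
  assume "\<not> ?thesis"
  then have *: "x * mon t * mon z * y \<in> I" if "t \<in> set ts" "z \<in> set zs" for t z using that by blast
  have "x * mon t * sum_list (map mon zs) * y = sum_list (map (\<lambda>z. x * mon t * mon z * y) zs)" for t
    by (induction zs) (auto simp: distrib_left distrib_right)
  then have 1: "x * mon t * sum_list (map mon zs) * y \<in> I" if "t \<in> set ts" for t
    using bi_ideal_sum_list[OF I *[OF that]] by simp
  have "x * sum_list (map mon ts) * sum_list (map mon zs) * y =
      sum_list (map (\<lambda>t. x * mon t * sum_list (map mon zs) * y) ts)"
    by (induction ts) (auto simp: distrib_left distrib_right)
  then have 2: "x * sum_list (map mon ts) * sum_list (map mon zs) * y \<in> I"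
    using bi_ideal_sum_list[OF I 1] by simp
  have "sum_list (map mon ts) \<in> A"
    using a(3) by (induction ts) (auto intro: A_plus mon_A A_zero)
  then have "x * sum_list (map mon ts) \<in> alg" using x alg_mult A_in_alg by blast
  then have "x * sum_list (map mon ts) * b \<approx> x * sum_list (map mon ts) * sum_list (map mon zs)"
    using b(2) by (intro eqv_left)
  moreover have "x * a * b \<approx> x * sum_list (map mon ts) * b"
    using a(2) x A_in_alg[OF b(1)] by (intro eqv_right eqv_left)
  ultimately have "x * a * b * y \<approx> x * sum_list (map mon ts) * sum_list (map mon zs) * y"
    using y eqv_right eqv_trans by meson
  then show False using 2 ne bi_ideal_eqv[OF I] by blast
qed

text \<open>
  In a simple module with annihilator \<open>P\<close>, a vector \<open>s\<close> satisfies \<open>s = a\<^sub>u u b\<^sub>u s\<close> for every live vertex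
  \<open>u\<close>, so that no product \<open>c b\<^sub>c a\<^sub>u u\<close> lies in \<open>P\<close>. Hence a path that occurs in \<open>b\<^sub>c\<close> is comparable with
  one of the finitely many paths that occur in \<open>a\<^sub>u\<close>.
\<close>

lemma live_pairing:
  assumes mm: "modular_maximal T w0" and P: "P = core T"
  shows "\<exists>a b. \<forall>u\<in>live P. a u \<in> A \<and> b u \<in> A \<and> (\<forall>c\<in>live P. vx c * b c * a u * vx u \<notin> P)"
proof -
  note m = modular_maximalD[OF mm]
  note T = left_idealD[OF m(1)]
  have I: "bi_ideal P" and PT: "P \<subseteq> T" using bi_ideal_core[OF mm] P by auto
  have "\<exists>a b. a \<in> A \<and> b \<in> A \<and> a * (vx u * b) - w0 \<in> T" if u: "u \<in> live P" for u
  proof -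
    have "vx u \<in> A" "vx u \<notin> P" using u by (auto simp: live_def)
    then obtain b where b: "b \<in> A" "vx u * b \<notin> T" by (auto simp: P core_def)
    then obtain a where "a \<in> A" "a * (vx u * b) - w0 \<in> T"
      using m(5)[OF A_mult[OF \<open>vx u \<in> A\<close> b(1)]] by blast
    then show ?thesis using b by blast
  qed
  then obtain a b where ab: "\<And>u. u \<in> live P \<Longrightarrow> a u \<in> A \<and> b u \<in> A \<and> a u * (vx u * b u) - w0 \<in> T"
    by metis
  have "vx c * b c * a u * vx u \<notin> P" if c: "c \<in> live P" and u: "u \<in> live P" for c u
  proof
    assume "vx c * b c * a u * vx u \<in> P"
    \<comment> \<open>Completed by \<open>a c\<close> and \<open>b u\<close>, the product consists
      of two factors that both fix the chosen vector, so it cannot annihilate this vector.\<close>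
    then have "a c * (vx c * b c * a u * vx u) * b u \<in> P"
      using ab c u bi_idealD(5,6)[OF I] by blast
    then have 1: "(a c * (vx c * b c)) * (a u * (vx u * b u)) \<in> T" using PT by (auto simp: mult.assoc)
    let ?x = "a c * (vx c * b c)" and ?y = "a u * (vx u * b u)"
    have xA: "?x \<in> A" using ab[OF c] c by (auto simp: live_def intro!: A_mult)
    have "?x * (?y - w0) \<in> T" using T(4)[OF xA] ab[OF u] by blast
    from additive_closed_diff[OF T(1) 1 this] have "?x * w0 \<in> T" by (simp add: right_diff_distrib)
    then have "?x \<in> T" using additive_closed_cong[OF T(1) m(4)[OF xA]] by simp
    then have "w0 \<in> T" using additive_closed_cong[OF T(1)] ab[OF c] by blast
    then show False using m(3) by blast
  qed
  then show ?thesis using ab by blast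
qed

text \<open>If the property fails, every countable set of live vertices is out of reach of some live
  vertex, chosen by \<open>n\<close>. The countable set \<open>C\<close> is closed under taking the
  live vertices on ghost paths of \<open>b c\<close> and under \<open>n\<close> on finite subsets.
  Let \<open>u\<close> reach no vertex of \<open>C\<close>. The real paths of \<open>a u\<close>
  meet only a finite set \<open>D\<close> of vertices, so a \<open>c\<close> that does not reach
  \<open>D \<inter> C\<close> is still found inside \<open>C\<close>, although \<open>D\<close>
  depends on \<open>u\<close> and \<open>u\<close> on \<open>C\<close>. A surviving product of
  monomials for \<open>c\<close> and \<open>u\<close> contradicts one of the two choices.\<close>

lemma csp_of_primitive:
  assumes mm: "modular_maximal T w0" and P: "P = core T"
  shows "countable_separation E (live P)"
proof (rule ccontr)
  assume nocsp: "\<not> countable_separation E (live P)"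
  have I: "bi_ideal P" using bi_ideal_core[OF mm] P by auto
  obtain a b where ab: "\<And>u. u \<in> live P \<Longrightarrow> a u \<in> A \<and> b u \<in> A"
    and ne: "\<And>c u. c \<in> live P \<Longrightarrow> u \<in> live P \<Longrightarrow> vx c * b c * a u * vx u \<notin> P"
    using live_pairing[OF mm P] by blast
  have "\<exists>ts. (\<forall>t\<in>set ts. valid t) \<and> x \<approx> sum_list (map mon ts)" if "x \<in> A" for x
    using spanned_A[OF that] by (simp add: spanned_def)
  then obtain ms where ms: "\<And>x. x \<in> A \<Longrightarrow> (\<forall>t\<in>set (ms x). valid t) \<and> x \<approx> sum_list (map mon (ms x))"
    by metis
  have avoid: "\<exists>u\<in>live P. \<forall>v\<in>C. \<not> u \<rightarrow>\<^sup>*\<^bsub>E\<^esub> v" if "countable C" "C \<subseteq> live P" for C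
  proof (rule ccontr)
    assume "\<not> ?thesis"
    then have "\<forall>u\<in>live P. \<exists>v\<in>C. u \<rightarrow>\<^sup>*\<^bsub>E\<^esub> v" by blast
    then have "countable_separation E (live P)"
      unfolding countable_separation_def using that by (intro exI[of _ C] conjI)
    then show False using nocsp by contradiction
  qed
  define n where "n C = (SOME u. u \<in> live P \<and> (\<forall>v\<in>C. \<not> u \<rightarrow>\<^sup>*\<^bsub>E\<^esub> v))" for C
  have n: "n C \<in> live P \<and> (\<forall>v\<in>C. \<not> n C \<rightarrow>\<^sup>*\<^bsub>E\<^esub> v)" if "countable C" "C \<subseteq> live P" for C
    unfolding n_def by (rule someI_ex) (use avoid[OF that] in blast)
  define V where "V = (\<lambda>(k :: 'k, u :: 'v, p :: 'e list, v, q). on_path v q)"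
  define step where "step C = C \<union> (\<Union>c\<in>C. \<Union>t\<in>set (ms (b c)). V t \<inter> live P) \<union> n ` {F. finite F \<and> F \<subseteq> C}" for C
  define stage where "stage i = (step ^^ i) {}" for i
  define C where "C = (\<Union>i. stage i)"
  have finV: "finite (V t)" for t by (cases t) (auto simp: V_def on_path_def)
  have stage: "countable (stage i) \<and> stage i \<subseteq> live P" for i
  proof (induction i)
    case (Suc i)
    have "countable (step (stage i))"
      unfolding step_def using Suc finV
      by (intro countable_Un countable_UN countable_image countable_Collect_finite_subset)
        (auto intro: countable_finite countable_subset[of _ "V _"])
    moreover have "step (stage i) \<subseteq> live P"
      unfolding step_def using Suc n by (auto intro: countable_finite)
    ultimately show ?case by (simp add: stage_def)
  qed (simp add: stage_def)
  have mono: "stage i \<subseteq> stage j" if "i \<le> j" for i j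
    using that
  proof (induction j rule: dec_induct)
    case (step j)
    then show ?case by (auto simp: stage_def step_def)
  qed simp
  have C: "countable C" "C \<subseteq> live P" using stage by (auto simp: C_def)
  have C_paths: "V t \<inter> live P \<subseteq> C" if ct: "c \<in> C" "t \<in> set (ms (b c))" for c t
  proof -
    obtain i where "c \<in> stage i" using ct by (auto simp: C_def)
    then have "V t \<inter> live P \<subseteq> stage (Suc i)" using ct by (auto simp: stage_def step_def)
    then show ?thesis by (auto simp: C_def)
  qed
  have C_avoid: "n F \<in> C" if "finite F" "F \<subseteq> C" for F
  proof -
    have "\<exists>i. F \<subseteq> stage i"
      using that
    proof (induction F rule: finite_induct)
      case (insert x F)
      then obtain i j where "F \<subseteq> stage i" "x \<in> stage j" by (auto simp: C_def)
      then have "insert x F \<subseteq> stage (max i j)" using mono[of i "max i j"] mono[of j "max i j"] by auto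
      then show ?case by blast
    qed simp
    then obtain i where "F \<subseteq> stage i" by blast
    then have "n F \<in> stage (Suc i)" using that(1) by (auto simp: stage_def step_def)
    then show ?thesis by (auto simp: C_def)
  qed
  obtain u where u: "u \<in> live P" "\<And>v. v \<in> C \<Longrightarrow> \<not> u \<rightarrow>\<^sup>*\<^bsub>E\<^esub> v" using avoid[OF C] by blast
  define D where "D = (\<Union>z\<in>set (ms (a u)). case z of (k, u2, p2, v2, q2) \<Rightarrow> on_path u2 p2)"
  have "finite D" by (auto simp: D_def on_path_def split: prod.split)
  then have F: "finite (D \<inter> C)" "D \<inter> C \<subseteq> C" by auto
  define c where "c = n (D \<inter> C)"
  have c: "c \<in> C" "c \<in> live P" "\<And>v. v \<in> D \<inter> C \<Longrightarrow> \<not> c \<rightarrow>\<^sup>*\<^bsub>E\<^esub> v"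
    using C_avoid[OF F] n[of "D \<inter> C"] F C by (auto simp: c_def intro: countable_finite)
  have cu: "c \<in> verts E" "u \<in> verts E" using c(2) u(1) by (auto simp: live_def)
  obtain t z where t: "t \<in> set (ms (b c))" and z: "z \<in> set (ms (a u))"
    and tz: "vx c * mon t * mon z * vx u \<notin> P"
    using mon_product_not_in_ideal[OF I _ _ _ _ _ _ _ _ ne[OF c(2) u(1)], of "ms (b c)" "ms (a u)"]
      ab[OF c(2)] ab[OF u(1)] ms cu by auto
  have "valid t" "valid z" using ms ab c(2) u(1) t z by blast+
  then obtain k1 u1 p1 v1 q1 w1 k2 u2 p2 v2 q2 w2 where
    teq: "t = (k1, u1, p1, v1, q1)" "awalk u1 p1 w1" "awalk v1 q1 w1" and
    zeq: "z = (k2, u2, p2, v2, q2)" "awalk u2 p2 w2" "awalk v2 q2 w2"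
    by (cases t rule: prod_cases5, cases z rule: prod_cases5) (auto simp: valid_def)
  note in_alg = path_in_alg[OF teq(2)] path_in_alg[OF teq(3)] path_in_alg[OF zeq(2)] path_in_alg[OF zeq(3)]
  have mons: "mon t \<in> alg" "mon z \<in> alg" using \<open>valid t\<close> \<open>valid z\<close> mon_A A_in_alg by auto
  have split: "vx c * mon t * mon z * vx u =
    scal k1 * (scal k2 * ((vx c * pth u1 p1) * (gpth v1 q1 * pth u2 p2) * (gpth v2 q2 * vx u)))"
  proof -
    have sc: "x * (scal k * y) = scal k * (x * y)" for x y :: "('v, 'e, 'k) free_lpa" and k
      using scal_commute[of k x] by (simp flip: mult.assoc)
    show ?thesis
      by (simp add: mon_def teq(1) zeq(1) mult.assoc sc[of "vx c"] sc[of "pth u1 p1"] sc[of "gpth v1 q1"])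
  qed
  have in_P: False if "(vx c * pth u1 p1) * (gpth v1 q1 * pth u2 p2) * (gpth v2 q2 * vx u) \<in> P"
    using tz split bi_ideal_alg(1)[OF I bi_ideal_alg(1)[OF I that scal_alg] scal_alg] by simp
  have N0: "x \<in> P" if "x \<approx> 0" for x using that bi_idealD(3)[OF I] by (auto simp: eqv_zero_iff)
  have fac: "vx c * pth u1 p1 \<in> alg" "gpth v1 q1 * pth u2 p2 \<in> alg" "gpth v2 q2 * vx u \<in> alg"
    using in_alg cu by (simp_all add: alg_mult)
  have u1: "u1 = c"
  proof (rule ccontr)
    assume "u1 \<noteq> c"
    then have "vx c * pth u1 p1 \<in> P" using vx_pth_orth(1)[OF teq(2) cu(1)] N0 by auto
    from in_P[OF bi_ideal_alg(2)[OF I bi_ideal_alg(2)[OF I this fac(2)] fac(3)]] show False .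
  qed
  have v2: "v2 = u"
  proof (rule ccontr)
    assume "v2 \<noteq> u"
    then have "gpth v2 q2 * vx u \<in> P" using vx_pth_orth(2)[OF zeq(3) cu(2)] N0 by auto
    from in_P[OF bi_ideal_alg(1)[OF I this alg_mult[OF fac(1,2)]]] show False .
  qed
  have comp: "\<not> gpth v1 q1 * pth u2 p2 \<approx> 0"
  proof
    assume "gpth v1 q1 * pth u2 p2 \<approx> 0"
    then have "gpth v1 q1 * pth u2 p2 \<in> P" by (rule N0)
    from in_P[OF bi_ideal_alg(2)[OF I bi_ideal_alg(1)[OF I this fac(1)] fac(3)]] show False .
  qed
  have u2: "u2 = v1" using comp gpth_pth_source_orth[OF teq(3) zeq(2)] by blast
  have w1: "w1 \<in> live P"
  proof (rule ccontr)
    assume "w1 \<notin> live P"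
    then have "vx w1 \<in> P" using teq(2) by (auto simp: live_def)
    then have "mon t \<in> P" unfolding teq(1) by (rule mon_in_ideal[OF I teq(2,3)])
    from bi_ideal_alg(2)[OF I bi_ideal_alg(2)[OF I bi_ideal_alg(1)[OF I this gens_alg(1)[OF cu(1)]]
        mons(2)] gens_alg(1)[OF cu(2)]]
    show False using tz by contradiction
  qed
  have w2: "w2 \<in> live P"
  proof (rule ccontr)
    assume "w2 \<notin> live P"
    then have "vx w2 \<in> P" using zeq(2) by (auto simp: live_def)
    then have "mon z \<in> P" unfolding zeq(1) by (rule mon_in_ideal[OF I zeq(2,3)])
    from bi_ideal_alg(2)[OF I bi_ideal_alg(1)[OF I this alg_mult[OF gens_alg(1)[OF cu(1)] mons(1)]]
        gens_alg(1)[OF cu(2)]]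
    show False using tz by contradiction
  qed
  consider (long) r where "p2 = q1 @ r" | (short) r where "q1 = p2 @ r"
    using comp gpth_pth_orth[OF teq(3)] zeq(2) u2 by blast
  then show False
  proof cases
    case long
    \<comment> \<open>The end of the ghost path lies on the real path from \<open>a u\<close>, so
      \<open>c\<close> reaches a vertex of \<open>D \<inter> C\<close>.\<close>
    have "w1 \<in> V t" using on_path_prefix[OF teq(3), of "[]"] by (simp add: V_def teq(1))
    then have "w1 \<in> C" using C_paths[OF c(1) t] w1 by blast
    moreover have "w1 \<in> on_path u2 p2" using on_path_prefix[OF teq(3)] long u2 by simp
    then have "w1 \<in> D" using z unfolding D_def zeq(1) by force
    moreover have "c \<rightarrow>\<^sup>*\<^bsub>E\<^esub> w1" using teq(2) u1 by (auto simp: reachable_awalk)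
    ultimately show False using c(3) by blast
  next
    case short
    \<comment> \<open>The end of the real path lies on the ghost path from \<open>b c\<close>, so
      \<open>u\<close> reaches a vertex of \<open>C\<close>.\<close>
    have "w2 \<in> V t" using on_path_prefix[OF zeq(2)] short u2 by (simp add: V_def teq(1))
    then have "w2 \<in> C" using C_paths[OF c(1) t] w2 by blast
    moreover have "u \<rightarrow>\<^sup>*\<^bsub>E\<^esub> w2" using zeq(3) v2 by (auto simp: reachable_awalk)
    ultimately show False using u(2) by blast
  qed
qed

lemma primes_primitive_imp:
  assumes "\<And>P. elementwise_prime P \<Longrightarrow> \<exists>T w. modular_maximal T w \<and> P = core T"
  shows "condition_K E" "maximal_tail E M \<Longrightarrow> countable_separation E M"
proof -
  show "condition_K E" using condition_K_necessary assms by blast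
  assume M: "maximal_tail E M"
  show "countable_separation E M"
  proof (cases "M = {}")
    \<comment> \<open>The definition of a maximal tail admits the empty set, which is not the set of
      live vertices of a proper ideal.\<close>
    case True
    then show ?thesis by (auto simp: countable_separation_def)
  next
    case False
    then obtain P where "elementwise_prime P" "live P = M" using prime_with_live[OF M] by blast
    then show ?thesis using assms csp_of_primitive by blast
  qed
qed

end

theorem corollary4p4:
  fixes E :: "('v, 'e) pre_digraph"
  assumes "wf_digraph E"
  shows "(\<forall>P. prime_ideal (leavitt_path_algebra TYPE('k::field) E) P \<longrightarrow>
              primitive_ideal (leavitt_path_algebra TYPE('k) E) P) \<longleftrightarrow>
         condition_K E \<and> (\<forall>M. maximal_tail E M \<longrightarrow> countable_separation E M)"
proof -
  interpret leavitt E "TYPE('k)" using assms by (simp add: leavitt_def)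
  show ?thesis
    unfolding primes_primitive_iff
    using prime_imp_primitive primes_primitive_imp by blast
qed

end
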